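(* Let $l:(0,\infty)\to[0,\infty)$ be measurable, let $d\lambda(s)=l(s)s^{-1}\,ds$ on $\mathbb R_+=(0,\infty)$, and assume: (a) $\int_{\mathbb R_+} l(s)\min\{1,s^{-1}\}\,ds<\infty$; (b) $l(s)>0$ for all $s\in\mathbb R_+$; (c) for each $n\in\mathbb N$ there exists $\varepsilon>0$ such that $\sup_{r\in[1/n,\,n]}\int_{(0,\varepsilon)}|l(rs)-l(s)|\,s^{-1}\,ds<\infty$. Then for every $\theta\in C_0(X\to\mathbb R_+)$ the map $\eta\mapsto\theta\cdot\eta$ maps $\mathbb K(X)$ into itself, the pushforward $\mu_\lambda^\theta$ of $\mu_\lambda$ under this map is equivalent to $\mu_\lambda$, and for $\mu_\lambda$-a.e. $\eta\in\mathbb K(X)$ \[ \frac{d\mu_\lambda^\theta}{d\mu_\lambda}(\eta)=\exp\Bigg[\sum_{x\in\tau(\eta)}\log\Big(\frac{l(s_x/\theta(x))}{l(s_x)}\Big)+\int_X\int_{\mathbb R_+}\big(l(s)-l(s/\theta(x))\big)s^{-1}\,ds\,dx\Bigg], \] where the series converges absolutely for $\mu_\lambda$-a.e. $\eta$ and the double integral converges absolutely.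
   Context: $X$ is a separable, connected, oriented, non-compact $C^\infty$ Riemannian manifold with Riemannian volume $dx$. $\mathbb M(X)$ denotes the space of Radon measures on $X$ with the vague topology and its Borel $\sigma$-algebra. For a measure $\lambda$ on $\mathbb R_+=(0,\infty)$ with $\int\min\{1,s\}\,d\lambda(s)<\infty$, $\mu_\lambda$ is the unique probability measure on $\mathbb M(X)$ with $\int e^{i\langle\varphi,\eta\rangle}d\mu_\lambda(\eta)=\exp\big[\int_X\int_{\mathbb R_+}(e^{is\varphi(x)}-1)\,d\lambda(s)\,dx\big]$ for all continuous compactly supported $\varphi$, where $\langle\varphi,\eta\rangle=\int\varphi\,d\eta$ (law of a measure-valued Lévy process with intensity $\lambda$). $\mathbb K(X)$ is the set of measures $\eta=\sum_i s_i\delta_{x_i}\in\mathbb M(X)$ with $s_i>0$, distinct points $x_i$, at most countably many; $\tau(\eta)=\{x_i\}$ and $s_x=\eta(\{x\})$ for $x\in\tau(\eta)$. It is known that $\mu_\lambda(\mathbb K(X))=1$. $C_0(X\to\mathbb R_+)$ is the multiplicative group of continuous functions $X\to(0,\infty)$ equal to $1$ outside a compact set; $\theta$ acts on measures by $d(\theta\cdot\eta)=\theta\,d\eta$. *)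

theory Defs
  imports "HOL-Probability.Probability"
begin

text \<open>The manifold X is modelled by a type 'a (a proper metric space, class heine_borel)
  together with a Radon measure dx playing the role of the Riemannian volume.\<close>

definition radon_measures :: "'a::heine_borel measure set" where
  "radon_measures = {\<eta>. sets \<eta> = sets borel \<and> (\<forall>K. compact K \<longrightarrow> emeasure \<eta> K < \<infinity>)}"

definition Cc :: "('a::heine_borel \<Rightarrow> real) set" where
  "Cc = {\<phi>. continuous_on UNIV \<phi> \<and> (\<exists>K. compact K \<and> (\<forall>x. x \<notin> K \<longrightarrow> \<phi> x = 0))}"

definition pairing :: "('a \<Rightarrow> real) \<Rightarrow> 'a measure \<Rightarrow> real" where
  "pairing \<phi> \<eta> = integral\<^sup>L \<eta> \<phi>"

text \<open>M(X) with the Borel sigma-algebra of the vague topology, i.e. the sigma-algebra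
  generated by the maps eta |-> <phi, eta>, phi in Cc.\<close>
definition vague_space :: "'a::heine_borel measure measure" where
  "vague_space = sigma radon_measures
     {{\<eta> \<in> radon_measures. pairing \<phi> \<eta> \<in> B} | \<phi> B. \<phi> \<in> Cc \<and> B \<in> sets borel}"

definition levy_intensity :: "(real \<Rightarrow> real) \<Rightarrow> real measure" where
  "levy_intensity l = density (restrict_space lborel {0<..}) (\<lambda>s. ennreal (l s / s))"

definition is_levy_law ::
    "'a::heine_borel measure \<Rightarrow> real measure \<Rightarrow> 'a measure measure \<Rightarrow> bool" where
  "is_levy_law dx lam P \<longleftrightarrow> prob_space P \<and> sets P = sets vague_space \<and>
     (\<forall>\<phi>\<in>Cc. (\<integral>\<eta>. cis (pairing \<phi> \<eta>) \<partial>P) =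
        exp (\<integral>x. (\<integral>s. (cis (s * \<phi> x) - 1) \<partial>lam) \<partial>dx))"

definition levy_law :: "'a::heine_borel measure \<Rightarrow> real measure \<Rightarrow> 'a measure measure" where
  "levy_law dx lam = (THE P. is_levy_law dx lam P)"

definition atoms :: "'a measure \<Rightarrow> 'a set" where
  "atoms \<eta> = {x. emeasure \<eta> {x} > 0}"

definition atom_mass :: "'a measure \<Rightarrow> 'a \<Rightarrow> real" where
  "atom_mass \<eta> x = enn2real (emeasure \<eta> {x})"

text \<open>K(X): Radon measures of the form sum_i s_i delta_{x_i}, s_i > 0, x_i distinct,
  at most countably many.\<close>
definition discrete_radon :: "'a::heine_borel measure set" where
  "discrete_radon = {\<eta> \<in> radon_measures. countable (atoms \<eta>) \<and>
     (\<forall>A\<in>sets borel. emeasure \<eta> A =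
        (\<integral>\<^sup>+x. emeasure \<eta> {x} * indicator (A \<inter> atoms \<eta>) x \<partial>count_space UNIV))}"

definition C0pos :: "('a::heine_borel \<Rightarrow> real) set" where
  "C0pos = {\<theta>. continuous_on UNIV \<theta> \<and> (\<forall>x. \<theta> x > 0) \<and>
     (\<exists>K. compact K \<and> (\<forall>x. x \<notin> K \<longrightarrow> \<theta> x = 1))}"

definition theta_action :: "('a \<Rightarrow> real) \<Rightarrow> 'a measure \<Rightarrow> 'a measure" where
  "theta_action \<theta> \<eta> = density \<eta> (\<lambda>x. ennreal (\<theta> x))"

end

theory Submission
  imports Defs
begin

text \<open>
  The law is realised as \<open>\<eta> = \<Sum>\<^sub>i s\<^sub>i \<delta>\<^sub>x\<^sub>i\<close>, where \<open>(x\<^sub>i, s\<^sub>i)\<close> are the points of a Poisson process with intensity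
  \<open>N = dx \<otimes> l(s)/s ds\<close>. For \<open>L(x,s) = ln (l(s/\<theta>(x))/l(s))\<close> the exponential formula
  \<open>E exp (\<Sum>\<^sub>i z(x\<^sub>i,s\<^sub>i)) = exp (\<integral> (exp z - 1) dN)\<close>, applied to \<open>z = L + \<i> s \<phi>\<close>, shows that the measure with density
  \<open>exp (\<Sum>\<^sub>i L(x\<^sub>i,s\<^sub>i) + \<integral> (1 - exp L) dN)\<close> has the characteristic functional of the image law, after the
  substitution \<open>s \<mapsto> \<theta>(x) s\<close>; and characteristic functionals determine measures on \<open>M(X)\<close>. The points
  \<open>x\<^sub>i\<close> are almost surely distinct because \<open>dx\<close> has no atoms, so \<open>s\<^sub>i = \<eta>{x\<^sub>i}\<close> and the density is a
  measurable function of \<open>\<eta>\<close> alone.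
\<close>

subsection \<open>Finite measures determined by characteristic functionals\<close>

text \<open>\<open>levy_law\<close> is a definite description, so nothing can be proved about it
  before a measure with the prescribed characteristic functional has been built and shown to be
  unique; hence the explicit process. The intensity N may have infinite mass, so every formula is
  written with exp z - 1, never with exp z alone. The hypotheses control only the N-integral of |exp
  L - 1|, not that of |L|: near s = 0 by (c) with r = 1/\<theta>(x), for large s by the tail bound
  contained in (a), and where \<theta> = 1 the integrand vanishes. As min(1,|L|) is at most 2 |exp L
  - 1|, the truncated sum over the points has finite mean; it then has only finitely many terms of
  size at least 1 almost surely, and the full series converges absolutely. The second obstacle is
  measurability: the sigma-algebra on M(X) sees only pairings with continuous functions. From these
  come the masses of compact sets, then integrals against \<eta> of integrands that depend on \<eta>
  themselves, then point masses and sums over atoms.\<close>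

lemma borel_measurable_cis [measurable]: "cis \<in> borel_measurable borel"
  by (intro borel_measurable_continuous_onI continuous_intros)

text \<open>Reduction to the uniqueness theorem for probability measures: t = 0 shows that the total
  masses agree, and both measures are divided by the common mass. Mass 0 cannot be normalised and is
  treated apart.\<close>

lemma finite_measure_eqI_char:
  fixes A B :: "real measure"
  assumes finA: "finite_measure A" and finB: "finite_measure B"
    and setsA[measurable_cong]: "sets A = sets borel" and setsB[measurable_cong]: "sets B = sets borel"
    and eq: "\<And>t. (\<integral>x. cis (t * x) \<partial>A) = (\<integral>x. cis (t * x) \<partial>B)"
  shows "A = B"
proof -
  interpret A: finite_measure A by fact
  interpret B: finite_measure B by fact
  have spaceA: "space A = UNIV" and spaceB: "space B = UNIV"
    using sets_eq_imp_space_eq[OF setsA] sets_eq_imp_space_eq[OF setsB] by auto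
  have "complex_of_real (measure A UNIV) = complex_of_real (measure B UNIV)"
    using eq[of 0] by (simp add: spaceA spaceB scaleR_conv_of_real)
  then have mass: "measure A UNIV = measure B UNIV" by (simp only: of_real_eq_iff)
  show ?thesis
  proof (cases "measure A UNIV = 0")
    case True
    have "emeasure A X = 0" "emeasure B X = 0" for X
      using True mass A.finite_measure_mono[of X UNIV] B.finite_measure_mono[of X UNIV] setsA setsB
      by (auto simp: A.emeasure_eq_measure B.emeasure_eq_measure measure_le_0_iff)
    then show ?thesis using setsA setsB by (intro measure_eqI) auto
  next
    case False
    define c where "c = measure A UNIV"
    have c: "c > 0" using False by (simp add: c_def less_le)
    let ?n = "\<lambda>M. density M (\<lambda>_. ennreal (1 / c))"
    have prob: "real_distribution (?n A)" "real_distribution (?n B)"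
    proof -
      have "prob_space (?n A)"
        using c by (intro prob_spaceI) (auto simp: emeasure_density nn_integral_cmult spaceA
            A.emeasure_eq_measure c_def[symmetric] ennreal_mult[symmetric])
      then show "real_distribution (?n A)"
        by (auto simp: real_distribution_def real_distribution_axioms_def setsA)
      have "prob_space (?n B)"
        using c by (intro prob_spaceI) (auto simp: emeasure_density nn_integral_cmult spaceB
            B.emeasure_eq_measure c_def[symmetric] mass[symmetric] ennreal_mult[symmetric])
      then show "real_distribution (?n B)"
        by (auto simp: real_distribution_def real_distribution_axioms_def setsB)
    qed
    have "char (?n A) = char (?n B)"
    proof
      fix t
      have "char (?n A) t = (1 / c) *\<^sub>R (\<integral>x. cis (t * x) \<partial>A)"
        using c unfolding char_def cis_conv_exp[symmetric] by (subst integral_density) auto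
      moreover have "char (?n B) t = (1 / c) *\<^sub>R (\<integral>x. cis (t * x) \<partial>B)"
        using c unfolding char_def cis_conv_exp[symmetric] by (subst integral_density) auto
      ultimately show "char (?n A) t = char (?n B) t" by (simp add: eq)
    qed
    then have "?n A = ?n B" using Levy_uniqueness prob by blast
    then have e: "emeasure (?n A) X = emeasure (?n B) X" for X by simp
    show ?thesis
    proof (rule measure_eqI)
      fix X assume X: "X \<in> sets A"
      then have "ennreal (1/c) * emeasure A X = ennreal (1/c) * emeasure B X"
        using e[of X] by (simp add: emeasure_density nn_integral_cmult setsA setsB)
      then show "emeasure A X = emeasure B X"
        using c by (subst (asm) ennreal_mult_cancel_left) auto
    qed (simp add: setsA setsB)
  qed
qed

lemma cos_shift_eq_cis: "complex_of_real (cos (g + a)) = (cis a * cis g + cis (- a) * cis (- g)) / 2"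
  by (simp add: complex_eq_iff cos_add)

lemma integrable_cis_finite [simp]:
  assumes "finite_measure P" "g \<in> borel_measurable P"
  shows "integrable P (\<lambda>x. cis (g x))"
proof -
  interpret finite_measure P by fact
  show ?thesis using assms(2) by (intro integrable_const_bound[where B = 1]) auto
qed

text \<open>The indicator of {f in B} is not a combination of exponentials, so \<open>eq\<close>
  does not reach it directly. The weight 1 + cos(h + a) is one, with exponents h, -h and 0. Pushing
  the weighted measure forward along f gives a finite measure on the line whose characteristic
  function uses only t f, t f + h and t f - h, all in \<open>V\<close>. Uniqueness on the line then
  lets B enter.\<close>

lemma char_functional_restrict:
  fixes P Q :: "'b measure" and V :: "('b \<Rightarrow> real) set"
  assumes finP: "finite_measure P" and finQ: "finite_measure Q" and sets_eq: "sets P = sets Q"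
    and meas: "\<And>g. g \<in> V \<Longrightarrow> g \<in> borel_measurable P"
    and lin: "\<And>f g t. f \<in> V \<Longrightarrow> g \<in> V \<Longrightarrow> (\<lambda>x. t * f x + g x) \<in> V"
    and zero: "(\<lambda>x. 0) \<in> V"
    and eq: "\<And>g. g \<in> V \<Longrightarrow> (\<integral>x. cis (g x) \<partial>P) = (\<integral>x. cis (g x) \<partial>Q)"
    and f: "f \<in> V" and g: "g \<in> V" and B[measurable]: "B \<in> sets borel"
  shows "(\<integral>x. cis (g x) \<partial>density P (\<lambda>x. indicator B (f x))) = (\<integral>x. cis (g x) \<partial>density Q (\<lambda>x. indicator B (f x)))"
proof -
  interpret P: finite_measure P by fact
  interpret Q: finite_measure Q by fact
  note sets_eq[measurable_cong]
  have neg: "(\<lambda>x. - h x) \<in> V" if "h \<in> V" for h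
    using lin[OF that zero, of "- 1"] by simp
  have measQ: "h \<in> borel_measurable Q" if "h \<in> V" for h
    using meas[OF that] by (simp add: measurable_cong_sets[OF sets_eq refl])
  have [measurable]: "f \<in> borel_measurable P" "f \<in> borel_measurable Q"
    using meas measQ f by auto
  \<comment> \<open>The summand 1 makes the weight nonnegative, so that it is the density of a
    measure.\<close>
  have wt: "(\<integral>x. indicat_real B (f x) * (1 + cos (h x + a)) \<partial>P) = (\<integral>x. indicat_real B (f x) * (1 + cos (h x + a)) \<partial>Q)"
    if h: "h \<in> V" for h a
  proof -
    have [measurable]: "h \<in> borel_measurable P" "h \<in> borel_measurable Q"
      using meas measQ h by auto
    define w where "w x = 1 + cos (h x + a)" for x
    have w0: "0 \<le> w x" "w x \<le> 2" for x using cos_ge_minus_one[of "h x + a"] cos_le_one[of "h x + a"] unfolding w_def by linarith+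
    have [measurable]: "w \<in> borel_measurable P" "w \<in> borel_measurable Q" by (auto simp: w_def[abs_def])
    have fin: "finite_measure (density M w)" if "finite_measure M" "w \<in> borel_measurable M" for M
    proof -
      interpret finite_measure M by fact
      have "(\<integral>\<^sup>+x. ennreal (w x) \<partial>M) \<le> (\<integral>\<^sup>+x. 2 \<partial>M)"
        using w0 by (intro nn_integral_mono) (simp add: ennreal_le_iff2 flip: ennreal_numeral)
      also have "\<dots> < \<infinity>" by (simp add: ennreal_mult_eq_top_iff less_top[symmetric])
      finally show ?thesis using that by (intro finite_measureI) (auto simp: emeasure_density cong: nn_integral_cong)
    qed
    have cw: "(\<integral>x. cis (t * x) \<partial>distr (density M w) borel f)
       = (\<integral>x. cis (t * f x) \<partial>M) + (cis a * (\<integral>x. cis (t * f x + h x) \<partial>M) + cis (-a) * (\<integral>x. cis (t * f x + - h x) \<partial>M)) / 2"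
      if "finite_measure M" and [measurable]: "w \<in> borel_measurable M" "f \<in> borel_measurable M" "h \<in> borel_measurable M" for M t
    proof -
      interpret finite_measure M by fact
      have "(\<integral>x. cis (t * x) \<partial>distr (density M w) borel f) = (\<integral>x. w x *\<^sub>R cis (t * f x) \<partial>M)"
        using w0 by (subst integral_distr) (auto simp: integral_density)
      also have "\<dots> = (\<integral>x. cis (t * f x) + (cis a * cis (t * f x + h x) + cis (-a) * cis (t * f x + - h x)) / 2 \<partial>M)"
      proof (intro Bochner_Integration.integral_cong refl)
        fix x
        have "complex_of_real (w x) = 1 + (cis a * cis (h x) + cis (- a) * cis (- h x)) / 2"
          unfolding w_def of_real_add of_real_1 cos_shift_eq_cis ..
        then show "w x *\<^sub>R cis (t * f x) = cis (t * f x) + (cis a * cis (t * f x + h x) + cis (-a) * cis (t * f x + - h x)) / 2"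
          unfolding scaleR_conv_of_real cis_mult[symmetric, of "t * f x"] by (simp only:) (simp add: field_simps)
      qed
      also have "\<dots> = (\<integral>x. cis (t * f x) \<partial>M) + (cis a * (\<integral>x. cis (t * f x + h x) \<partial>M) + cis (-a) * (\<integral>x. cis (t * f x + - h x) \<partial>M)) / 2"
        using \<open>finite_measure M\<close> by simp
      finally show ?thesis .
    qed
    have tf: "(\<lambda>x. t * f x) \<in> V" for t using lin[OF f zero, of t] by simp
    have "distr (density P w) borel f = distr (density Q w) borel f"
    proof (rule finite_measure_eqI_char)
      fix t
      show "(\<integral>x. cis (t * x) \<partial>distr (density P w) borel f) = (\<integral>x. cis (t * x) \<partial>distr (density Q w) borel f)"
        by (subst (1 2) cw) (auto simp: finP finQ eq[OF tf] eq[OF lin[OF f h]] eq[OF lin[OF f neg[OF h]], simplified])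
    qed (auto intro!: finite_measure.finite_measure_distr fin finP finQ)
    then have "integral\<^sup>L (distr (density P w) borel f) (indicat_real B) = integral\<^sup>L (distr (density Q w) borel f) (indicat_real B)"
      by simp
    then show ?thesis
      using w0 by (subst (asm) (1 2) integral_distr)
        (auto simp: integral_density w_def[symmetric] mult.commute)
  qed
  have [measurable]: "g \<in> borel_measurable P" "g \<in> borel_measurable Q"
    using meas measQ g by auto
  have int: "integrable M (\<lambda>x. indicat_real B (f x))" "integrable M (\<lambda>x. indicat_real B (f x) * cos (g x + a))"
    if "finite_measure M" and [measurable]: "f \<in> borel_measurable M" "g \<in> borel_measurable M" for M a
  proof -
    interpret finite_measure M by fact
    show "integrable M (\<lambda>x. indicat_real B (f x))" "integrable M (\<lambda>x. indicat_real B (f x) * cos (g x + a))"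
      by (auto intro!: integrable_const_bound[where B = 1] simp: indicator_def)
  qed
  \<comment> \<open>For h = 0 and a = 0 the weight is the constant 2, which isolates the part
    without a cosine.\<close>
  have one: "(\<integral>x. indicat_real B (f x) \<partial>P) = (\<integral>x. indicat_real B (f x) \<partial>Q)"
    using wt[OF zero, of 0] by simp
  have c: "(\<integral>x. indicat_real B (f x) * cos (g x + a) \<partial>P) = (\<integral>x. indicat_real B (f x) * cos (g x + a) \<partial>Q)" for a
    using wt[OF g, of a] one int[OF finP] int[OF finQ] by (simp add: distrib_left)
  \<comment> \<open>The phases 0 and -pi/2 turn the shifted cosine into cos g and sin g, the real
    and imaginary parts of cis g.\<close>
  have "(\<integral>x. indicat_real B (f x) *\<^sub>R cis (g x) \<partial>M) = Complex (\<integral>x. indicat_real B (f x) * cos (g x + 0) \<partial>M) (\<integral>x. indicat_real B (f x) * cos (g x + (- pi/2)) \<partial>M)"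
    if "finite_measure M" and [measurable]: "f \<in> borel_measurable M" "g \<in> borel_measurable M" for M
  proof -
    interpret finite_measure M by fact
    have i: "integrable M (\<lambda>x. indicat_real B (f x) *\<^sub>R cis (g x))"
      by (auto intro!: integrable_const_bound[where B = 1] simp: indicator_def)
    show ?thesis
      using integral_Re[OF i] integral_Im[OF i] by (simp add: complex_eq_iff cos_diff)
  qed
  then have "(\<integral>x. indicat_real B (f x) *\<^sub>R cis (g x) \<partial>P) = (\<integral>x. indicat_real B (f x) *\<^sub>R cis (g x) \<partial>Q)"
    by (simp only: finP finQ c f \<open>f \<in> borel_measurable P\<close> \<open>f \<in> borel_measurable Q\<close> \<open>g \<in> borel_measurable P\<close> \<open>g \<in> borel_measurable Q\<close>)
  then show ?thesis
    unfolding ennreal_indicator[symmetric] by (subst (1 2) integral_density) auto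
qed

text \<open>Cylinder sets with finitely many constraints form an intersection-stable generator.
  Their constraints are absorbed into the two measures one at a time, as densities;
  \<open>char_functional_restrict\<close> shows that the hypothesis on characteristic functionals
  survives each absorption.\<close>

theorem measure_eqI_char_functional:
  fixes P Q :: "'b measure" and V :: "('b \<Rightarrow> real) set"
  assumes finP: "finite_measure P" and finQ: "finite_measure Q"
    and sets_P: "sets P = sigma_sets \<Omega> {{x \<in> \<Omega>. f x \<in> B} | f B. f \<in> V \<and> B \<in> sets borel}"
    and sets_Q: "sets Q = sigma_sets \<Omega> {{x \<in> \<Omega>. f x \<in> B} | f B. f \<in> V \<and> B \<in> sets borel}"
    and lin: "\<And>f g t. f \<in> V \<Longrightarrow> g \<in> V \<Longrightarrow> (\<lambda>x. t * f x + g x) \<in> V"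
    and zero: "(\<lambda>x. 0) \<in> V"
    and eq: "\<And>g. g \<in> V \<Longrightarrow> (\<integral>x. cis (g x) \<partial>P) = (\<integral>x. cis (g x) \<partial>Q)"
  shows "P = Q"
proof -
  define G where "G = {{x \<in> \<Omega>. f x \<in> B} | f B. f \<in> V \<and> B \<in> sets (borel :: real measure)}"
  define cyl where "cyl xs = {x \<in> \<Omega>. \<forall>(f, B) \<in> set xs. f x \<in> B}" for xs :: "(('b \<Rightarrow> real) \<times> real set) list"
  define H where "H = cyl ` {xs. set xs \<subseteq> V \<times> sets borel}"
  have subG: "G \<subseteq> Pow \<Omega>" by (auto simp: G_def)
  have spP: "space P = \<Omega>" and spQ: "space Q = \<Omega>"
    using sets_P sets_Q sigma_sets_into_sp[OF subG] unfolding G_def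
    by (metis (no_types, lifting) PowD sets.sets_into_space sets.top sigma_sets_top subset_antisym subG G_def)+
  have fm: "f \<in> borel_measurable P" if "f \<in> V" for f
    using that unfolding measurable_def spP sets_P by (auto intro!: sigma_sets.Basic simp: vimage_def Int_def conj_commute)
  have cyl: "emeasure P (cyl xs) = emeasure Q (cyl xs)" if "set xs \<subseteq> V \<times> sets borel" for xs
    using that finP finQ sets_P sets_Q eq
  \<comment> \<open>The induction hypothesis is applied to the restrictions of P and Q to {f in B}.
    The empty list compares total masses, through the function 0 in \<open>V\<close>.\<close>
  proof (induction xs arbitrary: P Q)
    case Nil
    interpret P: finite_measure P by fact
    interpret Q: finite_measure Q by fact
    have sp: "space P = \<Omega>" "space Q = \<Omega>"
      using Nil(4,5) sigma_sets_into_sp[OF subG] unfolding G_def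
      by (metis (no_types, lifting) PowD sets.sets_into_space sets.top sigma_sets_top subset_antisym subG G_def)+
    have "complex_of_real (measure P \<Omega>) = complex_of_real (measure Q \<Omega>)"
      using Nil(6)[OF zero] by (simp add: sp scaleR_conv_of_real)
    then show ?case
      by (simp add: cyl_def P.emeasure_eq_measure Q.emeasure_eq_measure)
  next
    case (Cons p xs)
    obtain f B where p: "p = (f, B)" by force
    have f: "f \<in> V" and B[measurable]: "B \<in> sets borel" using Cons.prems(1) by (auto simp: p)
    interpret P: finite_measure P by fact
    interpret Q: finite_measure Q by fact
    have sp: "space P = \<Omega>" "space Q = \<Omega>"
      using Cons.prems(4,5) sigma_sets_into_sp[OF subG] unfolding G_def
      by (metis (no_types, lifting) PowD sets.sets_into_space sets.top sigma_sets_top subset_antisym subG G_def)+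
    have seq: "sets P = sets Q" using Cons.prems(4,5) by simp
    have fm: "h \<in> borel_measurable P" if "h \<in> V" for h
      using that unfolding measurable_def sp Cons.prems(4) by (auto intro!: sigma_sets.Basic simp: vimage_def Int_def conj_commute)
    have fm': "h \<in> borel_measurable Q" if "h \<in> V" for h
      using fm[OF that] by (simp add: measurable_cong_sets[OF seq refl])
    note [measurable] = fm[OF f] fm'[OF f]
    let ?d = "\<lambda>M. density M (\<lambda>x. indicator B (f x))"
    have fin: "finite_measure (?d M)" if "finite_measure M" "f \<in> borel_measurable M" for M :: "'b measure"
    proof -
      interpret finite_measure M by fact
      have "(\<integral>\<^sup>+x. indicator B (f x) \<partial>M) \<le> (\<integral>\<^sup>+x. 1 \<partial>M)"
        by (intro nn_integral_mono) (simp add: indicator_def)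
      also have "\<dots> < \<infinity>" by (simp add: less_top[symmetric])
      finally show ?thesis using that by (intro finite_measureI) (auto simp: emeasure_density cong: nn_integral_cong)
    qed
    have IH: "emeasure (?d P) (cyl xs) = emeasure (?d Q) (cyl xs)"
    proof (rule Cons.IH)
      show "set xs \<subseteq> V \<times> sets borel" using Cons.prems(1) by auto
      show "(\<integral>x. cis (g x) \<partial>?d P) = (\<integral>x. cis (g x) \<partial>?d Q)" if "g \<in> V" for g
        by (rule char_functional_restrict[OF Cons.prems(2,3) seq fm lin zero Cons.prems(6) f that B])
    qed (auto simp: Cons.prems fin fm fm' f)
    have cs: "cyl xs \<in> sets P"
    proof -
      have "cyl xs = {x \<in> space P. \<forall>q\<in>set xs. fst q x \<in> snd q}" by (auto simp: cyl_def sp split_beta)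
      also have "\<dots> \<in> sets P"
      proof (rule sets.sets_Collect_finite_All)
        fix q assume "q \<in> set xs"
        then have "fst q \<in> V" "snd q \<in> sets borel" using Cons.prems(1) by auto
        then show "{x \<in> space P. fst q x \<in> snd q} \<in> sets P"
          using fm[of "fst q"] by measurable
      qed auto
      finally show ?thesis .
    qed
    have "emeasure (?d M) (cyl xs) = emeasure M (cyl (p # xs))" if "cyl xs \<in> sets M" "f \<in> borel_measurable M" "space M = \<Omega>" for M
    proof -
      note [measurable] = that(1,2)
      have [measurable]: "cyl (p # xs) \<in> sets M"
      proof -
        have "cyl (p # xs) = {x \<in> space M. f x \<in> B} \<inter> cyl xs" by (auto simp: cyl_def p that)
        then show ?thesis by simp
      qed
      have "emeasure (?d M) (cyl xs) = (\<integral>\<^sup>+x. indicator (cyl (p # xs)) x \<partial>M)"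
        unfolding emeasure_density[OF _ that(1), of "\<lambda>x. indicator B (f x)", simplified]
        by (intro nn_integral_cong) (auto simp: cyl_def p that indicator_def)
      then show ?thesis by simp
    qed
    then show ?case using IH cs seq sp fm fm' f by simp
  qed
  have Gm: "X \<in> sets P" if "X \<in> H" for X
  proof -
    from that obtain xs where xs: "X = cyl xs" "set xs \<subseteq> V \<times> sets borel" by (auto simp: H_def)
    have "cyl xs = {x \<in> space P. \<forall>q\<in>set xs. fst q x \<in> snd q}" by (auto simp: cyl_def spP split_beta)
    also have "\<dots> \<in> sets P"
    proof (rule sets.sets_Collect_finite_All)
      fix q assume "q \<in> set xs"
      then have "fst q \<in> V" "snd q \<in> sets borel" using xs by auto
      then show "{x \<in> space P. fst q x \<in> snd q} \<in> sets P"
        using fm[of "fst q"] by measurable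
    qed auto
    finally show ?thesis using xs by simp
  qed
  have HG: "sigma_sets \<Omega> H = sigma_sets \<Omega> G"
  proof (rule sigma_sets_eqI)
    fix X assume "X \<in> H" then show "X \<in> sigma_sets \<Omega> G" using Gm sets_P by (simp add: G_def)
  next
    fix X assume "X \<in> G"
    then obtain f B where "X = cyl [(f, B)]" "f \<in> V" "B \<in> sets borel" by (auto simp: G_def cyl_def)
    then have "X \<in> H" unfolding H_def by (auto intro!: imageI)
    then show "X \<in> sigma_sets \<Omega> H" by auto
  qed
  show ?thesis
  proof (rule measure_eqI_generator_eq[of H \<Omega> P Q "\<lambda>_. \<Omega>"])
    show "Int_stable H"
    proof (unfold H_def, rule Int_stableI_image)
      fix xs ys :: "(('b \<Rightarrow> real) \<times> real set) list"
      assume "xs \<in> {xs. set xs \<subseteq> V \<times> sets borel}" "ys \<in> {xs. set xs \<subseteq> V \<times> sets borel}"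
      then show "\<exists>zs\<in>{xs. set xs \<subseteq> V \<times> sets borel}. cyl xs \<inter> cyl ys = cyl zs"
        by (intro bexI[of _ "xs @ ys"]) (auto simp: cyl_def)
    qed
    show "H \<subseteq> Pow \<Omega>" by (auto simp: H_def cyl_def)
    show "emeasure P X = emeasure Q X" if "X \<in> H" for X using that cyl by (auto simp: H_def)
    show "sets P = sigma_sets \<Omega> H" "sets Q = sigma_sets \<Omega> H" using sets_P sets_Q HG by (auto simp: G_def)
    show "range (\<lambda>_::nat. \<Omega>) \<subseteq> H" by (auto simp: H_def cyl_def intro!: image_eqI[of _ _ "[]"])
    show "emeasure P \<Omega> \<noteq> \<infinity>" for i::nat using finite_measure.emeasure_finite[OF finP] by simp
  qed simp
qed

subsection \<open>The space of Radon measures\<close>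

text \<open>Closed balls are compact, hence have finite 1/(m+1)-nets, and the balls of integer
  radius exhaust the space.\<close>

lemma heine_borel_countable_dense:
  obtains D :: "'a::heine_borel set" where "countable D" "\<And>x e. 0 < e \<Longrightarrow> \<exists>d\<in>D. dist x d < e"
proof -
  fix a :: 'a
  have "\<exists>k. finite k \<and> cball a (real n) \<subseteq> (\<Union>x\<in>k. ball x (1 / real (Suc m)))" for n m :: nat
    using compact_eq_totally_bounded[of "cball a (real n)"] by auto
  then obtain k where k: "\<And>n m. finite (k n m)"
    "\<And>n m. cball a (real n) \<subseteq> (\<Union>x\<in>k n m. ball x (1 / real (Suc m)))"
    by metis
  show thesis
  proof (rule that[of "\<Union>n m. k n m"])
    show "countable (\<Union>n m. k n m)" by (intro countable_UN countableI_type) (rule countable_finite[OF k(1)])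
    fix x and e :: real assume "0 < e"
    then obtain m where m: "1 / real (Suc m) < e" using nat_approx_posE by blast
    obtain n where "dist a x \<le> real n" using real_arch_simple by blast
    then have "x \<in> cball a (real n)" by simp
    then obtain d where "d \<in> k n m" "dist d x < 1 / real (Suc m)" using k(2)[of n m] by auto
    then show "\<exists>d\<in>(\<Union>n m. k n m). dist x d < e" using m by (intro bexI[of _ d]) (auto simp: dist_commute)
  qed
qed

lemma dist_const_borel_measurable [measurable]: "(\<lambda>x::'a::metric_space. dist x d) \<in> borel_measurable borel"
  by (intro borel_measurable_continuous_onI continuous_intros)

text \<open>A closed set lies in the Borel algebra of the product space, which can be larger than
  the product of the Borel algebras. A countable dense set closes the gap: x = y iff at every scale
  some point of D is near both. This is what makes point masses jointly measurable and coincidences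
  of random points measurable events.\<close>

lemma sets_diagonal [measurable]:
  "{p :: 'a::heine_borel \<times> 'a. fst p = snd p} \<in> sets (borel \<Otimes>\<^sub>M borel)"
proof -
  obtain D :: "'a set" where D: "countable D" "\<And>x e. 0 < e \<Longrightarrow> \<exists>d\<in>D. dist x d < e"
    using heine_borel_countable_dense by blast
  have eq: "x = y \<longleftrightarrow> (\<forall>n. \<exists>d\<in>D. dist x d < 1 / real (Suc n) \<and> dist y d < 1 / real (Suc n))" for x y :: 'a
  proof
    assume *: "\<forall>n. \<exists>d\<in>D. dist x d < 1 / real (Suc n) \<and> dist y d < 1 / real (Suc n)"
    show "x = y"
    proof (rule ccontr)
      assume "x \<noteq> y"
      then have "0 < dist x y / 2" by simp
      then obtain n where "1 / real (Suc n) < dist x y / 2" using nat_approx_posE by blast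
      moreover obtain d where "dist x d < 1 / real (Suc n)" "dist y d < 1 / real (Suc n)" using * by blast
      ultimately show False using dist_triangle2[of x y d] by linarith
    qed
  qed (use D in simp)
  have "{p :: 'a \<times> 'a. fst p = snd p} = (\<Inter>n. \<Union>d\<in>D. {p \<in> space (borel \<Otimes>\<^sub>M borel). dist (fst p) d < 1 / real (Suc n) \<and> dist (snd p) d < 1 / real (Suc n)})"
    by (subst eq) (auto simp: space_pair_measure)
  also have "\<dots> \<in> sets (borel \<Otimes>\<^sub>M borel)"
  proof (intro sets.countable_INT'' sets.countable_UN'' D(1))
    fix n :: nat and d :: 'a
    show "{p \<in> space (borel \<Otimes>\<^sub>M borel). dist (fst p) d < 1 / real (Suc n) \<and> dist (snd p) d < 1 / real (Suc n)} \<in> sets (borel \<Otimes>\<^sub>M borel)"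
      by measurable
  qed (auto simp: sets.top[of "borel \<Otimes>\<^sub>M borel", simplified space_pair_measure space_borel UNIV_Times_UNIV])
  finally show ?thesis .
qed

lemma sets_cball [measurable]: "cball (a::'a::metric_space) r \<in> sets borel"
  by simp

lemma space_vague: "space vague_space = radon_measures"
  unfolding vague_space_def by (rule space_measure_of) auto

lemma sets_vague: "sets vague_space = sigma_sets radon_measures
     {{\<eta> \<in> radon_measures. pairing \<phi> \<eta> \<in> B} | \<phi> B. \<phi> \<in> Cc \<and> B \<in> sets borel}"
  unfolding vague_space_def by (rule sets_measure_of) auto

lemma pairing_measurable [measurable]: "\<phi> \<in> Cc \<Longrightarrow> pairing \<phi> \<in> borel_measurable vague_space"
  unfolding measurable_def space_vague sets_vague
  by (auto intro!: sigma_sets.Basic simp: vimage_def Int_def conj_commute)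

lemma measurable_vague_spaceI:
  fixes \<kappa> :: "'z \<Rightarrow> 'a::heine_borel measure"
  assumes "\<And>z. z \<in> space Z \<Longrightarrow> \<kappa> z \<in> radon_measures"
    and "\<And>\<phi>. \<phi> \<in> Cc \<Longrightarrow> (\<lambda>z. pairing \<phi> (\<kappa> z)) \<in> borel_measurable Z"
  shows "\<kappa> \<in> measurable Z vague_space"
  unfolding vague_space_def
proof (rule measurable_measure_of)
  fix Y :: "'a measure set" assume "Y \<in> {{\<eta> \<in> radon_measures. pairing \<phi> \<eta> \<in> B} |\<phi> B. \<phi> \<in> Cc \<and> B \<in> sets borel}"
  then obtain \<phi> B where Y: "Y = {\<eta> \<in> radon_measures. pairing \<phi> \<eta> \<in> B}" and "\<phi> \<in> Cc" "B \<in> sets borel" by auto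
  then have "(\<lambda>z. pairing \<phi> (\<kappa> z)) -` B \<inter> space Z \<in> sets Z" using assms(2) by (auto intro: measurable_sets)
  moreover have "\<kappa> -` Y \<inter> space Z = (\<lambda>z. pairing \<phi> (\<kappa> z)) -` B \<inter> space Z"
    using assms(1) by (auto simp: Y)
  ultimately show "\<kappa> -` Y \<inter> space Z \<in> sets Z" by simp
qed (use assms in auto)

lemma Cc_borel: "\<phi> \<in> Cc \<Longrightarrow> \<phi> \<in> borel_measurable borel"
  by (auto simp: Cc_def intro: borel_measurable_continuous_onI)

lemma Cc_bounded:
  fixes \<phi> :: "'a::heine_borel \<Rightarrow> real"
  assumes "\<phi> \<in> Cc"
  obtains K M where "compact K" "0 \<le> M" "\<forall>x. \<bar>\<phi> x\<bar> \<le> M * indicator K x"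
proof -
  obtain K where K: "compact K" "\<And>x. x \<notin> K \<Longrightarrow> \<phi> x = 0" and c: "continuous_on UNIV \<phi>"
    using assms by (auto simp: Cc_def)
  have "compact (\<phi> ` K)" using K c by (intro compact_continuous_image continuous_on_subset[OF c]) auto
  then have "\<exists>M. \<forall>x\<in>K. \<bar>\<phi> x\<bar> \<le> M" using compact_imp_bounded[of "\<phi> ` K"] unfolding bounded_iff by auto
  then obtain M where M: "\<And>x. x \<in> K \<Longrightarrow> \<bar>\<phi> x\<bar> \<le> M" by blast
  show thesis
  proof (rule that[of K "max M 0"])
    show "\<forall>x. \<bar>\<phi> x\<bar> \<le> max M 0 * indicator K x"
    proof
      fix x show "\<bar>\<phi> x\<bar> \<le> max M 0 * indicator K x" using M[of x] K(2)[of x] by (cases "x \<in> K") auto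
    qed
  qed (use K in auto)
qed

lemma radon_setsD: "\<eta> \<in> radon_measures \<Longrightarrow> sets \<eta> = sets borel"
  by (simp add: radon_measures_def)

lemma radon_spaceD: "\<eta> \<in> radon_measures \<Longrightarrow> space \<eta> = UNIV"
  by (drule radon_setsD, drule sets_eq_imp_space_eq) simp

lemma radon_compact_finite: "\<eta> \<in> radon_measures \<Longrightarrow> compact K \<Longrightarrow> emeasure \<eta> K < \<infinity>"
  by (simp add: radon_measures_def)

lemma Cc_integrable:
  assumes "\<phi> \<in> Cc" "\<eta> \<in> radon_measures"
  shows "integrable \<eta> \<phi>"
proof -
  obtain K M where K: "compact K" and "0 \<le> M" and M: "\<forall>x. \<bar>\<phi> x\<bar> \<le> M * indicator K x"
    by (rule Cc_bounded[OF assms(1)])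
  note [measurable_cong] = radon_setsD[OF assms(2)]
  have "integrable \<eta> (\<lambda>x. M * indicator K x)"
    using radon_compact_finite[OF assms(2) K] borel_compact[OF K] radon_setsD[OF assms(2)]
    by (intro integrable_mult_right integrable_real_indicator) simp_all
  then show ?thesis
  proof (rule Bochner_Integration.integrable_bound)
    show "\<phi> \<in> borel_measurable \<eta>" using Cc_borel[OF assms(1)] by (simp add: measurable_cong_sets[OF radon_setsD[OF assms(2)] refl])
    show "AE x in \<eta>. norm (\<phi> x) \<le> norm (M * indicat_real K x)"
    proof (rule AE_I2)
      fix x show "norm (\<phi> x) \<le> norm (M * indicat_real K x)" using M[rule_format, of x] unfolding real_norm_def by linarith
    qed
  qed
qed

section \<open>Measurability of masses, integrals and point masses in the vague
  sigma-algebra\<close>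

text \<open>The indicator of a compact set is a decreasing limit of functions in \<open>Cc\<close>,
  so its mass is a limit of pairings.\<close>

lemma emeasure_compact_measurable:
  fixes K :: "'a::heine_borel set"
  assumes K: "compact K"
  shows "(\<lambda>\<eta>. emeasure \<eta> K) \<in> borel_measurable vague_space"
\<comment> \<open>\<open>infdist\<close> to the empty set is 0 by convention, which would make the
  functions below constantly 1.\<close>
proof (cases "K = {}")
  case False
  \<comment> \<open>Tents equal to 1 on K and 0 from distance 1/(n+1) on. All are supported within
    distance 1 of K, and the widest one, \<open>\<phi> 0\<close>, dominates the others.\<close>
  define \<phi> where "\<phi> n x = max 0 (1 - real (Suc n) * infdist x K)" for n x
  have clK: "closed K" using K by (rule compact_imp_closed)
  obtain a r where "\<forall>y\<in>K. dist a y \<le> r" using compact_imp_bounded[OF K] unfolding bounded_def by blast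
  then have ar: "y \<in> K \<Longrightarrow> dist a y \<le> r" for y by blast
  have supp: "\<phi> n x = 0" if "x \<notin> cball a (r + 1)" for n x
  proof -
    obtain y where y: "y \<in> K" "infdist x K = dist x y" using infdist_attains_inf[OF clK False] by blast
    have "dist a x \<le> dist a y + dist x y" by (rule dist_triangle2)
    then have "1 < infdist x K" using y ar[OF y(1)] that by simp
    moreover have "1 * infdist x K \<le> real (Suc n) * infdist x K" by (intro mult_right_mono infdist_nonneg) auto
    ultimately show ?thesis unfolding \<phi>_def by linarith
  qed
  have Cc: "\<phi> n \<in> Cc" for n
    unfolding Cc_def
  proof (intro CollectI conjI exI[of _ "cball a (r + 1)"])
    show "continuous_on UNIV (\<phi> n)" unfolding \<phi>_def by (intro continuous_intros)
  qed (auto simp: supp simp del: mem_cball)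
  have lim: "(\<lambda>n. pairing (\<phi> n) \<eta>) \<longlonglongrightarrow> measure \<eta> K" if \<eta>: "\<eta> \<in> radon_measures" for \<eta>
  proof -
    have "(\<lambda>n. integral\<^sup>L \<eta> (\<phi> n)) \<longlonglongrightarrow> (\<integral>x. indicator K x \<partial>\<eta>)"
    proof (rule integral_dominated_convergence[where w = "\<phi> 0"])
      show "integrable \<eta> (\<phi> 0)" using Cc_integrable[OF Cc \<eta>] .
      show "AE x in \<eta>. (\<lambda>n. \<phi> n x) \<longlonglongrightarrow> indicat_real K x"
      proof (rule AE_I2)
        fix x
        show "(\<lambda>n. \<phi> n x) \<longlonglongrightarrow> indicat_real K x"
        proof (cases "x \<in> K")
          case True
          then show ?thesis by (simp add: \<phi>_def)
        next
          case F: False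
          then have p: "0 < infdist x K" using in_closed_iff_infdist_zero[OF clK False] infdist_nonneg[of x K] by (simp add: less_le)
          obtain N where N: "1 / infdist x K < real N" using reals_Archimedean2 by blast
          have "\<phi> n x = 0" if "n \<ge> N" for n
          proof -
            have "1 / infdist x K < real (Suc n)" using N that by simp
            then have "1 < real (Suc n) * infdist x K" using p by (simp only: pos_divide_less_eq)
            then show ?thesis unfolding \<phi>_def by linarith
          qed
          then show ?thesis using F by (intro tendsto_eventually) (auto simp: eventually_sequentially)
        qed
      qed
      show "AE x in \<eta>. norm (\<phi> n x) \<le> \<phi> 0 x" for n
      proof (rule AE_I2)
        fix x
        have "1 * infdist x K \<le> real (Suc n) * infdist x K" by (intro mult_right_mono infdist_nonneg) auto
        then show "norm (\<phi> n x) \<le> \<phi> 0 x" unfolding \<phi>_def by (auto simp: max_def abs_if algebra_simps)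
      qed
    qed (use Cc_borel[OF Cc] borel_compact[OF K] in \<open>simp_all add: measurable_cong_sets[OF radon_setsD[OF \<eta>] refl]\<close>)
    then show ?thesis by (simp add: pairing_def radon_spaceD[OF \<eta>])
  qed
  have [measurable]: "(\<lambda>\<eta>. measure \<eta> K) \<in> borel_measurable vague_space"
    by (rule borel_measurable_LIMSEQ_real[where u = "\<lambda>n. pairing (\<phi> n)"]) (use lim in \<open>simp_all add: space_vague pairing_measurable Cc\<close>)
  have "(\<lambda>\<eta>. ennreal (measure \<eta> K)) \<in> borel_measurable vague_space" by measurable
  then show ?thesis
    by (rule measurable_cong[THEN iffD1, rotated])
      (auto simp: space_vague intro!: emeasure_eq_ennreal_measure[symmetric] dest!: radon_compact_finite[OF _ K])
qed simp

text \<open>A Radon measure may be infinite, while kernels into \<open>subprob_algebra\<close> have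
  mass at most 1. Restricting to a ball and dividing by 1 + its mass produces such a kernel; the
  summand 1 avoids division by zero, and the factor can be multiplied back because it is
  finite.\<close>

definition normalised_ball :: "'a::heine_borel \<Rightarrow> real \<Rightarrow> 'a measure \<Rightarrow> 'a measure" where
  "normalised_ball a r \<eta> = density \<eta> (\<lambda>x. indicator (cball a r) x * inverse (1 + emeasure \<eta> (cball a r)))"

lemma nn_integral_normalised_ball:
  assumes \<eta>: "\<eta> \<in> radon_measures" and [measurable]: "f \<in> borel_measurable borel"
  shows "(\<integral>\<^sup>+x. f x \<partial>normalised_ball a r \<eta>)
    = (\<integral>\<^sup>+x. f x * indicator (cball a r) x \<partial>\<eta>) / (1 + emeasure \<eta> (cball a r))"
proof -
  note [measurable_cong] = radon_setsD[OF \<eta>]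
  have "(\<integral>\<^sup>+x. f x \<partial>normalised_ball a r \<eta>) = (\<integral>\<^sup>+x. f x * indicator (cball a r) x / (1 + emeasure \<eta> (cball a r)) \<partial>\<eta>)"
    unfolding normalised_ball_def
    by (subst nn_integral_density) (auto simp: divide_ennreal_def mult_ac)
  also have "\<dots> = (\<integral>\<^sup>+x. f x * indicator (cball a r) x \<partial>\<eta>) / (1 + emeasure \<eta> (cball a r))"
    by (rule nn_integral_divide) simp
  finally show ?thesis .
qed

text \<open>Closed sets generate the Borel algebra and meet a closed ball in a compact set, whose
  mass is already known to be measurable.\<close>

lemma normalised_ball_measurable:
  "normalised_ball a r \<in> measurable vague_space (subprob_algebra borel)"
proof (rule measurable_subprob_algebra_generated[where \<Omega> = UNIV and G = "Collect closed"])
  let ?B = "cball a r"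
  have em: "emeasure (normalised_ball a r \<eta>) A = emeasure \<eta> (A \<inter> ?B) / (1 + emeasure \<eta> ?B)"
    if "\<eta> \<in> radon_measures" and [measurable]: "A \<in> sets borel" for \<eta> A
  proof -
    note [measurable_cong] = radon_setsD[OF that(1)]
    have "emeasure (normalised_ball a r \<eta>) A = (\<integral>\<^sup>+x. indicator A x \<partial>normalised_ball a r \<eta>)"
      using radon_setsD[OF that(1)] by (subst nn_integral_indicator) (auto simp: normalised_ball_def)
    also have "\<dots> = (\<integral>\<^sup>+x. indicator (A \<inter> ?B) x \<partial>\<eta>) / (1 + emeasure \<eta> ?B)"
      by (subst nn_integral_normalised_ball[OF that(1)]) (simp_all add: that indicator_inter_arith[symmetric])
    also have "(\<integral>\<^sup>+x. indicator (A \<inter> ?B) x \<partial>\<eta>) = emeasure \<eta> (A \<inter> ?B)"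
      by (rule nn_integral_indicator) simp
    finally show ?thesis .
  qed
  show "sets (borel :: 'a measure) = sigma_sets UNIV (Collect closed)"
    by (subst borel_eq_closed) auto
  show "Int_stable (Collect (closed :: 'a set \<Rightarrow> bool))" by (auto simp: Int_stable_def)
  note [measurable] = emeasure_compact_measurable
  have cm: "(\<lambda>\<eta>. emeasure (normalised_ball a r \<eta>) A) \<in> borel_measurable vague_space" if "closed A" for A
  proof -
    have "compact (A \<inter> ?B)" using that by (intro closed_Int_compact) auto
    then have "(\<lambda>\<eta>. emeasure \<eta> (A \<inter> ?B) / (1 + emeasure \<eta> ?B)) \<in> borel_measurable vague_space"
      using emeasure_compact_measurable[of ?B] emeasure_compact_measurable[of "A \<inter> ?B"] by simp
    then show ?thesis
      by (rule measurable_cong[THEN iffD1, rotated]) (use that in \<open>auto simp: space_vague em\<close>)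
  qed
  show "(\<lambda>\<eta>. emeasure (normalised_ball a r \<eta>) UNIV) \<in> borel_measurable vague_space"
    "\<And>A. A \<in> Collect closed \<Longrightarrow> (\<lambda>\<eta>. emeasure (normalised_ball a r \<eta>) A) \<in> borel_measurable vague_space"
    using cm by auto
  fix \<eta> :: "'a measure" assume "\<eta> \<in> space vague_space"
  then have \<eta>: "\<eta> \<in> radon_measures" by (simp add: space_vague)
  show s: "sets (normalised_ball a r \<eta>) = sets borel" using radon_setsD[OF \<eta>] by (simp add: normalised_ball_def)
  have fin: "emeasure \<eta> ?B < \<top>" using radon_compact_finite[OF \<eta>, of ?B] by simp
  then have "emeasure \<eta> ?B / (1 + emeasure \<eta> ?B) \<le> 1"
    by (intro divide_le_posI_ennreal) (auto simp: add_pos_nonneg)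
  then show "subprob_space (normalised_ball a r \<eta>)"
    using sets_eq_imp_space_eq[OF s] em[OF \<eta>, of UNIV] by (intro subprob_spaceI) auto
qed auto

lemma cball_cover: "(\<Union>n::nat. cball (a::'a::metric_space) (real n)) = UNIV"
  using real_arch_simple by (auto simp: mem_cball)

lemma nn_integral_SUP_cball:
  fixes a :: "'a::metric_space"
  assumes [measurable_cong]: "sets \<eta> = sets borel" and [measurable]: "f \<in> borel_measurable borel"
  shows "(\<integral>\<^sup>+x. f x \<partial>\<eta>) = (SUP n::nat. \<integral>\<^sup>+x. f x * indicator (cball a (real n)) x \<partial>\<eta>)"
proof -
  have "(\<integral>\<^sup>+x. f x \<partial>\<eta>) = (\<integral>\<^sup>+x. (SUP n::nat. f x * indicator (cball a (real n)) x) \<partial>\<eta>)"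
  proof (rule nn_integral_cong)
    fix x
    obtain n where "dist a x \<le> real n" using real_arch_simple by blast
    then show "f x = (SUP n::nat. f x * indicator (cball a (real n)) x)"
      by (intro antisym SUP_upper2[of n] SUP_least) (auto simp: indicator_def)
  qed
  also have "\<dots> = (SUP n::nat. \<integral>\<^sup>+x. f x * indicator (cball a (real n)) x \<partial>\<eta>)"
    by (rule nn_integral_monotone_convergence_SUP) (auto simp: incseq_def le_fun_def intro!: mult_left_mono split: split_indicator)
  finally show ?thesis .
qed

text \<open>The integral against the normalised restriction is measurable by the theory of
  subprobability kernels. Multiplying by 1 + mass gives the integral over the ball, and the supremum
  over integer radii the full integral. The integrand may depend on z as well, which is essential
  for \<open>atom_sum\<close>.\<close>

lemma nn_integral_radon_kernel_measurable:
  fixes \<kappa> :: "'z \<Rightarrow> 'a::heine_borel measure"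
  assumes \<kappa>[measurable]: "\<kappa> \<in> measurable Z vague_space"
    and g[measurable]: "(\<lambda>(z, x). g z x) \<in> borel_measurable (Z \<Otimes>\<^sub>M borel)"
  shows "(\<lambda>z. \<integral>\<^sup>+x. g z x \<partial>\<kappa> z) \<in> borel_measurable Z"
proof -
  fix a :: 'a
  note [measurable] = normalised_ball_measurable
  have k: "(\<lambda>z. normalised_ball a r (\<kappa> z)) \<in> measurable Z (subprob_algebra borel)" for r by measurable
  have radon: "\<kappa> z \<in> radon_measures" if "z \<in> space Z" for z
    using measurable_space[OF \<kappa> that] by (simp add: space_vague)
  have [measurable]: "(\<lambda>z. emeasure (\<kappa> z) (cball a r)) \<in> borel_measurable Z" for r
    by (rule measurable_compose[OF \<kappa> emeasure_compact_measurable]) simp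
  have "(\<lambda>z. SUP n::nat. (1 + emeasure (\<kappa> z) (cball a (real n))) * (\<integral>\<^sup>+x. g z x \<partial>normalised_ball a (real n) (\<kappa> z))) \<in> borel_measurable Z"
    by (intro borel_measurable_SUP borel_measurable_times_ennreal nn_integral_measurable_subprob_algebra2[OF g k]) auto
  then show ?thesis
  proof (rule measurable_cong[THEN iffD1, rotated])
    fix z assume z: "z \<in> space Z"
    have gz[measurable]: "g z \<in> borel_measurable borel" using measurable_Pair2[OF g z] by simp
    have "(1 + emeasure (\<kappa> z) (cball a r)) * (\<integral>\<^sup>+x. g z x \<partial>normalised_ball a r (\<kappa> z))
       = (\<integral>\<^sup>+x. g z x * indicator (cball a r) x \<partial>\<kappa> z)" for r
    proof -
      have fin: "emeasure (\<kappa> z) (cball a r) < \<top>" using radon_compact_finite[OF radon[OF z], of "cball a r"] by simp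
      show ?thesis
        using fin by (subst nn_integral_normalised_ball[OF radon[OF z] gz])
          (auto intro!: ennreal_mult_divide_eq simp: mult.commute[of "1 + _"] ennreal_times_divide ennreal_divide_times)
    qed
    then show "(SUP n::nat. (1 + emeasure (\<kappa> z) (cball a (real n))) * (\<integral>\<^sup>+x. g z x \<partial>normalised_ball a (real n) (\<kappa> z))) = (\<integral>\<^sup>+x. g z x \<partial>\<kappa> z)"
      using nn_integral_SUP_cball[OF radon_setsD[OF radon[OF z]] gz, of a] by simp
  qed
qed

text \<open>The mass of {x} is the integral of the indicator of the diagonal in its second variable,
  hence a kernel integral with parameter (\<eta>, x).\<close>

lemma point_mass_measurable [measurable]:
  "(\<lambda>(\<eta>, x). emeasure \<eta> {x :: 'a::heine_borel}) \<in> borel_measurable (vague_space \<Otimes>\<^sub>M borel)"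
proof -
  have "(\<lambda>z. \<integral>\<^sup>+y. indicator {p :: 'a \<times> 'a. fst p = snd p} (snd z, y) \<partial>fst z) \<in> borel_measurable (vague_space \<Otimes>\<^sub>M (borel :: 'a measure))"
    by (rule nn_integral_radon_kernel_measurable) measurable
  then show ?thesis
  proof (rule measurable_cong[THEN iffD1, rotated])
    fix z :: "'a measure \<times> 'a" assume "z \<in> space (vague_space \<Otimes>\<^sub>M borel)"
    then have r: "fst z \<in> radon_measures" by (auto simp: space_pair_measure space_vague)
    have "(\<integral>\<^sup>+y. indicator {p :: 'a \<times> 'a. fst p = snd p} (snd z, y) \<partial>fst z) = (\<integral>\<^sup>+y. indicator {snd z} y \<partial>fst z)"
      by (intro nn_integral_cong) (auto simp: indicator_def)
    then show "(\<integral>\<^sup>+y. indicator {p :: 'a \<times> 'a. fst p = snd p} (snd z, y) \<partial>fst z) = (case z of (\<eta>, x) \<Rightarrow> emeasure \<eta> {x})"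
      using radon_setsD[OF r] by (simp add: split_beta)
  qed
qed

text \<open>On discrete measures this is the sum of \<open>f (x, s\<^sub>x)\<close> over the atoms \<open>x\<close>; writing it as an integral
  against the measure itself makes its measurability a statement about kernels.\<close>
definition atom_sum :: "('a \<times> real \<Rightarrow> ennreal) \<Rightarrow> 'a measure \<Rightarrow> ennreal" where
  "atom_sum f \<eta> = (\<integral>\<^sup>+x. f (x, atom_mass \<eta> x) / emeasure \<eta> {x} \<partial>\<eta>)"

lemma atom_sum_measurable [measurable]:
  fixes f :: "'a::heine_borel \<times> real \<Rightarrow> ennreal"
  assumes [measurable]: "f \<in> borel_measurable (borel \<Otimes>\<^sub>M borel)"
  shows "atom_sum f \<in> borel_measurable vague_space"
  unfolding atom_sum_def[abs_def] atom_mass_def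
  by (rule nn_integral_radon_kernel_measurable[where \<kappa> = "\<lambda>x. x"]) measurable

section \<open>Discrete Radon measures as weighted counting measures on their atoms\<close>

lemma discrete_radonD: "\<eta> \<in> discrete_radon \<Longrightarrow> \<eta> \<in> radon_measures"
  by (simp add: discrete_radon_def)

lemma radon_point_finite: "\<eta> \<in> radon_measures \<Longrightarrow> emeasure \<eta> {x} < \<infinity>"
  by (rule radon_compact_finite) auto

lemma atom_mass_pos: "\<eta> \<in> radon_measures \<Longrightarrow> x \<in> atoms \<eta> \<Longrightarrow> 0 < atom_mass \<eta> x"
  using radon_point_finite[of \<eta> x] by (simp add: atom_mass_def atoms_def enn2real_positive_iff)

lemma point_mass_measurable2:
  assumes "\<eta> \<in> radon_measures"
  shows "(\<lambda>x. emeasure \<eta> {x :: 'a::heine_borel}) \<in> borel_measurable borel"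
  using measurable_Pair2[OF point_mass_measurable, of \<eta>] assms by (simp add: space_vague)

lemma nn_integral_discrete_radon:
  fixes \<eta> :: "'a::heine_borel measure"
  assumes \<eta>: "\<eta> \<in> discrete_radon" and [measurable]: "f \<in> borel_measurable borel"
  shows "(\<integral>\<^sup>+x. f x \<partial>\<eta>) = (\<integral>\<^sup>+x. emeasure \<eta> {x} * f x \<partial>count_space (atoms \<eta>))"
proof -
  let ?C = "distr (density (count_space (atoms \<eta>)) (\<lambda>x. emeasure \<eta> {x})) borel (\<lambda>x. x)"
  have "\<eta> = ?C"
  proof (rule measure_eqI)
    show "sets \<eta> = sets ?C" using radon_setsD[OF discrete_radonD[OF \<eta>]] by simp
    fix A assume "A \<in> sets \<eta>"
    then have A: "A \<in> sets borel" using radon_setsD[OF discrete_radonD[OF \<eta>]] by simp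
    then have "emeasure \<eta> A = (\<integral>\<^sup>+x. emeasure \<eta> {x} * indicator (A \<inter> atoms \<eta>) x \<partial>count_space UNIV)"
      using \<eta> unfolding discrete_radon_def by blast
    also have "\<dots> = (\<integral>\<^sup>+x. emeasure \<eta> {x} * indicator A x \<partial>count_space (atoms \<eta>))"
      by (simp add: nn_integral_count_space_indicator indicator_inter_arith mult.assoc)
    also have "\<dots> = emeasure ?C A"
      using A by (subst emeasure_distr) (auto simp: emeasure_density indicator_inter_arith intro!: nn_integral_cong split: split_indicator)
    finally show "emeasure \<eta> A = emeasure ?C A" .
  qed
  then have "(\<integral>\<^sup>+x. f x \<partial>\<eta>) = (\<integral>\<^sup>+x. f x \<partial>?C)" by (rule arg_cong[where f = "\<lambda>M. nn_integral M f"])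
  also have "\<dots> = (\<integral>\<^sup>+x. emeasure \<eta> {x} * f x \<partial>count_space (atoms \<eta>))"
    by (subst nn_integral_distr) (simp_all add: nn_integral_density)
  finally show ?thesis .
qed

text \<open>Integration against \<eta> weights each atom by its mass, which the division inside
  \<open>atom_sum\<close> cancels. Masses of atoms are positive, and finite because singletons are
  compact.\<close>

lemma atom_sum_discrete_radon:
  fixes \<eta> :: "'a::heine_borel measure"
  assumes \<eta>: "\<eta> \<in> discrete_radon" and f[measurable]: "f \<in> borel_measurable (borel \<Otimes>\<^sub>M borel)"
  shows "atom_sum f \<eta> = (\<integral>\<^sup>+x. f (x, atom_mass \<eta> x) \<partial>count_space (atoms \<eta>))"
proof -
  note r = discrete_radonD[OF \<eta>]
  note [measurable] = point_mass_measurable2[OF r]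
  have [measurable]: "atom_mass \<eta> \<in> borel_measurable borel" unfolding atom_mass_def[abs_def] by measurable
  have "atom_sum f \<eta> = (\<integral>\<^sup>+x. emeasure \<eta> {x} * (f (x, atom_mass \<eta> x) / emeasure \<eta> {x}) \<partial>count_space (atoms \<eta>))"
    unfolding atom_sum_def by (rule nn_integral_discrete_radon[OF \<eta>]) measurable
  also have "\<dots> = (\<integral>\<^sup>+x. f (x, atom_mass \<eta> x) \<partial>count_space (atoms \<eta>))"
  proof (rule nn_integral_cong)
    fix x assume "x \<in> space (count_space (atoms \<eta>))"
    then have "emeasure \<eta> {x} \<noteq> 0" "emeasure \<eta> {x} \<noteq> \<top>"
      using radon_point_finite[OF r, of x] by (auto simp: atoms_def)
    then show "emeasure \<eta> {x} * (f (x, atom_mass \<eta> x) / emeasure \<eta> {x}) = f (x, atom_mass \<eta> x)"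
      by (simp only: ennreal_times_divide mult.commute[of "emeasure \<eta> {x}"] ennreal_mult_divide_eq simp_thms not_False_eq_True)
  qed
  finally show ?thesis .
qed

section \<open>The multiplicative action on Radon measures\<close>

lemma C0pos_borel: "\<theta> \<in> C0pos \<Longrightarrow> \<theta> \<in> borel_measurable borel"
  by (auto simp: C0pos_def intro: borel_measurable_continuous_onI)

text \<open>The range [1/n, n] is the one over which the oscillation hypothesis on l is uniform. The
  lower end comes from bounding 1/\<theta> on the compact set.\<close>

lemma C0pos_bounds:
  fixes \<theta> :: "'a::heine_borel \<Rightarrow> real"
  assumes "\<theta> \<in> C0pos"
  obtains K n where "compact K" "n \<ge> 1" "\<forall>x. x \<notin> K \<longrightarrow> \<theta> x = 1" "\<forall>x. \<theta> x \<in> {1 / real n .. real n}"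
proof -
  obtain K where K: "compact K" "\<forall>x. x \<notin> K \<longrightarrow> \<theta> x = 1" and c: "continuous_on UNIV \<theta>" and pos: "\<And>x. 0 < \<theta> x"
    using assms by (auto simp: C0pos_def)
  have "compact (\<theta> ` K)" "compact ((\<lambda>x. inverse (\<theta> x)) ` K)"
    using pos by (intro compact_continuous_image continuous_on_inverse K continuous_on_subset[OF c]; simp add: less_imp_neq[symmetric])+
  then have "bounded (\<theta> ` K)" "bounded ((\<lambda>x. inverse (\<theta> x)) ` K)" by (auto intro: compact_imp_bounded)
  then have "\<exists>M1. \<forall>x\<in>K. \<bar>\<theta> x\<bar> \<le> M1" "\<exists>M2. \<forall>x\<in>K. \<bar>inverse (\<theta> x)\<bar> \<le> M2" unfolding bounded_iff by auto
  then obtain M1 M2 where M: "\<forall>x\<in>K. \<bar>\<theta> x\<bar> \<le> M1" "\<forall>x\<in>K. \<bar>inverse (\<theta> x)\<bar> \<le> M2" by blast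
  obtain n where n: "max 1 (max M1 M2) \<le> real n" using real_arch_simple by blast
  have n1: "n \<ge> 1" using n by simp
  have "\<theta> x \<in> {1 / real n .. real n}" for x
  proof (cases "x \<in> K")
    case True
    have "\<theta> x \<le> real n" using bspec[OF M(1) True] n by linarith
    moreover have "inverse (\<theta> x) \<le> real n" using bspec[OF M(2) True] n by linarith
    then have "1 / real n \<le> \<theta> x" using pos[of x] n1 by (simp add: field_simps)
    ultimately show ?thesis by simp
  next
    case False
    then show ?thesis using K n1 by simp
  qed
  then show thesis using that K n1 by blast
qed

lemma theta_action_radon:
  assumes \<theta>: "\<theta> \<in> C0pos" and \<eta>: "\<eta> \<in> radon_measures"
  shows "theta_action \<theta> \<eta> \<in> radon_measures"
  unfolding radon_measures_def
proof (intro CollectI conjI allI impI)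
  note [measurable] = C0pos_borel[OF \<theta>] and [measurable_cong] = radon_setsD[OF \<eta>]
  show "sets (theta_action \<theta> \<eta>) = sets borel" using radon_setsD[OF \<eta>] by (simp add: theta_action_def)
  fix K :: "'a set" assume K: "compact K"
  then have [measurable]: "K \<in> sets borel" by (rule borel_compact)
  obtain K' n where "compact K'" "n \<ge> 1" "\<forall>x. x \<notin> K' \<longrightarrow> \<theta> x = 1" and n: "\<forall>x. \<theta> x \<in> {1 / real n .. real n}"
    by (rule C0pos_bounds[OF \<theta>])
  have "emeasure (theta_action \<theta> \<eta>) K = (\<integral>\<^sup>+x. ennreal (\<theta> x) * indicator K x \<partial>\<eta>)"
    unfolding theta_action_def by (rule emeasure_density) auto
  also have "\<dots> \<le> (\<integral>\<^sup>+x. ennreal (real n) * indicator K x \<partial>\<eta>)"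
    by (intro nn_integral_mono mult_right_mono ennreal_leI) (use n in simp_all)
  also have "\<dots> = ennreal (real n) * emeasure \<eta> K" by (simp add: nn_integral_cmult_indicator)
  also have "\<dots> < \<infinity>" using radon_compact_finite[OF \<eta> K] by (simp add: ennreal_mult_less_top)
  finally show "emeasure (theta_action \<theta> \<eta>) K < \<infinity>" .
qed

lemma emeasure_theta_action_point:
  assumes \<theta>: "\<theta> \<in> C0pos" and \<eta>: "\<eta> \<in> radon_measures"
  shows "emeasure (theta_action \<theta> \<eta>) {x} = ennreal (\<theta> x) * emeasure \<eta> {x}"
proof -
  note [measurable] = C0pos_borel[OF \<theta>] and [measurable_cong] = radon_setsD[OF \<eta>]
  have "emeasure (theta_action \<theta> \<eta>) {x} = (\<integral>\<^sup>+y. ennreal (\<theta> y) * indicator {x} y \<partial>\<eta>)"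
    unfolding theta_action_def by (rule emeasure_density) auto
  also have "\<dots> = (\<integral>\<^sup>+y. ennreal (\<theta> x) * indicator {x} y \<partial>\<eta>)"
    by (intro nn_integral_cong) (auto split: split_indicator)
  also have "\<dots> = ennreal (\<theta> x) * emeasure \<eta> {x}" using radon_setsD[OF \<eta>] by (simp add: nn_integral_cmult_indicator)
  finally show ?thesis .
qed

lemma theta_action_discrete_radon:
  fixes \<theta> :: "'a::heine_borel \<Rightarrow> real"
  assumes \<theta>: "\<theta> \<in> C0pos" and \<eta>: "\<eta> \<in> discrete_radon"
  shows "theta_action \<theta> \<eta> \<in> discrete_radon"
proof -
  note r = discrete_radonD[OF \<eta>]
  note [measurable] = C0pos_borel[OF \<theta>] and [measurable_cong] = radon_setsD[OF r]
  have pos: "0 < \<theta> x" for x using \<theta> by (simp add: C0pos_def)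
  have atoms: "atoms (theta_action \<theta> \<eta>) = atoms \<eta>"
    using pos by (auto simp: atoms_def emeasure_theta_action_point[OF \<theta> r] ennreal_zero_less_mult_iff)
  show ?thesis
    unfolding discrete_radon_def
  proof (intro CollectI conjI ballI)
    show "theta_action \<theta> \<eta> \<in> radon_measures" by (rule theta_action_radon[OF \<theta> r])
    show "countable (atoms (theta_action \<theta> \<eta>))" using \<eta> unfolding atoms discrete_radon_def by blast
    fix A :: "'a set" assume [measurable]: "A \<in> sets borel"
    have "emeasure (theta_action \<theta> \<eta>) A = (\<integral>\<^sup>+x. ennreal (\<theta> x) * indicator A x \<partial>\<eta>)"
      unfolding theta_action_def by (rule emeasure_density) auto
    also have "\<dots> = (\<integral>\<^sup>+x. emeasure \<eta> {x} * (ennreal (\<theta> x) * indicator A x) \<partial>count_space (atoms \<eta>))"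
      by (rule nn_integral_discrete_radon[OF \<eta>]) auto
    also have "\<dots> = (\<integral>\<^sup>+x. emeasure (theta_action \<theta> \<eta>) {x} * indicator (A \<inter> atoms (theta_action \<theta> \<eta>)) x \<partial>count_space UNIV)"
      by (simp add: nn_integral_count_space_indicator indicator_inter_arith atoms emeasure_theta_action_point[OF \<theta> r] mult_ac)
    finally show "emeasure (theta_action \<theta> \<eta>) A = (\<integral>\<^sup>+x. emeasure (theta_action \<theta> \<eta>) {x} * indicator (A \<inter> atoms (theta_action \<theta> \<eta>)) x \<partial>count_space UNIV)" .
  qed
qed

lemma Cc_mult_C0pos: "\<phi> \<in> Cc \<Longrightarrow> \<theta> \<in> C0pos \<Longrightarrow> (\<lambda>x. \<theta> x * \<phi> x) \<in> Cc"
proof -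
  assume \<phi>: "\<phi> \<in> Cc" and \<theta>: "\<theta> \<in> C0pos"
  obtain K where "compact K" "\<forall>x. x \<notin> K \<longrightarrow> \<phi> x = 0" using \<phi> unfolding Cc_def by blast
  then have "compact K" "\<forall>x. x \<notin> K \<longrightarrow> \<theta> x * \<phi> x = 0" by auto
  moreover have "continuous_on UNIV (\<lambda>x. \<theta> x * \<phi> x)" using \<phi> \<theta> unfolding Cc_def C0pos_def
    by (intro continuous_on_mult) auto
  ultimately show ?thesis unfolding Cc_def by blast
qed

lemma pairing_theta_action:
  assumes \<theta>: "\<theta> \<in> C0pos" and \<eta>: "\<eta> \<in> radon_measures" and \<phi>: "\<phi> \<in> Cc"
  shows "pairing \<phi> (theta_action \<theta> \<eta>) = pairing (\<lambda>x. \<theta> x * \<phi> x) \<eta>"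
proof -
  note [measurable] = C0pos_borel[OF \<theta>] Cc_borel[OF \<phi>] and [measurable_cong] = radon_setsD[OF \<eta>]
  have pos: "0 \<le> \<theta> x" for x using \<theta> by (simp add: C0pos_def less_imp_le)
  show ?thesis
    unfolding pairing_def theta_action_def by (subst integral_density) (auto simp: pos)
qed

text \<open>The action is dual to multiplication of test functions by \<theta>, which maps
  \<open>Cc\<close> into itself.\<close>

lemma theta_action_measurable:
  assumes \<theta>: "\<theta> \<in> C0pos"
  shows "theta_action \<theta> \<in> measurable vague_space vague_space"
proof (rule measurable_vague_spaceI)
  fix \<phi> :: "'a \<Rightarrow> real" assume \<phi>: "\<phi> \<in> Cc"
  have "pairing (\<lambda>x. \<theta> x * \<phi> x) \<in> borel_measurable vague_space"
    by (rule pairing_measurable[OF Cc_mult_C0pos[OF \<phi> \<theta>]])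
  then show "(\<lambda>\<eta>. pairing \<phi> (theta_action \<theta> \<eta>)) \<in> borel_measurable vague_space"
    by (rule measurable_cong[THEN iffD1, rotated]) (simp add: space_vague pairing_theta_action[OF \<theta> _ \<phi>])
qed (simp add: space_vague theta_action_radon[OF \<theta>])

section \<open>Uniqueness of the law with a given characteristic functional\<close>

lemma Cc_lin: "f \<in> Cc \<Longrightarrow> g \<in> Cc \<Longrightarrow> (\<lambda>x. t * f x + g x) \<in> Cc"
proof -
  assume f: "f \<in> Cc" and g: "g \<in> Cc"
  obtain K1 K2 where K: "compact K1" "\<forall>x. x \<notin> K1 \<longrightarrow> f x = 0" "compact K2" "\<forall>x. x \<notin> K2 \<longrightarrow> g x = 0"
    using f g unfolding Cc_def by blast
  then have "compact (K1 \<union> K2)" "\<forall>x. x \<notin> K1 \<union> K2 \<longrightarrow> t * f x + g x = 0" by (auto intro: compact_Un)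
  moreover have "continuous_on UNIV (\<lambda>x. t * f x + g x)" using f g by (auto simp: Cc_def intro!: continuous_intros)
  ultimately show ?thesis unfolding Cc_def by blast
qed

lemma vague_measure_eqI:
  fixes P Q :: "'a::heine_borel measure measure"
  assumes "finite_measure P" "finite_measure Q" "sets P = sets vague_space" "sets Q = sets vague_space"
    and eq: "\<And>\<phi>. \<phi> \<in> Cc \<Longrightarrow> (\<integral>\<eta>. cis (pairing \<phi> \<eta>) \<partial>P) = (\<integral>\<eta>. cis (pairing \<phi> \<eta>) \<partial>Q)"
  shows "P = Q"
proof -
  \<comment> \<open>Pairings are linear in the test function only where it is integrable, in
    particular on Radon measures. Functions that merely agree there with a pairing do form a vector
    space, and they generate the same sets.\<close>
  define V where "V = {F :: 'a measure \<Rightarrow> real. \<exists>\<phi>\<in>Cc. \<forall>\<eta>\<in>radon_measures. F \<eta> = pairing \<phi> \<eta>}"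
  have sp: "space P = radon_measures" "space Q = radon_measures"
    using assms(3,4)[THEN sets_eq_imp_space_eq] by (auto simp: space_vague)
  have gen: "{{\<eta> \<in> radon_measures. pairing \<phi> \<eta> \<in> B} | \<phi> B. \<phi> \<in> Cc \<and> B \<in> sets borel}
     = {{x \<in> radon_measures. f x \<in> B} | f B. f \<in> V \<and> B \<in> sets borel}" (is "?L = ?R")
  proof (intro equalityI subsetI)
    fix X assume "X \<in> ?L"
    then obtain \<phi> B where "X = {\<eta> \<in> radon_measures. pairing \<phi> \<eta> \<in> B}" "\<phi> \<in> Cc" "B \<in> sets borel" by blast
    moreover from this have "pairing \<phi> \<in> V" by (auto simp: V_def)
    ultimately show "X \<in> ?R" by blast
  next
    fix X assume "X \<in> ?R"
    then obtain f B where X: "X = {\<eta> \<in> radon_measures. f \<eta> \<in> B}" "f \<in> V" and B: "B \<in> sets borel" by blast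
    then obtain \<phi> where \<phi>: "\<phi> \<in> Cc" "\<forall>\<eta>\<in>radon_measures. f \<eta> = pairing \<phi> \<eta>" by (auto simp: V_def)
    then have "X = {\<eta> \<in> radon_measures. pairing \<phi> \<eta> \<in> B}" using X by auto
    then show "X \<in> ?L" using \<phi> B by blast
  qed
  show ?thesis
  proof (rule measure_eqI_char_functional[where V = V and \<Omega> = radon_measures])
    show "sets P = sigma_sets radon_measures {{x \<in> radon_measures. f x \<in> B} |f B. f \<in> V \<and> B \<in> sets borel}"
      "sets Q = sigma_sets radon_measures {{x \<in> radon_measures. f x \<in> B} |f B. f \<in> V \<and> B \<in> sets borel}"
      by (simp_all only: assms sets_vague gen)
    show "(\<lambda>x. t * f x + g x) \<in> V" if fg: "f \<in> V" "g \<in> V" for f g t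
    proof -
      obtain \<phi> \<psi> where \<phi>: "\<phi> \<in> Cc" "\<forall>\<eta>\<in>radon_measures. f \<eta> = pairing \<phi> \<eta>"
        and \<psi>: "\<psi> \<in> Cc" "\<forall>\<eta>\<in>radon_measures. g \<eta> = pairing \<psi> \<eta>" using fg unfolding V_def by blast
      have "t * f \<eta> + g \<eta> = pairing (\<lambda>x. t * \<phi> x + \<psi> x) \<eta>" if \<eta>: "\<eta> \<in> radon_measures" for \<eta>
        using Cc_integrable[OF \<phi>(1) \<eta>] Cc_integrable[OF \<psi>(1) \<eta>] \<phi>(2) \<psi>(2) \<eta> by (simp add: pairing_def)
      then show ?thesis unfolding V_def using Cc_lin[OF \<phi>(1) \<psi>(1), of t] by blast
    qed
    have "(\<lambda>_. 0) \<in> Cc" by (auto simp: Cc_def)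
    then show "(\<lambda>x. 0) \<in> V" unfolding V_def by (auto intro!: bexI[of _ "\<lambda>_. 0"] simp: pairing_def)
    fix g assume "g \<in> V"
    then obtain \<phi> where \<phi>: "\<phi> \<in> Cc" "\<forall>\<eta>\<in>radon_measures. g \<eta> = pairing \<phi> \<eta>" by (auto simp: V_def)
    have "(\<integral>x. cis (g x) \<partial>P) = (\<integral>x. cis (pairing \<phi> x) \<partial>P)" "(\<integral>x. cis (g x) \<partial>Q) = (\<integral>x. cis (pairing \<phi> x) \<partial>Q)"
      using \<phi>(2) sp by (auto intro!: Bochner_Integration.integral_cong)
    then show "(\<integral>x. cis (g x) \<partial>P) = (\<integral>x. cis (g x) \<partial>Q)" using eq[OF \<phi>(1)] by simp
  qed fact+
qed

text \<open>The uniqueness half of the definite description; the existence half is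
  \<open>levy_law_eq_law\<close> below.\<close>

lemma levy_law_eqI:
  assumes "is_levy_law dx lam P"
  shows "levy_law dx lam = P"
  unfolding levy_law_def
proof (rule the_equality)
  show "is_levy_law dx lam P" by fact
  fix Q assume "is_levy_law dx lam Q"
  then show "Q = P"
    using assms by (intro vague_measure_eqI) (auto simp: is_levy_law_def prob_space.finite_measure)
qed

subsection \<open>Poisson processes\<close>

text \<open>The probability generating function of the Poisson law. Its series converges at every
  complex z, so no bound on the modulus is required.\<close>

lemma integral_poisson_power:
  fixes z :: complex
  assumes r: "0 < r"
  shows "integrable (measure_pmf (poisson_pmf r)) (\<lambda>n. z ^ n)"
    and "(\<integral>n. z ^ n \<partial>measure_pmf (poisson_pmf r)) = exp (of_real r * (z - 1))"
proof -
  have term_eq: "pmf (poisson_pmf r) n *\<^sub>R z ^ n = exp (- of_real r) * ((of_real r * z) ^ n /\<^sub>R fact n)" for n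
    using r by (simp add: scaleR_conv_of_real power_mult_distrib exp_of_real[symmetric] field_simps)
  have s: "(\<lambda>n. pmf (poisson_pmf r) n *\<^sub>R z ^ n) sums (exp (- of_real r) * exp (of_real r * z))"
    unfolding term_eq by (intro sums_mult exp_converges)
  have ns: "summable (\<lambda>n. norm (pmf (poisson_pmf r) n *\<^sub>R z ^ n))"
    unfolding term_eq norm_mult by (intro summable_mult summable_norm_exp)
  have int: "integrable (count_space UNIV) (\<lambda>n. pmf (poisson_pmf r) n *\<^sub>R z ^ n)"
    by (simp only: integrable_count_space_nat_iff ns)
  show "integrable (measure_pmf (poisson_pmf r)) (\<lambda>n. z ^ n)"
    unfolding measure_pmf_eq_density by (subst integrable_density) (use int in auto)
  have "(\<integral>n. z ^ n \<partial>measure_pmf (poisson_pmf r)) = (\<integral>n. pmf (poisson_pmf r) n *\<^sub>R z ^ n \<partial>count_space UNIV)"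
    unfolding measure_pmf_eq_density by (subst integral_density) auto
  also have "\<dots> = (\<Sum>n. pmf (poisson_pmf r) n *\<^sub>R z ^ n)"
    by (rule integral_count_space_nat[OF int])
  also have "\<dots> = exp (- of_real r) * exp (of_real r * z)"
    using s by (rule sums_unique[symmetric])
  also have "\<dots> = exp (of_real r * (z - 1))" by (simp add: mult_exp_exp algebra_simps)
  finally show "(\<integral>n. z ^ n \<partial>measure_pmf (poisson_pmf r)) = exp (of_real r * (z - 1))" .
qed

lemma nn_integral_poisson_power:
  assumes r: "0 < r" and c: "0 \<le> c"
  shows "(\<integral>\<^sup>+n. ennreal c ^ n \<partial>measure_pmf (poisson_pmf r)) = ennreal (exp (r * (c - 1)))"
proof -
  have i: "integrable (measure_pmf (poisson_pmf r)) (\<lambda>n. complex_of_real (c ^ n))"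
    using integral_poisson_power(1)[OF r, of "of_real c"] by simp
  have "complex_of_real (\<integral>n. c ^ n \<partial>measure_pmf (poisson_pmf r)) = exp (of_real r * (of_real c - 1))"
    using integral_poisson_power(2)[OF r, of "of_real c"] by (simp flip: of_real_power)
  also have "\<dots> = of_real (exp (r * (c - 1)))" by (simp add: exp_of_real[symmetric])
  finally have e: "(\<integral>n. c ^ n \<partial>measure_pmf (poisson_pmf r)) = exp (r * (c - 1))" by (simp only: of_real_eq_iff)
  have i': "integrable (measure_pmf (poisson_pmf r)) (\<lambda>n. c ^ n)"
    using integrable_Re[OF i] by simp
  have "(\<integral>\<^sup>+n. ennreal c ^ n \<partial>measure_pmf (poisson_pmf r)) = (\<integral>\<^sup>+n. ennreal (c ^ n) \<partial>measure_pmf (poisson_pmf r))"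
    using c by (simp add: ennreal_power)
  also have "\<dots> = ennreal (\<integral>n. c ^ n \<partial>measure_pmf (poisson_pmf r))"
    using c by (intro nn_integral_eq_integral[OF i']) auto
  finally show ?thesis by (simp add: e)
qed

lemma nn_integral_poisson_mean:
  assumes r: "0 < r"
  shows "(\<integral>\<^sup>+n. of_nat n \<partial>measure_pmf (poisson_pmf r)) = ennreal r"
proof -
  have s: "(\<lambda>n. pmf (poisson_pmf r) n * real n) sums r"
  proof -
    have e: "pmf (poisson_pmf r) (Suc n) * real (Suc n) = r * exp (- r) * (r ^ n /\<^sub>R fact n)" for n
      using r by (simp add: field_simps del: of_nat_Suc)
    have "(\<lambda>n. pmf (poisson_pmf r) (Suc n) * real (Suc n)) sums (r * exp (- r) * exp r)"
      unfolding e by (intro sums_mult exp_converges)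
    then show ?thesis by (subst (asm) sums_Suc_iff) (simp add: mult.assoc mult_exp_exp)
  qed
  have "(\<integral>\<^sup>+n. of_nat n \<partial>measure_pmf (poisson_pmf r)) = (\<Sum>n. ennreal (pmf (poisson_pmf r) n * real n))"
    unfolding measure_pmf_eq_density
    by (subst nn_integral_density) (auto simp: nn_integral_count_space_nat ennreal_mult ennreal_of_nat_eq_real_of_nat)
  also have "\<dots> = ennreal r" using s by (intro suminf_ennreal_eq) auto
  finally show ?thesis .
qed

text \<open>Only the coordinates in J occur, and the image of the infinite product under restriction
  to J is the finite product, where the integral factorises.\<close>

lemma PiM_prod_integral:
  fixes M :: "'i \<Rightarrow> 'b measure"
  assumes prob: "\<And>i. prob_space (M i)" and J: "finite J"
  shows "(\<And>i. i \<in> J \<Longrightarrow> f i \<in> borel_measurable (M i)) \<Longrightarrow>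
      (\<integral>\<^sup>+\<omega>. (\<Prod>i\<in>J. f i (\<omega> i)) \<partial>PiM UNIV M) = (\<Prod>i\<in>J. \<integral>\<^sup>+x. f i x \<partial>M i)"
    and "(\<And>i. i \<in> J \<Longrightarrow> integrable (M i) (g i)) \<Longrightarrow>
      (\<integral>\<omega>. (\<Prod>i\<in>J. (g i (\<omega> i) :: complex)) \<partial>PiM UNIV M) = (\<Prod>i\<in>J. \<integral>x. g i x \<partial>M i)"
proof -
  interpret P: product_prob_space M UNIV
    by (intro product_prob_spaceI prob)
  have d: "distr (PiM UNIV M) (PiM J M) (\<lambda>x. restrict x J) = PiM J M"
    using J by (intro P.distr_PiM_restrict_finite) auto
  have [measurable]: "(\<lambda>x. restrict x J) \<in> measurable (PiM UNIV M) (PiM J M)"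
    by (rule measurable_restrict_subset) simp
  {
    assume f: "\<And>i. i \<in> J \<Longrightarrow> f i \<in> borel_measurable (M i)"
    have m: "(\<lambda>x. \<Prod>i\<in>J. f i (x i)) \<in> borel_measurable (PiM J M)"
      using f by (intro borel_measurable_prod_ennreal measurable_compose[OF measurable_component_singleton]) auto
    have "(\<integral>\<^sup>+\<omega>. (\<Prod>i\<in>J. f i (\<omega> i)) \<partial>PiM UNIV M) = (\<integral>\<^sup>+\<omega>. (\<Prod>i\<in>J. f i (restrict \<omega> J i)) \<partial>PiM UNIV M)"
      by (intro nn_integral_cong prod.cong) auto
    also have "\<dots> = (\<integral>\<^sup>+x. (\<Prod>i\<in>J. f i (x i)) \<partial>distr (PiM UNIV M) (PiM J M) (\<lambda>x. restrict x J))"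
      using m by (subst nn_integral_distr) auto
    also have "\<dots> = (\<Prod>i\<in>J. \<integral>\<^sup>+x. f i x \<partial>M i)"
      unfolding d by (rule P.product_nn_integral_prod[OF J f])
    finally show "(\<integral>\<^sup>+\<omega>. (\<Prod>i\<in>J. f i (\<omega> i)) \<partial>PiM UNIV M) = (\<Prod>i\<in>J. \<integral>\<^sup>+x. f i x \<partial>M i)" .
  }
  {
    assume g: "\<And>i. i \<in> J \<Longrightarrow> integrable (M i) (g i)"
    have m: "(\<lambda>x. \<Prod>i\<in>J. g i (x i)) \<in> borel_measurable (PiM J M)"
      using g by (intro borel_measurable_prod measurable_compose[OF measurable_component_singleton]) auto
    have "(\<integral>\<omega>. (\<Prod>i\<in>J. g i (\<omega> i)) \<partial>PiM UNIV M) = (\<integral>\<omega>. (\<Prod>i\<in>J. g i (restrict \<omega> J i)) \<partial>PiM UNIV M)"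
      by (intro Bochner_Integration.integral_cong prod.cong) auto
    also have "\<dots> = (\<integral>x. (\<Prod>i\<in>J. g i (x i)) \<partial>distr (PiM UNIV M) (PiM J M) (\<lambda>x. restrict x J))"
      using m by (subst integral_distr) auto
    also have "\<dots> = (\<Prod>i\<in>J. \<integral>x. g i x \<partial>M i)"
      unfolding d by (rule P.product_integral_prod[OF J g])
    finally show "(\<integral>\<omega>. (\<Prod>i\<in>J. g i (\<omega> i)) \<partial>PiM UNIV M) = (\<Prod>i\<in>J. \<integral>x. g i x \<partial>M i)" .
  }
qed

text \<open>Each term of size at least 1 adds 1 to the truncated sum, so there are finitely many of
  them; the remaining terms are not changed by the truncation.\<close>

lemma count_space_sum_finite_of_min:
  fixes u :: "'i \<Rightarrow> real"
  assumes u: "\<And>i. i \<in> A \<Longrightarrow> 0 \<le> u i"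
    and fin: "(\<integral>\<^sup>+i. ennreal (min 1 (u i)) \<partial>count_space A) < \<infinity>"
  shows "(\<integral>\<^sup>+i. ennreal (u i) \<partial>count_space A) < \<infinity>"
proof -
  let ?B = "{i \<in> A. 1 \<le> u i}"
  have "emeasure (count_space A) ?B = (\<integral>\<^sup>+i. indicator ?B i \<partial>count_space A)" by simp
  also have "\<dots> \<le> (\<integral>\<^sup>+i. ennreal (min 1 (u i)) \<partial>count_space A)"
    by (intro nn_integral_mono) (auto split: split_indicator)
  finally have "emeasure (count_space A) ?B < \<infinity>" using fin by (rule le_less_trans)
  then have finB: "finite ?B" by (subst (asm) emeasure_count_space) (auto split: if_splits)
  have "(\<integral>\<^sup>+i. ennreal (u i) \<partial>count_space A) \<le> (\<integral>\<^sup>+i. ennreal (min 1 (u i)) + ennreal (u i) * indicator ?B i \<partial>count_space A)"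
    by (intro nn_integral_mono) (auto split: split_indicator simp: min_def)
  also have "\<dots> = (\<integral>\<^sup>+i. ennreal (min 1 (u i)) \<partial>count_space A) + (\<integral>\<^sup>+i. ennreal (u i) * indicator ?B i \<partial>count_space A)"
    by (intro nn_integral_add) auto
  also have "(\<integral>\<^sup>+i. ennreal (u i) * indicator ?B i \<partial>count_space A) = (\<Sum>i\<in>?B. ennreal (u i))"
    using finB by (subst nn_integral_indicator_finite) (auto simp: nn_integral_count_space_finite)
  also have "(\<integral>\<^sup>+i. ennreal (min 1 (u i)) \<partial>count_space A) + (\<Sum>i\<in>?B. ennreal (u i)) < \<infinity>"
    using fin finB by (simp add: sum_ennreal u)
  finally show ?thesis .
qed

text \<open>A Poisson process with \<open>\<sigma>\<close>-finite intensity \<open>N\<close>: the weights \<open>g\<^sub>k\<close> sum to one, so that \<open>N\<close> is the sum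
  of the finite measures \<open>g\<^sub>k N = m\<^sub>k p\<^sub>k\<close>, and the \<open>k\<close>-th cluster consists of a Poisson(\<open>m\<^sub>k\<close>)
  number of independent points with law \<open>p\<^sub>k\<close>.\<close>
locale poisson_construction =
  fixes N :: "'b measure" and h :: "'b \<Rightarrow> real"
  assumes h_meas [measurable]: "h \<in> borel_measurable N"
    and h_pos: "0 < h x" and h_le: "h x \<le> 1"
    and h_int: "integrable N h"
    and N_nonzero: "emeasure N (space N) \<noteq> 0"
begin

text \<open>Geometric weights with success probability h(x)/2. Halving keeps the ratio 1 - h/2 at
  least 1/2, so every weight is strictly positive even where h = 1; this makes all the masses
  \<open>m k\<close> positive.\<close>

definition g :: "nat \<Rightarrow> 'b \<Rightarrow> real" where "g k x = (h x / 2) * (1 - h x / 2) ^ k"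

definition m :: "nat \<Rightarrow> real" where "m k = (\<integral>x. g k x \<partial>N)"

definition p :: "nat \<Rightarrow> 'b measure" where "p k = density N (\<lambda>x. ennreal (g k x / m k))"

abbreviation counts :: "(nat \<Rightarrow> nat) measure" where
  "counts \<equiv> PiM UNIV (\<lambda>k. measure_pmf (poisson_pmf (m k)))"

abbreviation points :: "(nat \<times> nat \<Rightarrow> 'b) measure" where
  "points \<equiv> PiM UNIV (\<lambda>i::nat \<times> nat. p (fst i))"

definition \<Omega> :: "((nat \<Rightarrow> nat) \<times> (nat \<times> nat \<Rightarrow> 'b)) measure" where
  "\<Omega> = counts \<Otimes>\<^sub>M points"

text \<open>Every cluster is given an infinite sequence of points, independent of the counts, of
  which only the first \<open>fst \<omega> k\<close> are used. This keeps the sample space a product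
  although the number of points is random.\<close>

definition active :: "(nat \<Rightarrow> nat) \<times> (nat \<times> nat \<Rightarrow> 'b) \<Rightarrow> (nat \<times> nat) set" where
  "active \<omega> = {i. snd i < fst \<omega> (fst i)}"

section \<open>The cluster laws and their superposition\<close>

lemma g_meas [measurable]: "g k \<in> borel_measurable N"
  unfolding g_def by measurable

lemma g_pos: "0 < g k x"
  using h_pos[of x] h_le[of x] by (simp add: g_def)

lemma g_le: "g k x \<le> h x"
proof -
  have "(1 - h x / 2) ^ k \<le> 1" using h_pos[of x] h_le[of x] by (intro power_le_one) auto
  then have "(h x / 2) * (1 - h x / 2) ^ k \<le> (h x / 2) * 1" using h_pos[of x] by (intro mult_left_mono) auto
  then show ?thesis using h_pos[of x] by (simp add: g_def)
qed

lemma g_le_1: "g k x \<le> 1"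
  using g_le[of k x] h_le[of x] by simp

lemma g_sums: "(\<lambda>k. g k x) sums 1"
proof -
  have "(\<lambda>k. (1 - h x / 2) ^ k) sums (1 / (1 - (1 - h x / 2)))"
    using h_pos[of x] h_le[of x] by (intro geometric_sums) auto
  from sums_mult[OF this, of "h x / 2"] show ?thesis using h_pos[of x] by (simp add: g_def)
qed

lemma g_int: "integrable N (g k)"
  by (rule Bochner_Integration.integrable_bound[OF h_int]) (auto simp: g_le abs_of_pos[OF g_pos] abs_of_pos[OF h_pos])

lemma m_pos: "0 < m k"
proof -
  have "0 \<le> m k" unfolding m_def by (intro Bochner_Integration.integral_nonneg) (simp add: less_imp_le[OF g_pos])
  moreover have "m k \<noteq> 0"
  proof
    assume "m k = 0"
    then have "AE x in N. g k x = 0"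
      unfolding m_def using integral_nonneg_eq_0_iff_AE[OF g_int] less_imp_le[OF g_pos] by auto
    then have "AE x in N. False"
    proof (rule eventually_mono)
      fix x assume "g k x = 0" then show False using g_pos[of k x] by simp
    qed
    then show False using N_nonzero by (simp add: eventually_False ae_filter_eq_bot_iff)
  qed
  ultimately show ?thesis by simp
qed

lemma sets_p [simp, measurable_cong]: "sets (p k) = sets N"
  by (simp add: p_def)

lemma space_p [simp]: "space (p k) = space N"
  by (simp add: p_def)

lemma nn_integral_p:
  assumes [measurable]: "f \<in> borel_measurable N"
  shows "ennreal (m k) * (\<integral>\<^sup>+x. f x \<partial>p k) = (\<integral>\<^sup>+x. ennreal (g k x) * f x \<partial>N)"
proof -
  have "ennreal (m k) * (\<integral>\<^sup>+x. f x \<partial>p k) = (\<integral>\<^sup>+x. ennreal (m k) * (ennreal (g k x / m k) * f x) \<partial>N)"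
    unfolding p_def by (subst nn_integral_density) (auto simp: nn_integral_cmult)
  also have "\<dots> = (\<integral>\<^sup>+x. ennreal (g k x) * f x \<partial>N)"
  proof (rule nn_integral_cong)
    fix x
    have "ennreal (m k) * ennreal (g k x / m k) = ennreal (g k x)"
      using m_pos[of k] g_pos[of k x] by (simp flip: ennreal_mult')
    then show "ennreal (m k) * (ennreal (g k x / m k) * f x) = ennreal (g k x) * f x"
      by (simp add: mult.assoc[symmetric])
  qed
  finally show ?thesis .
qed

lemma prob_p: "prob_space (p k)"
proof
  have "ennreal (m k) * emeasure (p k) (space (p k)) = ennreal (m k) * 1"
    using nn_integral_p[of "\<lambda>_. 1" k] nn_integral_eq_integral[OF g_int[of k]] less_imp_le[OF g_pos]
    by (simp add: m_def)
  then show "emeasure (p k) (space (p k)) = 1"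
    using m_pos[of k] by (subst (asm) ennreal_mult_cancel_left) auto
qed

lemma suminf_nn_integral_p:
  assumes [measurable]: "f \<in> borel_measurable N"
  shows "(\<Sum>k. ennreal (m k) * (\<integral>\<^sup>+x. f x \<partial>p k)) = (\<integral>\<^sup>+x. f x \<partial>N)"
proof -
  have "(\<Sum>k. ennreal (m k) * (\<integral>\<^sup>+x. f x \<partial>p k)) = (\<Sum>k. \<integral>\<^sup>+x. ennreal (g k x) * f x \<partial>N)"
    by (simp add: nn_integral_p)
  also have "\<dots> = (\<integral>\<^sup>+x. (\<Sum>k. ennreal (g k x) * f x) \<partial>N)"
    by (intro nn_integral_suminf[symmetric]) auto
  also have "\<dots> = (\<integral>\<^sup>+x. f x \<partial>N)"
  proof (rule nn_integral_cong)
    fix x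
    have "(\<Sum>k. ennreal (g k x)) = ennreal 1"
      by (rule suminf_ennreal_eq) (auto simp: less_imp_le[OF g_pos] g_sums)
    then show "(\<Sum>k. ennreal (g k x) * f x) = f x" by (simp only: ennreal_suminf_multc) simp
  qed
  finally show ?thesis .
qed

lemma integral_p:
  fixes w :: "'b \<Rightarrow> complex"
  assumes w: "integrable N w"
  shows "integrable (p k) w" and "of_real (m k) * (\<integral>x. w x \<partial>p k) = (\<integral>x. g k x *\<^sub>R w x \<partial>N)"
proof -
  have [measurable]: "w \<in> borel_measurable N" using w by auto
  have gw: "integrable N (\<lambda>x. g k x *\<^sub>R w x)"
    by (rule Bochner_Integration.integrable_bound[OF w])
      (auto simp: abs_of_pos[OF g_pos] intro!: mult_left_le_one_le g_le_1 less_imp_le[OF g_pos])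
  have eq: "(g k x / m k) *\<^sub>R w x = (1 / m k) *\<^sub>R (g k x *\<^sub>R w x)" for x by simp
  have nn: "AE x in N. 0 \<le> g k x / m k" using g_pos m_pos by (intro AE_I2 divide_nonneg_nonneg) (auto intro: less_imp_le)
  have gm: "(\<lambda>x. g k x / m k) \<in> borel_measurable N" by measurable
  have i: "integrable N (\<lambda>x. (g k x / m k) *\<^sub>R w x)" unfolding eq by (intro integrable_scaleR_right gw)
  show "integrable (p k) w"
    unfolding p_def integrable_density[OF \<open>w \<in> borel_measurable N\<close> gm nn] by (rule i)
  have "(\<integral>x. w x \<partial>p k) = (\<integral>x. (1 / m k) *\<^sub>R (g k x *\<^sub>R w x) \<partial>N)"
    unfolding p_def integral_density[OF \<open>w \<in> borel_measurable N\<close> gm nn] eq ..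
  also have "\<dots> = (1 / m k) *\<^sub>R (\<integral>x. g k x *\<^sub>R w x \<partial>N)" by (simp only: integral_scaleR_right)
  finally show "of_real (m k) * (\<integral>x. w x \<partial>p k) = (\<integral>x. g k x *\<^sub>R w x \<partial>N)"
    using m_pos[of k] by (simp add: scaleR_conv_of_real)
qed

lemma sum_integral_p_LIMSEQ:
  fixes w :: "'b \<Rightarrow> complex"
  assumes w: "integrable N w"
  shows "(\<lambda>K. \<Sum>k<K. of_real (m k) * (\<integral>x. w x \<partial>p k)) \<longlonglongrightarrow> (\<integral>x. w x \<partial>N)"
proof -
  have [measurable]: "w \<in> borel_measurable N" using w by auto
  have gw: "integrable N (\<lambda>x. g k x *\<^sub>R w x)" for k
    by (rule Bochner_Integration.integrable_bound[OF w])
      (auto simp: abs_of_pos[OF g_pos] intro!: mult_left_le_one_le g_le_1 less_imp_le[OF g_pos])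
  have "(\<lambda>K. \<integral>x. (\<Sum>k<K. g k x) *\<^sub>R w x \<partial>N) \<longlonglongrightarrow> (\<integral>x. w x \<partial>N)"
  proof (rule integral_dominated_convergence[where w = "\<lambda>x. norm (w x)"])
    show "AE x in N. (\<lambda>K. (\<Sum>k<K. g k x) *\<^sub>R w x) \<longlonglongrightarrow> w x"
    proof (rule AE_I2)
      fix x
      have "(\<lambda>K. (\<Sum>k<K. g k x) *\<^sub>R w x) \<longlonglongrightarrow> 1 *\<^sub>R w x"
        using g_sums[of x] by (intro tendsto_scaleR tendsto_const) (simp add: sums_def)
      then show "(\<lambda>K. (\<Sum>k<K. g k x) *\<^sub>R w x) \<longlonglongrightarrow> w x" by simp
    qed
    show "AE x in N. norm ((\<Sum>k<K. g k x) *\<^sub>R w x) \<le> norm (w x)" for K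
    proof (rule AE_I2)
      fix x
      have "(\<Sum>k<K. g k x) \<le> 1" using sum_le_suminf[OF sums_summable[OF g_sums[of x]], of "{..<K}"] sums_unique[OF g_sums[of x], symmetric]
        by (simp add: less_imp_le[OF g_pos])
      moreover have "0 \<le> (\<Sum>k<K. g k x)" by (intro sum_nonneg less_imp_le[OF g_pos])
      ultimately show "norm ((\<Sum>k<K. g k x) *\<^sub>R w x) \<le> norm (w x)" by (simp add: mult_left_le_one_le)
    qed
  qed (use w in auto)
  moreover have "(\<integral>x. (\<Sum>k<K. g k x) *\<^sub>R w x \<partial>N) = (\<Sum>k<K. of_real (m k) * (\<integral>x. w x \<partial>p k))" for K
    using gw by (simp add: scaleR_sum_left integral_p[OF w])
  ultimately show ?thesis by simp
qed

section \<open>Campbell's formula and its almost sure consequences\<close>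

lemma prob_\<Omega>: "prob_space \<Omega>"
proof -
  interpret A: prob_space counts
    by (intro prob_space_PiM prob_space_measure_pmf)
  interpret B: prob_space points
    by (intro prob_space_PiM prob_p)
  interpret pair_prob_space counts points ..
  show ?thesis unfolding \<Omega>_def by unfold_locales
qed

lemma count_meas [measurable]: "(\<lambda>\<omega>. fst \<omega> k) \<in> measurable \<Omega> (count_space UNIV)"
proof -
  have "(\<lambda>n. n k) \<in> measurable counts (measure_pmf (poisson_pmf (m k)))"
    by (rule measurable_component_singleton) simp
  then have "(\<lambda>n. n k) \<in> measurable counts (count_space UNIV)"
    by (simp only: measurable_cong_sets[OF refl sets_measure_pmf_count_space])
  then show ?thesis unfolding \<Omega>_def by (rule measurable_compose[OF measurable_fst])
qed

lemma point_meas [measurable]: "(\<lambda>\<omega>. snd \<omega> i) \<in> measurable \<Omega> N"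
proof -
  have "(\<lambda>n. n i) \<in> measurable points (p (fst i))"
    by (rule measurable_component_singleton) simp
  then have "(\<lambda>n. n i) \<in> measurable points N"
    by (simp only: measurable_cong_sets[OF refl sets_p])
  then show ?thesis unfolding \<Omega>_def by (rule measurable_compose[OF measurable_snd])
qed

lemma point_space: "\<omega> \<in> space \<Omega> \<Longrightarrow> snd \<omega> i \<in> space N"
  using measurable_space[OF point_meas] by blast

lemma nn_integral_\<Omega>:
  assumes [measurable]: "(\<lambda>\<omega>. f (fst \<omega>) (snd \<omega>)) \<in> borel_measurable \<Omega>"
  shows "(\<integral>\<^sup>+\<omega>. f (fst \<omega>) (snd \<omega>) \<partial>\<Omega>)
    = (\<integral>\<^sup>+n. \<integral>\<^sup>+x. f n x \<partial>points \<partial>counts)"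
proof -
  interpret B: prob_space points
    by (intro prob_space_PiM prob_p)
  show ?thesis
    using B.nn_integral_fst[of "\<lambda>\<omega>. f (fst \<omega>) (snd \<omega>)" counts] assms
    by (simp add: \<Omega>_def)
qed

text \<open>By independence the index (k,j) contributes the \<open>p k\<close>-mean of f times the
  probability that the k-th count exceeds j. Summing over j gives \<open>m k\<close> times that
  mean, and summing over k recovers N.\<close>

lemma campbell:
  assumes [measurable]: "f \<in> borel_measurable N"
  shows "(\<integral>\<^sup>+\<omega>. \<integral>\<^sup>+i. f (snd \<omega> i) \<partial>count_space (active \<omega>) \<partial>\<Omega>) = (\<integral>\<^sup>+x. f x \<partial>N)"
proof -
  have one: "(\<integral>\<^sup>+\<omega>. f (snd \<omega> (k, j)) * (if j < fst \<omega> k then 1 else 0) \<partial>\<Omega>)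
      = (\<integral>\<^sup>+x. f x \<partial>p k) * (\<integral>\<^sup>+n. (if j < n then 1 else 0) \<partial>measure_pmf (poisson_pmf (m k)))" for k j
  proof -
    have "(\<integral>\<^sup>+\<omega>. f (snd \<omega> (k, j)) * (if j < fst \<omega> k then 1 else 0) \<partial>\<Omega>)
      = (\<integral>\<^sup>+n. \<integral>\<^sup>+x. f (x (k, j)) * (if j < n k then 1 else 0) \<partial>points \<partial>counts)"
      by (rule nn_integral_\<Omega>[where f = "\<lambda>n x. f (x (k, j)) * (if j < n k then 1 else 0)"]) measurable
    also have "\<dots> = (\<integral>\<^sup>+n. (\<integral>\<^sup>+x. f x \<partial>p k) * (if j < n k then 1 else 0) \<partial>counts)"
      using PiM_prod_integral(1)[where M = "\<lambda>i::nat \<times> nat. p (fst i)" and J = "{(k, j)}" and f = "\<lambda>_. f", OF prob_p]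
      by (intro nn_integral_cong) simp
    also have "\<dots> = (\<integral>\<^sup>+x. f x \<partial>p k) * (\<integral>\<^sup>+n. (if j < n k then 1 else 0) \<partial>counts)"
    proof (rule nn_integral_cmult)
      have "(\<lambda>n. n k) \<in> measurable counts (measure_pmf (poisson_pmf (m k)))"
        by (rule measurable_component_singleton) simp
      then show "(\<lambda>n. if j < n k then 1 else 0) \<in> borel_measurable counts"
        by (rule measurable_compose) simp
    qed
    also have "(\<integral>\<^sup>+n. (if j < n k then 1 else 0) \<partial>counts)
        = (\<integral>\<^sup>+n. (if j < n then 1 else 0) \<partial>measure_pmf (poisson_pmf (m k)))"
      using PiM_prod_integral(1)[where M = "\<lambda>k. measure_pmf (poisson_pmf (m k))" and J = "{k}" and f = "\<lambda>_ n. if j < n then 1 else 0", OF prob_space_measure_pmf]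
      by simp
    finally show ?thesis .
  qed
  \<comment> \<open>The tail-sum formula for the mean of a variable with values in the natural
    numbers.\<close>
  have mean: "(\<integral>\<^sup>+j. \<integral>\<^sup>+n. (if j < n then 1 else 0) \<partial>measure_pmf (poisson_pmf (m k)) \<partial>count_space UNIV) = ennreal (m k)" for k
  proof -
    have "(\<integral>\<^sup>+j. \<integral>\<^sup>+n. (if j < n then 1 else 0) \<partial>measure_pmf (poisson_pmf (m k)) \<partial>count_space UNIV)
      = (\<integral>\<^sup>+n. \<integral>\<^sup>+j. (if j < n then 1 else 0) \<partial>count_space UNIV \<partial>measure_pmf (poisson_pmf (m k)))"
      by (rule nn_integral_count_space_nn_integral[symmetric]) auto
    also have "\<dots> = (\<integral>\<^sup>+n. of_nat n \<partial>measure_pmf (poisson_pmf (m k)))"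
    proof (rule nn_integral_cong)
      fix n :: nat
      have "(\<integral>\<^sup>+j. (if j < n then 1 else 0) \<partial>count_space UNIV) = (\<integral>\<^sup>+j. indicator {..<n} j \<partial>count_space UNIV)"
        by (intro nn_integral_cong) auto
      also have "\<dots> = of_nat n" by (subst nn_integral_indicator) (auto simp: emeasure_count_space_finite)
      finally show "(\<integral>\<^sup>+j. (if j < n then 1 else 0) \<partial>count_space UNIV) = (of_nat n :: ennreal)" .
    qed
    also have "\<dots> = ennreal (m k)" by (rule nn_integral_poisson_mean[OF m_pos])
    finally show ?thesis .
  qed
  have "(\<integral>\<^sup>+\<omega>. \<integral>\<^sup>+i. f (snd \<omega> i) \<partial>count_space (active \<omega>) \<partial>\<Omega>)
      = (\<integral>\<^sup>+\<omega>. \<integral>\<^sup>+i. f (snd \<omega> i) * (if snd i < fst \<omega> (fst i) then 1 else 0) \<partial>count_space UNIV \<partial>\<Omega>)"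
    by (auto simp: nn_integral_count_space_indicator active_def intro!: nn_integral_cong)
  also have "\<dots> = (\<integral>\<^sup>+i. \<integral>\<^sup>+\<omega>. f (snd \<omega> i) * (if snd i < fst \<omega> (fst i) then 1 else 0) \<partial>\<Omega> \<partial>count_space UNIV)"
    by (rule nn_integral_count_space_nn_integral) auto
  also have "\<dots> = (\<integral>\<^sup>+k. \<integral>\<^sup>+j. (\<integral>\<^sup>+x. f x \<partial>p k) * (\<integral>\<^sup>+n. (if j < n then 1 else 0) \<partial>measure_pmf (poisson_pmf (m k))) \<partial>count_space UNIV \<partial>count_space UNIV)"
    by (subst nn_integral_fst_count_space[symmetric]) (simp add: one)
  also have "\<dots> = (\<integral>\<^sup>+k. ennreal (m k) * (\<integral>\<^sup>+x. f x \<partial>p k) \<partial>count_space UNIV)"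
    by (simp add: nn_integral_cmult mean mult.commute)
  also have "\<dots> = (\<integral>\<^sup>+x. f x \<partial>N)" by (simp add: nn_integral_count_space_nat suminf_nn_integral_p)
  finally show ?thesis .
qed

lemma active_sum_eq:
  "(\<integral>\<^sup>+i. f (snd \<omega> i) \<partial>count_space (active \<omega>)) = (\<Sum>k. \<Sum>j. f (snd \<omega> (k, j)) * (if j < fst \<omega> k then 1 else 0))"
proof -
  have "(\<integral>\<^sup>+i. f (snd \<omega> i) \<partial>count_space (active \<omega>)) = (\<integral>\<^sup>+i. f (snd \<omega> i) * (if snd i < fst \<omega> (fst i) then 1 else 0) \<partial>count_space UNIV)"
    by (subst nn_integral_count_space_indicator) (auto simp: active_def intro!: nn_integral_cong split: split_indicator)
  also have "\<dots> = (\<Sum>k. \<Sum>j. f (snd \<omega> (k, j)) * (if j < fst \<omega> k then 1 else 0))"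
    by (subst nn_integral_fst_count_space[symmetric]) (simp add: nn_integral_count_space_nat)
  finally show ?thesis .
qed

lemma active_sum_meas [measurable]:
  assumes [measurable]: "f \<in> borel_measurable N"
  shows "(\<lambda>\<omega>. \<integral>\<^sup>+i. f (snd \<omega> i) \<partial>count_space (active \<omega>)) \<in> borel_measurable \<Omega>"
  unfolding active_sum_eq by measurable

text \<open>Campbell's formula makes the sum of min(1, |z|) over the points finite in mean, hence
  almost surely; \<open>count_space_sum_finite_of_min\<close> then removes the truncation.
  Integrability of z itself is not assumed, and fails for instance for marks with infinite
  mean.\<close>

lemma AE_active_integrable:
  fixes z :: "'b \<Rightarrow> 'c::{banach, second_countable_topology}"
  assumes [measurable]: "z \<in> borel_measurable N"
    and fin: "(\<integral>\<^sup>+x. ennreal (min 1 (norm (z x))) \<partial>N) < \<infinity>"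
  shows "AE \<omega> in \<Omega>. integrable (count_space (active \<omega>)) (\<lambda>i. z (snd \<omega> i))"
proof -
  have "AE \<omega> in \<Omega>. (\<integral>\<^sup>+i. ennreal (min 1 (norm (z (snd \<omega> i)))) \<partial>count_space (active \<omega>)) \<noteq> \<infinity>"
  proof (rule nn_integral_PInf_AE)
    have [measurable]: "(\<lambda>x. ennreal (min 1 (norm (z x)))) \<in> borel_measurable N" by measurable
    show "(\<lambda>\<omega>. \<integral>\<^sup>+i. ennreal (min 1 (norm (z (snd \<omega> i)))) \<partial>count_space (active \<omega>)) \<in> borel_measurable \<Omega>"
      by (rule active_sum_meas) fact
    show "(\<integral>\<^sup>+\<omega>. \<integral>\<^sup>+i. ennreal (min 1 (norm (z (snd \<omega> i)))) \<partial>count_space (active \<omega>) \<partial>\<Omega>) \<noteq> \<infinity>"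
      unfolding campbell[of "\<lambda>x. ennreal (min 1 (norm (z x)))", OF \<open>(\<lambda>x. ennreal (min 1 (norm (z x)))) \<in> borel_measurable N\<close>]
      using fin by (rule less_imp_neq)
  qed
  then show ?thesis
  proof eventually_elim
    case (elim \<omega>)
    have "(\<integral>\<^sup>+i. ennreal (norm (z (snd \<omega> i))) \<partial>count_space (active \<omega>)) < \<infinity>"
    proof (rule count_space_sum_finite_of_min)
      show "(\<integral>\<^sup>+i. ennreal (min 1 (norm (z (snd \<omega> i)))) \<partial>count_space (active \<omega>)) < \<infinity>"
        using elim by (simp only: infinity_ennreal_def less_top)
    qed simp
    then show ?case by (rule integrableI_bounded[rotated]) simp
  qed
qed

text \<open>By Campbell's formula the expected number of points in an N-null set is 0.\<close>

lemma AE_active: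
  assumes "AE x in N. P x"
  shows "AE \<omega> in \<Omega>. \<forall>i\<in>active \<omega>. P (snd \<omega> i)"
proof -
  obtain Z where "{x \<in> space N. \<not> P x} \<subseteq> Z" "emeasure N Z = 0" and Z[measurable]: "Z \<in> sets N"
    using assms by (rule AE_E)
  have "(\<integral>\<^sup>+\<omega>. \<integral>\<^sup>+i. indicator Z (snd \<omega> i) \<partial>count_space (active \<omega>) \<partial>\<Omega>) = 0"
    using \<open>emeasure N Z = 0\<close> by (subst campbell) auto
  then have "AE \<omega> in \<Omega>. (\<integral>\<^sup>+i. indicator Z (snd \<omega> i) \<partial>count_space (active \<omega>)) = 0"
    by (subst (asm) nn_integral_0_iff_AE) auto
  with AE_space show ?thesis
  proof eventually_elim
    case (elim \<omega>)
    have "snd \<omega> i \<notin> Z" if "i \<in> active \<omega>" for i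
      using elim(2) that by (subst (asm) nn_integral_0_iff_AE) (auto simp: AE_count_space)
    then show ?case using point_space[OF elim(1)] \<open>{x \<in> space N. \<not> P x} \<subseteq> Z\<close> by blast
  qed
qed

end

section \<open>The exponential formula\<close>

lemma integral_count_space_indicator:
  fixes f :: "'i \<Rightarrow> 'c::{banach, second_countable_topology}"
  shows "(\<integral>i. f i \<partial>count_space A) = (\<integral>i. indicator A i *\<^sub>R f i \<partial>count_space UNIV)"
  using integral_restrict_space[of A "count_space UNIV" f] by (simp add: restrict_count_space)

context poisson_construction
begin

text \<open>The number of factors is random, but it takes countably many values, and for each fixed
  length the product is measurable.\<close>

lemma cluster_prod_meas [measurable]:
  assumes [measurable]: "v \<in> borel_measurable N"
  shows "(\<lambda>\<omega>. \<Prod>k<K. \<Prod>j<fst \<omega> k. (v (snd \<omega> (k, j)) :: complex)) \<in> borel_measurable \<Omega>"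
proof (intro borel_measurable_prod)
  fix k
  have "(\<lambda>\<omega>. \<Prod>j<n. v (snd \<omega> (k, j))) \<in> borel_measurable \<Omega>" for n :: nat by measurable
  then show "(\<lambda>\<omega>. \<Prod>j<fst \<omega> k. v (snd \<omega> (k, j))) \<in> borel_measurable \<Omega>"
    by (rule measurable_compose_countable[where f = "\<lambda>n \<omega>. \<Prod>j<n. v (snd \<omega> (k, j))" and g = "\<lambda>\<omega>. fst \<omega> k", OF _ count_meas])
qed

lemma cluster_prod_meas_ennreal [measurable]:
  assumes [measurable]: "v \<in> borel_measurable N"
  shows "(\<lambda>\<omega>. \<Prod>k<K. \<Prod>j<fst \<omega> k. (v (snd \<omega> (k, j)) :: ennreal)) \<in> borel_measurable \<Omega>"
proof (intro borel_measurable_prod_ennreal)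
  fix k
  have "(\<lambda>\<omega>. \<Prod>j<n. v (snd \<omega> (k, j))) \<in> borel_measurable \<Omega>" for n :: nat by measurable
  then show "(\<lambda>\<omega>. \<Prod>j<fst \<omega> k. v (snd \<omega> (k, j))) \<in> borel_measurable \<Omega>"
    by (rule measurable_compose_countable[where f = "\<lambda>n \<omega>. \<Prod>j<n. v (snd \<omega> (k, j))" and g = "\<lambda>\<omega>. fst \<omega> k", OF _ count_meas])
qed

text \<open>The bound does not depend on K, so it passes to the supremum and yields the dominating
  function of the exponential formula. The exponents \<open>m k * I k\<close> are the cluster
  contributions to the N-integral of u, hence their partial sums stay below it.\<close>

lemma nn_integral_cluster_prod_le:
  fixes u :: "'b \<Rightarrow> real"
  assumes u: "integrable N u" and u0: "\<And>x. 0 \<le> u x"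
  shows "(\<integral>\<^sup>+\<omega>. (\<Prod>k<K. \<Prod>j<fst \<omega> k. ennreal (1 + u (snd \<omega> (k, j)))) \<partial>\<Omega>) \<le> ennreal (exp (\<integral>x. u x \<partial>N))"
proof -
  have um[measurable]: "u \<in> borel_measurable N" using u by auto
  define I where "I k = enn2real (\<integral>\<^sup>+x. ennreal (u x) \<partial>p k)" for k
  have fin: "(\<integral>\<^sup>+x. ennreal (u x) \<partial>N) = ennreal (\<integral>x. u x \<partial>N)"
    using u0 by (intro nn_integral_eq_integral u) auto
  have le: "(\<Sum>k<K. ennreal (m k) * (\<integral>\<^sup>+x. ennreal (u x) \<partial>p k)) \<le> ennreal (\<integral>x. u x \<partial>N)"
    unfolding fin[symmetric] suminf_nn_integral_p[of "\<lambda>x. ennreal (u x)", OF measurable_compose[OF um measurable_ennreal], symmetric]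
    by (intro sum_le_suminf) auto
  have Ik: "(\<integral>\<^sup>+x. ennreal (u x) \<partial>p k) = ennreal (I k)" for k
  proof -
    have "ennreal (m k) * (\<integral>\<^sup>+x. ennreal (u x) \<partial>p k) \<le> (\<integral>\<^sup>+x. ennreal (u x) \<partial>N)"
      unfolding nn_integral_p[of "\<lambda>x. ennreal (u x)", OF measurable_compose[OF um measurable_ennreal]]
    proof (rule nn_integral_mono)
      fix x
      have "ennreal (g k x) * ennreal (u x) \<le> 1 * ennreal (u x)"
        using g_le_1[of k x] by (intro mult_right_mono) (simp_all add: ennreal_le_1)
      then show "ennreal (g k x) * ennreal (u x) \<le> ennreal (u x)" by simp
    qed
    then have "ennreal (m k) * (\<integral>\<^sup>+x. ennreal (u x) \<partial>p k) < \<top>" unfolding fin by (rule le_less_trans) simp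
    then have "(\<integral>\<^sup>+x. ennreal (u x) \<partial>p k) < \<top>" using m_pos[of k] by (auto simp: ennreal_mult_less_top)
    then show ?thesis by (simp add: I_def)
  qed
  have I0: "0 \<le> I k" for k by (simp add: I_def)
  have sum_le: "(\<Sum>k<K. m k * I k) \<le> (\<integral>x. u x \<partial>N)"
  proof -
    have "ennreal (\<Sum>k<K. m k * I k) \<le> ennreal (\<integral>x. u x \<partial>N)"
      using le by (simp add: Ik I0 less_imp_le[OF m_pos] sum_ennreal flip: ennreal_mult')
    then show ?thesis using u0 by (subst (asm) ennreal_le_iff) auto
  qed
  have one: "(\<integral>\<^sup>+x. ennreal (1 + u x) \<partial>p k) = ennreal (1 + I k)" for k
  proof -
    interpret prob_space "p k" by (rule prob_p)
    have "(\<integral>\<^sup>+x. ennreal (1 + u x) \<partial>p k) = (\<integral>\<^sup>+x. 1 + ennreal (u x) \<partial>p k)"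
      using u0 by (simp add: ennreal_plus)
    also have "\<dots> = 1 + (\<integral>\<^sup>+x. ennreal (u x) \<partial>p k)"
      using emeasure_space_1 by (subst nn_integral_add) auto
    finally show ?thesis using I0 by (simp add: Ik ennreal_plus)
  qed
  have "(\<integral>\<^sup>+\<omega>. (\<Prod>k<K. \<Prod>j<fst \<omega> k. ennreal (1 + u (snd \<omega> (k, j)))) \<partial>\<Omega>)
     = (\<integral>\<^sup>+n. \<integral>\<^sup>+x. (\<Prod>k<K. \<Prod>j<n k. ennreal (1 + u (x (k, j)))) \<partial>points \<partial>counts)"
    by (rule nn_integral_\<Omega>[where f = "\<lambda>n x. \<Prod>k<K. \<Prod>j<n k. ennreal (1 + u (x (k, j)))"])
      (rule cluster_prod_meas_ennreal[of "\<lambda>x. ennreal (1 + u x)"], measurable)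
  also have "\<dots> = (\<integral>\<^sup>+n. (\<Prod>k<K. ennreal (1 + I k) ^ n k) \<partial>counts)"
  proof (rule nn_integral_cong)
    fix n :: "nat \<Rightarrow> nat"
    have "(\<integral>\<^sup>+x. (\<Prod>k<K. \<Prod>j<n k. ennreal (1 + u (x (k, j)))) \<partial>points)
       = (\<integral>\<^sup>+x. (\<Prod>i\<in>Sigma {..<K} (\<lambda>k. {..<n k}). ennreal (1 + u (x i))) \<partial>points)"
      by (subst prod.Sigma) (auto intro!: nn_integral_cong)
    also have "\<dots> = (\<Prod>i\<in>Sigma {..<K} (\<lambda>k. {..<n k}). \<integral>\<^sup>+x. ennreal (1 + u x) \<partial>p (fst i))"
      by (rule PiM_prod_integral(1)[where M = "\<lambda>i::nat \<times> nat. p (fst i)" and f = "\<lambda>_ x. ennreal (1 + u x)", OF prob_p]) auto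
    also have "\<dots> = (\<Prod>(k,j)\<in>Sigma {..<K} (\<lambda>k. {..<n k}). ennreal (1 + I k))"
      by (intro prod.cong) (auto simp: one)
    also have "\<dots> = (\<Prod>k<K. \<Prod>j<n k. ennreal (1 + I k))" by (subst prod.Sigma) auto
    finally show "(\<integral>\<^sup>+x. (\<Prod>k<K. \<Prod>j<n k. ennreal (1 + u (x (k, j)))) \<partial>points) = (\<Prod>k<K. ennreal (1 + I k) ^ n k)"
      by simp
  qed
  also have "\<dots> = (\<Prod>k<K. \<integral>\<^sup>+n. ennreal (1 + I k) ^ n \<partial>measure_pmf (poisson_pmf (m k)))"
    by (rule PiM_prod_integral(1)[where M = "\<lambda>k. measure_pmf (poisson_pmf (m k))" and f = "\<lambda>k n. ennreal (1 + I k) ^ n", OF prob_space_measure_pmf]) auto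
  also have "\<dots> = (\<Prod>k<K. ennreal (exp (m k * I k)))"
    using nn_integral_poisson_power[OF m_pos, of "1 + I _"] I0 by (intro prod.cong) (simp_all del: ennreal_plus)
  also have "\<dots> = ennreal (exp (\<Sum>k<K. m k * I k))" by (simp add: prod_ennreal exp_sum)
  also have "\<dots> \<le> ennreal (exp (\<integral>x. u x \<partial>N))" using sum_le by (intro ennreal_leI) simp
  finally show ?thesis .
qed

lemma norm_cluster_prod_le:
  "ennreal (norm (\<Prod>k<K. \<Prod>j<n k. 1 + w (x (k, j)) :: complex)) \<le> (\<Prod>k<K. \<Prod>j<n k. ennreal (1 + norm (w (x (k, j)))))"
proof -
  have "norm (\<Prod>k<K. \<Prod>j<n k. 1 + w (x (k, j))) = (\<Prod>k<K. \<Prod>j<n k. norm (1 + w (x (k, j))))"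
    by (simp add: prod_norm)
  also have "\<dots> \<le> (\<Prod>k<K. \<Prod>j<n k. 1 + norm (w (x (k, j))))"
    by (intro prod_mono conjI prod_nonneg ballI) (auto intro: order_trans[OF norm_triangle_ineq])
  finally have "ennreal (norm (\<Prod>k<K. \<Prod>j<n k. 1 + w (x (k, j)))) \<le> ennreal (\<Prod>k<K. \<Prod>j<n k. 1 + norm (w (x (k, j))))"
    by (rule ennreal_leI)
  then show ?thesis by (simp add: prod_ennreal prod_nonneg del: ennreal_plus)
qed

lemma cluster_prod_integrable:
  fixes w :: "'b \<Rightarrow> complex"
  assumes w: "integrable N w"
  shows "integrable \<Omega> (\<lambda>\<omega>. \<Prod>k<K. \<Prod>j<fst \<omega> k. 1 + w (snd \<omega> (k, j)))"
proof (rule integrableI_bounded)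
  have [measurable]: "w \<in> borel_measurable N" using w by auto
  show "(\<lambda>\<omega>. \<Prod>k<K. \<Prod>j<fst \<omega> k. 1 + w (snd \<omega> (k, j))) \<in> borel_measurable \<Omega>"
    by (rule cluster_prod_meas[of "\<lambda>x. 1 + w x"]) measurable
  have "(\<integral>\<^sup>+\<omega>. norm (\<Prod>k<K. \<Prod>j<fst \<omega> k. 1 + w (snd \<omega> (k, j))) \<partial>\<Omega>)
     \<le> (\<integral>\<^sup>+\<omega>. (\<Prod>k<K. \<Prod>j<fst \<omega> k. ennreal (1 + norm (w (snd \<omega> (k, j))))) \<partial>\<Omega>)"
    by (intro nn_integral_mono norm_cluster_prod_le)
  also have "\<dots> \<le> ennreal (exp (\<integral>x. norm (w x) \<partial>N))"
    using w by (intro nn_integral_cluster_prod_le) auto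
  also have "\<dots> < \<infinity>" by simp
  finally show "(\<integral>\<^sup>+\<omega>. norm (\<Prod>k<K. \<Prod>j<fst \<omega> k. 1 + w (snd \<omega> (k, j))) \<partial>\<Omega>) < \<infinity>" .
qed

text \<open>Given the counts the points are independent, and the product has mean (1 + a)^n in each
  cluster, where a is the mean of w. The Poisson generating function at 1 + a is exp(m a).\<close>

lemma integral_cluster_prod:
  fixes w :: "'b \<Rightarrow> complex"
  assumes w: "integrable N w"
  shows "(\<integral>\<omega>. (\<Prod>k<K. \<Prod>j<fst \<omega> k. 1 + w (snd \<omega> (k, j))) \<partial>\<Omega>) = exp (\<Sum>k<K. of_real (m k) * (\<integral>x. w x \<partial>p k))"
proof -
  interpret A: prob_space counts
    by (intro prob_space_PiM prob_space_measure_pmf)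
  interpret B: prob_space points
    by (intro prob_space_PiM prob_p)
  interpret pair_prob_space counts points ..
  have one: "(\<integral>x. 1 + w x \<partial>p k) = 1 + (\<integral>x. w x \<partial>p k)" and int1: "integrable (p k) (\<lambda>x. 1 + w x)" for k
  proof -
    interpret prob_space "p k" by (rule prob_p)
    show "(\<integral>x. 1 + w x \<partial>p k) = 1 + (\<integral>x. w x \<partial>p k)"
      using integral_p(1)[OF w, of k] prob_space by (subst Bochner_Integration.integral_add) auto
    show "integrable (p k) (\<lambda>x. 1 + w x)" using integral_p(1)[OF w, of k] by simp
  qed
  have "(\<integral>\<omega>. (\<Prod>k<K. \<Prod>j<fst \<omega> k. 1 + w (snd \<omega> (k, j))) \<partial>\<Omega>)
     = (\<integral>n. \<integral>x. (\<Prod>k<K. \<Prod>j<n k. 1 + w (x (k, j))) \<partial>points \<partial>counts)"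
    using integral_fst'[OF cluster_prod_integrable[OF w, of K, unfolded \<Omega>_def]] by (simp add: \<Omega>_def)
  also have "\<dots> = (\<integral>n. (\<Prod>k<K. (1 + (\<integral>x. w x \<partial>p k)) ^ n k) \<partial>counts)"
  proof (rule Bochner_Integration.integral_cong[OF refl])
    fix n :: "nat \<Rightarrow> nat"
    have "(\<integral>x. (\<Prod>k<K. \<Prod>j<n k. 1 + w (x (k, j))) \<partial>points)
       = (\<integral>x. (\<Prod>i\<in>Sigma {..<K} (\<lambda>k. {..<n k}). 1 + w (x i)) \<partial>points)"
      by (subst prod.Sigma) (auto intro!: Bochner_Integration.integral_cong)
    also have "\<dots> = (\<Prod>i\<in>Sigma {..<K} (\<lambda>k. {..<n k}). \<integral>x. 1 + w x \<partial>p (fst i))"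
      by (rule PiM_prod_integral(2)[where M = "\<lambda>i::nat \<times> nat. p (fst i)" and g = "\<lambda>_ x. 1 + w x", OF prob_p]) (auto simp: int1)
    also have "\<dots> = (\<Prod>(k,j)\<in>Sigma {..<K} (\<lambda>k. {..<n k}). 1 + (\<integral>x. w x \<partial>p k))"
      by (intro prod.cong) (auto simp: one)
    also have "\<dots> = (\<Prod>k<K. \<Prod>j<n k. 1 + (\<integral>x. w x \<partial>p k))" by (subst prod.Sigma) auto
    finally show "(\<integral>x. (\<Prod>k<K. \<Prod>j<n k. 1 + w (x (k, j))) \<partial>points) = (\<Prod>k<K. (1 + (\<integral>x. w x \<partial>p k)) ^ n k)"
      by simp
  qed
  also have "\<dots> = (\<Prod>k<K. \<integral>n. (1 + (\<integral>x. w x \<partial>p k)) ^ n \<partial>measure_pmf (poisson_pmf (m k)))"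
    by (rule PiM_prod_integral(2)[where M = "\<lambda>k. measure_pmf (poisson_pmf (m k))" and g = "\<lambda>k n. (1 + (\<integral>x. w x \<partial>p k)) ^ n", OF prob_space_measure_pmf])
      (auto intro: integral_poisson_power(1)[OF m_pos])
  also have "\<dots> = exp (\<Sum>k<K. of_real (m k) * (\<integral>x. w x \<partial>p k))"
    by (simp add: integral_poisson_power(2)[OF m_pos] exp_sum)
  finally show ?thesis .
qed

text \<open>The domain \<open>active \<omega>\<close> varies with \<omega>; rewriting the sum over
  all index pairs with an indicator turns it into an integral with a parameter.\<close>

lemma active_integral_meas [measurable]:
  fixes z :: "'b \<Rightarrow> 'c::{banach, second_countable_topology}"
  assumes [measurable]: "z \<in> borel_measurable N"
  shows "(\<lambda>\<omega>. \<integral>i. z (snd \<omega> i) \<partial>count_space (active \<omega>)) \<in> borel_measurable \<Omega>"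
proof -
  interpret C: sigma_finite_measure "count_space (UNIV :: (nat \<times> nat) set)"
    by (rule sigma_finite_measure_count_space_countable) simp
  have "(\<lambda>\<omega>. \<integral>i. (if snd i < fst \<omega> (fst i) then 1 else 0) *\<^sub>R z (snd \<omega> i) \<partial>count_space UNIV) \<in> borel_measurable \<Omega>"
  proof (rule C.borel_measurable_lebesgue_integral)
    have "(\<lambda>\<omega>. (if snd i < fst (fst \<omega>) (fst i) then 1 else 0 :: real) *\<^sub>R z (snd (fst \<omega>) i)) \<in> borel_measurable (\<Omega> \<Otimes>\<^sub>M count_space UNIV)" for i :: "nat \<times> nat"
      by measurable
    then have "(\<lambda>\<omega>. (if snd (snd \<omega>) < fst (fst \<omega>) (fst (snd \<omega>)) then 1 else 0 :: real) *\<^sub>R z (snd (fst \<omega>) (snd \<omega>))) \<in> borel_measurable (\<Omega> \<Otimes>\<^sub>M count_space (UNIV :: (nat \<times> nat) set))"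
      by (rule measurable_compose_countable[where g = snd, OF _ measurable_snd])
    then show "(\<lambda>(\<omega>, i). (if snd i < fst \<omega> (fst i) then 1 else 0 :: real) *\<^sub>R z (snd \<omega> i)) \<in> borel_measurable (\<Omega> \<Otimes>\<^sub>M count_space UNIV)"
      by (simp add: split_beta)
  qed
  then show ?thesis
    by (subst integral_count_space_indicator) (simp add: active_def indicator_def of_bool_def)
qed

lemma active_integral_LIMSEQ:
  fixes z :: "'b \<Rightarrow> complex"
  assumes int: "integrable (count_space (active \<omega>)) (\<lambda>i. z (snd \<omega> i))"
  shows "(\<lambda>K. \<Sum>k<K. \<Sum>j<fst \<omega> k. z (snd \<omega> (k, j))) \<longlonglongrightarrow> (\<integral>i. z (snd \<omega> i) \<partial>count_space (active \<omega>))"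
proof -
  have "(\<lambda>K. \<integral>i. indicator {i. fst i < K} i *\<^sub>R z (snd \<omega> i) \<partial>count_space (active \<omega>)) \<longlonglongrightarrow> (\<integral>i. z (snd \<omega> i) \<partial>count_space (active \<omega>))"
  proof (rule integral_dominated_convergence[where w = "\<lambda>i. norm (z (snd \<omega> i))"])
    show "AE i in count_space (active \<omega>). (\<lambda>K. indicat_real {i. fst i < K} i *\<^sub>R z (snd \<omega> i)) \<longlonglongrightarrow> z (snd \<omega> i)"
    proof (intro AE_I2 tendsto_eventually)
      fix i
      show "\<forall>\<^sub>F K in sequentially. indicat_real {i. fst i < K} i *\<^sub>R z (snd \<omega> i) = z (snd \<omega> i)"
        unfolding eventually_sequentially by (intro exI[of _ "Suc (fst i)"]) auto
    qed
  qed (use int in \<open>auto split: split_indicator\<close>)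
  moreover have "(\<integral>i. indicat_real {i. fst i < K} i *\<^sub>R z (snd \<omega> i) \<partial>count_space (active \<omega>)) = (\<Sum>k<K. \<Sum>j<fst \<omega> k. z (snd \<omega> (k, j)))" for K
  proof -
    let ?S = "Sigma {..<K} (\<lambda>k. {..<fst \<omega> k})"
    have sub: "{i \<in> active \<omega>. indicat_real {i. fst i < K} i *\<^sub>R z (snd \<omega> i) \<noteq> 0} \<subseteq> ?S"
      by (auto simp: active_def split: split_indicator_asm)
    have "(\<integral>i. indicat_real {i. fst i < K} i *\<^sub>R z (snd \<omega> i) \<partial>count_space (active \<omega>))
       = (\<Sum>i | i \<in> active \<omega> \<and> indicat_real {i. fst i < K} i *\<^sub>R z (snd \<omega> i) \<noteq> 0. indicat_real {i. fst i < K} i *\<^sub>R z (snd \<omega> i))"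
      by (rule lebesgue_integral_count_space_finite_support[OF finite_subset[OF sub]]) auto
    also have "\<dots> = (\<Sum>i\<in>?S. indicat_real {i. fst i < K} i *\<^sub>R z (snd \<omega> i))"
      using sub by (intro sum.mono_neutral_left) (auto simp: active_def)
    also have "\<dots> = (\<Sum>i\<in>?S. z (snd \<omega> i))" by (intro sum.cong) auto
    also have "\<dots> = (\<Sum>k<K. \<Sum>j<fst \<omega> k. z (snd \<omega> (k, j)))" by (subst sum.Sigma) auto
    finally show ?thesis .
  qed
  ultimately show ?thesis by simp
qed

text \<open>The formula holds for the product over the first K clusters, by
  \<open>integral_cluster_prod\<close> with w = exp z - 1. To pass to the limit under the
  expectation a dominating variable is needed, because the real part of z may be unbounded
  above.\<close>

theorem exponential_formula:
  fixes z :: "'b \<Rightarrow> complex"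
  assumes zm[measurable]: "z \<in> borel_measurable N"
    and fin: "(\<integral>\<^sup>+x. ennreal (min 1 (norm (z x))) \<partial>N) < \<infinity>"
    and w: "integrable N (\<lambda>x. exp (z x) - 1)"
  shows "integrable \<Omega> (\<lambda>\<omega>. exp (\<integral>i. z (snd \<omega> i) \<partial>count_space (active \<omega>)))"
    and "(\<integral>\<omega>. exp (\<integral>i. z (snd \<omega> i) \<partial>count_space (active \<omega>)) \<partial>\<Omega>) = exp (\<integral>x. exp (z x) - 1 \<partial>N)"
proof -
  define u where "u x = norm (exp (z x) - 1)" for x
  define s where "s K \<omega> = (\<Prod>k<K. \<Prod>j<fst \<omega> k. 1 + (exp (z (snd \<omega> (k, j))) - 1))" for K and \<omega> :: "(nat \<Rightarrow> nat) \<times> (nat \<times> nat \<Rightarrow> 'b)"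
  define H where "H K \<omega> = (\<Prod>k<K. \<Prod>j<fst \<omega> k. ennreal (1 + u (snd \<omega> (k, j))))" for K and \<omega> :: "(nat \<Rightarrow> nat) \<times> (nat \<times> nat \<Rightarrow> 'b)"
  have um[measurable]: "u \<in> borel_measurable N" unfolding u_def by measurable
  have [measurable]: "s K \<in> borel_measurable \<Omega>" for K
    unfolding s_def by (rule cluster_prod_meas[of "\<lambda>x. 1 + (exp (z x) - 1)"]) measurable
  have [measurable]: "H K \<in> borel_measurable \<Omega>" for K
    unfolding H_def by (rule cluster_prod_meas_ennreal[of "\<lambda>x. ennreal (1 + u x)"]) measurable
  have inc: "incseq (\<lambda>K. H K)"
  proof (rule incseq_SucI, rule le_funI)
    fix K and \<omega> :: "(nat \<Rightarrow> nat) \<times> (nat \<times> nat \<Rightarrow> 'b)"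
    have "1 \<le> (\<Prod>j<fst \<omega> K. ennreal (1 + u (snd \<omega> (K, j))))"
      by (intro prod_ge_1) (simp add: u_def ennreal_ge_1)
    then have "H K \<omega> * 1 \<le> H K \<omega> * (\<Prod>j<fst \<omega> K. ennreal (1 + u (snd \<omega> (K, j))))" by (intro mult_left_mono) auto
    then show "H K \<omega> \<le> H (Suc K) \<omega>" by (simp add: H_def)
  qed
  \<comment> \<open>The increasing products of 1 + |exp z - 1| bound all partial products of exp z.
    Their supremum has mean at most exp of the N-integral of |exp z - 1|, by monotone
    convergence.\<close>
  define D where "D \<omega> = (SUP K. H K \<omega>)" for \<omega>
  have [measurable]: "D \<in> borel_measurable \<Omega>" unfolding D_def by measurable
  have "(\<integral>\<^sup>+\<omega>. D \<omega> \<partial>\<Omega>) = (SUP K. \<integral>\<^sup>+\<omega>. H K \<omega> \<partial>\<Omega>)"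
    unfolding D_def by (rule nn_integral_monotone_convergence_SUP[OF inc]) auto
  also have "\<dots> \<le> ennreal (exp (\<integral>x. u x \<partial>N))"
    unfolding H_def using w by (intro SUP_least nn_integral_cluster_prod_le) (auto simp: u_def)
  finally have Dfin: "(\<integral>\<^sup>+\<omega>. D \<omega> \<partial>\<Omega>) < \<infinity>" by (rule le_less_trans) simp
  then have DAE: "AE \<omega> in \<Omega>. D \<omega> \<noteq> \<infinity>" by (intro nn_integral_PInf_AE) auto
  have Dint: "integrable \<Omega> (\<lambda>\<omega>. enn2real (D \<omega>))"
  proof (rule integrableI_bounded)
    have "(\<integral>\<^sup>+\<omega>. ennreal (norm (enn2real (D \<omega>))) \<partial>\<Omega>) \<le> (\<integral>\<^sup>+\<omega>. D \<omega> \<partial>\<Omega>)"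
      by (intro nn_integral_mono) (simp add: ennreal_enn2real_if)
    then show "(\<integral>\<^sup>+\<omega>. ennreal (norm (enn2real (D \<omega>))) \<partial>\<Omega>) < \<infinity>" using Dfin by (rule le_less_trans)
  qed measurable
  have lim: "AE \<omega> in \<Omega>. (\<lambda>K. s K \<omega>) \<longlonglongrightarrow> exp (\<integral>i. z (snd \<omega> i) \<partial>count_space (active \<omega>))"
    using AE_active_integrable[OF zm fin]
  proof eventually_elim
    case (elim \<omega>)
    have "s K \<omega> = exp (\<Sum>k<K. \<Sum>j<fst \<omega> k. z (snd \<omega> (k, j)))" for K
      by (simp add: s_def exp_sum)
    then show ?case using active_integral_LIMSEQ[OF elim] by (simp add: tendsto_exp)
  qed
  have bd: "AE \<omega> in \<Omega>. norm (s K \<omega>) \<le> enn2real (D \<omega>)" for K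
    using DAE
  proof eventually_elim
    case (elim \<omega>)
    have "ennreal (norm (s K \<omega>)) \<le> H K \<omega>"
      unfolding s_def H_def u_def by (rule norm_cluster_prod_le)
    also have "\<dots> \<le> D \<omega>" unfolding D_def by (rule SUP_upper) simp
    also have "\<dots> = ennreal (enn2real (D \<omega>))" using elim by (simp add: less_top)
    finally show ?case by (subst (asm) ennreal_le_iff) auto
  qed
  have em: "(\<lambda>\<omega>. exp (\<integral>i. z (snd \<omega> i) \<partial>count_space (active \<omega>))) \<in> borel_measurable \<Omega>"
    using active_integral_meas[OF zm] by measurable
  show "integrable \<Omega> (\<lambda>\<omega>. exp (\<integral>i. z (snd \<omega> i) \<partial>count_space (active \<omega>)))"
    by (rule integrable_dominated_convergence[OF em _ Dint lim bd]) measurable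
  have l1: "(\<lambda>K. \<integral>\<omega>. s K \<omega> \<partial>\<Omega>) \<longlonglongrightarrow> (\<integral>\<omega>. exp (\<integral>i. z (snd \<omega> i) \<partial>count_space (active \<omega>)) \<partial>\<Omega>)"
    by (rule integral_dominated_convergence[OF em _ Dint lim bd]) measurable
  have l2: "(\<lambda>K. \<integral>\<omega>. s K \<omega> \<partial>\<Omega>) \<longlonglongrightarrow> exp (\<integral>x. exp (z x) - 1 \<partial>N)"
    unfolding s_def integral_cluster_prod[OF w] by (intro tendsto_exp sum_integral_p_LIMSEQ[OF w])
  show "(\<integral>\<omega>. exp (\<integral>i. z (snd \<omega> i) \<partial>count_space (active \<omega>)) \<partial>\<Omega>) = exp (\<integral>x. exp (z x) - 1 \<partial>N)"
    using l1 l2 by (rule LIMSEQ_unique)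
qed

text \<open>For two indices a and b, condition on all coordinates except b: the independent b-th
  point has probability 0 of sharing its label with the a-th. There are countably many pairs.
  Injectivity holds on all indices, active or not.\<close>

lemma AE_points_distinct:
  fixes \<pi> :: "'b \<Rightarrow> 'c"
  assumes diag[measurable]: "{q \<in> space (N \<Otimes>\<^sub>M N). \<pi> (fst q) \<noteq> \<pi> (snd q)} \<in> sets (N \<Otimes>\<^sub>M N)"
    and null: "\<And>a. AE b in N. \<pi> a \<noteq> \<pi> b"
  shows "AE \<omega> in \<Omega>. inj (\<lambda>i. \<pi> (snd \<omega> i))"
proof -
  interpret A: prob_space counts
    by (intro prob_space_PiM prob_space_measure_pmf)
  interpret B: prob_space points
    by (intro prob_space_PiM prob_p)
  interpret AB: pair_prob_space counts points ..
  have nullp: "AE b in p k. \<pi> a \<noteq> \<pi> b" for a k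
    unfolding p_def using null[of a] by (subst AE_density) (auto elim: eventually_mono)
  have comp[measurable]: "(\<lambda>x. x i) \<in> measurable (PiM I (\<lambda>i::nat \<times> nat. p (fst i))) N" if "i \<in> I" for i I
    using measurable_component_singleton[OF that, of "\<lambda>i. p (fst i)"] by (simp only: measurable_cong_sets[OF refl sets_p])
  have meas: "{x \<in> space Q. \<pi> (f x) \<noteq> \<pi> (h x)} \<in> sets Q" if [measurable]: "f \<in> measurable Q N" "h \<in> measurable Q N" for Q :: "'d measure" and f h
  proof -
    have "(\<lambda>x. (f x, h x)) -` {q \<in> space (N \<Otimes>\<^sub>M N). \<pi> (fst q) \<noteq> \<pi> (snd q)} \<inter> space Q \<in> sets Q"
      by (rule measurable_sets[OF _ diag]) measurable
    also have "(\<lambda>x. (f x, h x)) -` {q \<in> space (N \<Otimes>\<^sub>M N). \<pi> (fst q) \<noteq> \<pi> (snd q)} \<inter> space Q = {x \<in> space Q. \<pi> (f x) \<noteq> \<pi> (h x)}"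
      using that[THEN measurable_space] by (auto simp: space_pair_measure)
    finally show ?thesis .
  qed
  have pair: "AE x in points. \<pi> (x a) \<noteq> \<pi> (x b)" if "a \<noteq> b" for a b
  proof -
    let ?I = "UNIV - {b}" and ?M = "\<lambda>i::nat \<times> nat. p (fst i)"
    interpret P: prob_space "PiM ?I ?M" by (intro prob_space_PiM prob_p)
    interpret Q: prob_space "?M b" by (rule prob_p)
    interpret PQ: pair_prob_space "?M b" "PiM ?I ?M" ..
    interpret QP: pair_prob_space "PiM ?I ?M" "?M b" ..
    have ins: "insert b ?I = UNIV" by auto
    \<comment> \<open>Splits the coordinate b off the infinite product.\<close>
    have d: "distr (?M b \<Otimes>\<^sub>M PiM ?I ?M) (PiM UNIV ?M) (\<lambda>(x, X). X(b := x)) = PiM UNIV ?M"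
      using distr_pair_PiM_eq_PiM[of ?I ?M b] by (simp add: prob_p ins)
    have am[measurable]: "(\<lambda>x. x a) \<in> measurable (PiM ?I ?M) N" using that by (intro comp) auto
    have fm: "(\<lambda>(x, X). X(b := x)) \<in> measurable (?M b \<Otimes>\<^sub>M PiM ?I ?M) (PiM UNIV ?M)"
      using measurable_fun_upd[of UNIV ?I b snd "?M b \<Otimes>\<^sub>M PiM ?I ?M" ?M fst] by (simp add: split_beta' ins insert_absorb)
    have fsm[measurable]: "fst \<in> measurable (?M b \<Otimes>\<^sub>M PiM ?I ?M) N"
      using measurable_fst[of "?M b" "PiM ?I ?M"] by (simp only: measurable_cong_sets[OF refl sets_p])
    have "AE q in ?M b \<Otimes>\<^sub>M PiM ?I ?M. \<pi> ((snd q) a) \<noteq> \<pi> (fst q)"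
    proof -
      have mset: "{q \<in> space (?M b \<Otimes>\<^sub>M PiM ?I ?M). \<pi> ((snd q) a) \<noteq> \<pi> (fst q)} \<in> sets (?M b \<Otimes>\<^sub>M PiM ?I ?M)"
        by (rule meas) measurable
      show ?thesis
        \<comment> \<open>Exchanging the two variables makes the b-th point innermost, where
          \<open>nullp\<close> applies with the a-th label fixed.\<close>
        unfolding PQ.AE_pair_iff[OF mset, symmetric]
        by (subst PQ.AE_commute[OF mset]) (simp add: nullp)
    qed
    then have "AE q in ?M b \<Otimes>\<^sub>M PiM ?I ?M. \<pi> (((\<lambda>(x, X). X(b := x)) q) a) \<noteq> \<pi> (((\<lambda>(x, X). X(b := x)) q) b)"
      using that by (simp add: split_beta)
    then have "AE x in distr (?M b \<Otimes>\<^sub>M PiM ?I ?M) (PiM UNIV ?M) (\<lambda>(x, X). X(b := x)). \<pi> (x a) \<noteq> \<pi> (x b)"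
      by (subst AE_distr_iff[OF fm]) (auto intro!: meas comp)
    then show ?thesis unfolding d .
  qed
  have "AE x in points. \<forall>a b. a \<noteq> b \<longrightarrow> \<pi> (x a) \<noteq> \<pi> (x b)"
    unfolding AE_all_countable using pair by auto
  then have "AE x in points. inj (\<lambda>i. \<pi> (x i))"
    by (auto simp: inj_def elim!: eventually_mono)
  then obtain Z where Z: "{x \<in> space points. \<not> inj (\<lambda>i. \<pi> (x i))} \<subseteq> Z"
    "emeasure points Z = 0" "Z \<in> sets points"
    by (rule AE_E)
  show ?thesis
    unfolding \<Omega>_def
  proof (rule AE_I)
    show "{\<omega> \<in> space (counts \<Otimes>\<^sub>M points). \<not> inj (\<lambda>i. \<pi> (snd \<omega> i))}
       \<subseteq> space counts \<times> Z"
      using Z(1) by (auto simp: space_pair_measure simp del: space_PiM)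
    show "emeasure (counts \<Otimes>\<^sub>M points) (space counts \<times> Z) = 0"
      using Z(2,3) by (subst B.emeasure_pair_measure_Times) auto
  qed (use Z(3) in auto)
qed

end

subsection \<open>The measure-valued Levy process\<close>

lemma radon_sigma_finite:
  fixes \<eta> :: "'a::heine_borel measure"
  assumes \<eta>: "\<eta> \<in> radon_measures"
  shows "sigma_finite_measure \<eta>"
proof -
  let ?A = "range (\<lambda>n::nat. cball (undefined :: 'a) (real n))"
  have "countable ?A" by (rule countable_image) simp
  moreover have "?A \<subseteq> sets \<eta>" unfolding radon_setsD[OF \<eta>] by (intro image_subsetI sets_cball)
  moreover have "\<Union>?A = space \<eta>" unfolding radon_spaceD[OF \<eta>] by (rule cball_cover)
  moreover have "\<forall>b\<in>?A. emeasure \<eta> b \<noteq> \<infinity>"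
  proof
    fix b assume "b \<in> ?A"
    then have "compact b" by auto
    from radon_compact_finite[OF \<eta> this] show "emeasure \<eta> b \<noteq> \<infinity>" by simp
  qed
  ultimately show ?thesis unfolding sigma_finite_measure_def by blast
qed

text \<open>Here l is Borel on the whole line and hypothesis (a) is a nonnegative integral; the
  final theorem enters this setting after extending l by 0.\<close>

locale levy_setup =
  fixes dx :: "'a::heine_borel measure" and l :: "real \<Rightarrow> real"
  assumes dx_radon: "dx \<in> radon_measures"
    and dx_nonatomic: "emeasure dx {x} = 0"
    and dx_nonzero: "emeasure dx UNIV \<noteq> 0"
    and l_meas [measurable]: "l \<in> borel_measurable borel"
    and l_pos: "0 < s \<Longrightarrow> 0 < l s"
    and l_int: "(\<integral>\<^sup>+s. ennreal (l s * min 1 (1 / s)) * indicator {0<..} s \<partial>lborel) < \<infinity>"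
begin

sublocale dx: sigma_finite_measure dx
  by (rule radon_sigma_finite[OF dx_radon])

sublocale dxl: pair_sigma_finite dx lborel ..

text \<open>The density of the Levy intensity, extended by 0. Marks can then range over all of
  \<open>real\<close>, and N lives on a plain product space.\<close>

definition \<rho> :: "real \<Rightarrow> real" where "\<rho> s = (if 0 < s then l s / s else 0)"

definition N :: "('a \<times> real) measure" where
  "N = density (dx \<Otimes>\<^sub>M lborel) (\<lambda>q. ennreal (\<rho> (snd q)))"

lemma sets_dx [measurable_cong]: "sets dx = sets borel"
  by (rule radon_setsD[OF dx_radon])

lemma space_dx [simp]: "space dx = UNIV"
  by (rule radon_spaceD[OF dx_radon])

lemma sets_dxl: "sets (dx \<Otimes>\<^sub>M lborel) = sets (borel \<Otimes>\<^sub>M borel)"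
  by (rule sets_pair_measure_cong[OF sets_dx sets_lborel])

lemma sets_N [simp, measurable_cong]: "sets N = sets (borel \<Otimes>\<^sub>M borel)"
  unfolding N_def sets_density by (rule sets_dxl)

lemma space_N [simp]: "space N = UNIV"
  by (simp add: N_def space_pair_measure)

lemma \<rho>_meas [measurable]: "\<rho> \<in> borel_measurable borel"
  unfolding \<rho>_def by measurable

lemma \<rho>_nonneg: "0 \<le> \<rho> s"
  using l_pos[of s] by (auto simp: \<rho>_def less_imp_le)

lemma meas_dxl: "f \<in> borel_measurable (borel \<Otimes>\<^sub>M borel) \<longleftrightarrow> f \<in> borel_measurable (dx \<Otimes>\<^sub>M lborel)"
  by (rule arg_cong[where f = "\<lambda>A. f \<in> A"], rule measurable_cong_sets[OF sets_dxl[symmetric] refl])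

lemma nn_integral_N:
  assumes f: "f \<in> borel_measurable (borel \<Otimes>\<^sub>M borel)"
  shows "(\<integral>\<^sup>+q. f q \<partial>N) = (\<integral>\<^sup>+x. \<integral>\<^sup>+s. ennreal (\<rho> s) * f (x, s) \<partial>lborel \<partial>dx)"
proof -
  note [measurable] = f[unfolded meas_dxl]
  have "(\<integral>\<^sup>+q. f q \<partial>N) = (\<integral>\<^sup>+q. ennreal (\<rho> (snd q)) * f q \<partial>(dx \<Otimes>\<^sub>M lborel))"
    unfolding N_def by (rule nn_integral_density) measurable
  also have "\<dots> = (\<integral>\<^sup>+x. \<integral>\<^sup>+s. ennreal (\<rho> s) * f (x, s) \<partial>lborel \<partial>dx)"
    by (subst lborel.nn_integral_fst[symmetric]) simp_all
  finally show ?thesis .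
qed

lemma integral_levy_intensity:
  fixes f :: "real \<Rightarrow> complex"
  assumes [measurable]: "f \<in> borel_measurable borel"
  shows "(\<integral>s. f s \<partial>levy_intensity l) = (\<integral>s. \<rho> s *\<^sub>R f s \<partial>lborel)"
proof -
  let ?R = "restrict_space lborel {0<..} :: real measure"
  have "(\<integral>s. f s \<partial>levy_intensity l) = (\<integral>s. (l s / s) *\<^sub>R f s \<partial>?R)"
    unfolding levy_intensity_def
  proof (rule integral_density)
    show "f \<in> borel_measurable ?R" "(\<lambda>s. l s / s) \<in> borel_measurable ?R"
      by (rule measurable_restrict_space1, measurable)+
    show "AE s in ?R. 0 \<le> l s / s" by (intro AE_I2) (auto simp: space_restrict_space intro!: divide_nonneg_pos less_imp_le[OF l_pos])
  qed
  also have "\<dots> = (\<integral>s. indicator {0<..} s *\<^sub>R ((l s / s) *\<^sub>R f s) \<partial>lborel)"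
    by (rule integral_restrict_space) simp
  also have "\<dots> = (\<integral>s. \<rho> s *\<^sub>R f s \<partial>lborel)"
    by (intro Bochner_Integration.integral_cong) (auto simp: \<rho>_def)
  finally show ?thesis .
qed

lemma integral_N:
  fixes w :: "'a \<times> real \<Rightarrow> complex"
  assumes w: "integrable N w"
  shows "(\<integral>q. w q \<partial>N) = (\<integral>x. \<integral>s. \<rho> s *\<^sub>R w (x, s) \<partial>lborel \<partial>dx)"
proof -
  have wm: "w \<in> borel_measurable (borel \<Otimes>\<^sub>M borel)"
    using borel_measurable_integrable[OF w] by (simp only: measurable_cong_sets[OF sets_N refl])
  note [measurable] = wm[unfolded meas_dxl]
  have i: "integrable (dx \<Otimes>\<^sub>M lborel) (\<lambda>q. \<rho> (snd q) *\<^sub>R w q)"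
    using w unfolding N_def by (subst (asm) integrable_density) (auto simp: \<rho>_nonneg)
  have "(\<integral>q. w q \<partial>N) = (\<integral>q. \<rho> (snd q) *\<^sub>R w q \<partial>(dx \<Otimes>\<^sub>M lborel))"
    unfolding N_def by (rule integral_density) (auto simp: \<rho>_nonneg)
  also have "\<dots> = (\<integral>x. \<integral>s. \<rho> s *\<^sub>R w (x, s) \<partial>lborel \<partial>dx)"
    using dxl.integral_fst'[OF i] by simp
  finally show ?thesis .
qed

text \<open>Hypothesis (a) in the form used for points: min 1 (c s) is at most max 1 c times min 1
  s, and dividing min 1 s by s gives min 1 (1/s), the factor in (a). Compactness of K makes the
  space integral finite.\<close>

lemma nn_integral_min_N:
  assumes K: "compact K" and c: "0 \<le> c"
  shows "(\<integral>\<^sup>+q. ennreal (min 1 (c * \<bar>snd q\<bar> * indicator K (fst q))) \<partial>N) < \<infinity>"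
proof -
  have [measurable]: "K \<in> sets borel" using K by (rule borel_compact)
  let ?C = "max 1 c"
  have pt: "\<rho> s * min 1 (c * \<bar>s\<bar> * indicator K x) \<le> (?C * indicator K x) * (l s * min 1 (1 / s) * indicator {0<..} s)" for x s
  proof (cases "x \<in> K \<and> 0 < s")
    case True
    then have s: "0 < s" by simp
    have "min 1 (c * s) \<le> ?C * min 1 s"
    proof (cases "s \<le> 1")
      case True
      then show ?thesis using s by (simp add: min.coboundedI2 mult_right_mono)
    next
      case False
      then show ?thesis by (simp add: min.coboundedI1)
    qed
    then have "l s / s * min 1 (c * s) \<le> l s / s * (?C * min 1 s)"
      using l_pos[OF s] s by (intro mult_left_mono) auto
    also have "\<dots> = ?C * (l s * (min 1 s / s))" by simp
    also have "min 1 s / s = min 1 (1 / s)" using s by (auto simp: min_def field_simps)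
    finally show ?thesis using True by (simp add: \<rho>_def)
  next
    case False
    then show ?thesis by (auto simp: \<rho>_def)
  qed
  have "(\<integral>\<^sup>+q. ennreal (min 1 (c * \<bar>snd q\<bar> * indicator K (fst q))) \<partial>N)
    = (\<integral>\<^sup>+x. \<integral>\<^sup>+s. ennreal (\<rho> s) * ennreal (min 1 (c * \<bar>s\<bar> * indicator K x)) \<partial>lborel \<partial>dx)"
    by (subst nn_integral_N) auto
  also have "\<dots> \<le> (\<integral>\<^sup>+x. \<integral>\<^sup>+s. ennreal (?C * indicator K x) * (ennreal (l s * min 1 (1 / s)) * indicator {0<..} s) \<partial>lborel \<partial>dx)"
  proof (intro nn_integral_mono)
    fix x s
    have "ennreal (\<rho> s) * ennreal (min 1 (c * \<bar>s\<bar> * indicator K x)) = ennreal (\<rho> s * min 1 (c * \<bar>s\<bar> * indicator K x))"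
      using \<rho>_nonneg c by (simp add: ennreal_mult)
    also have "\<dots> \<le> ennreal ((?C * indicator K x) * (l s * min 1 (1 / s) * indicator {0<..} s))"
      by (intro ennreal_leI pt)
    also have "\<dots> = ennreal (?C * indicator K x) * (ennreal (l s * min 1 (1 / s)) * indicator {0<..} s)"
      by (subst ennreal_mult') (auto split: split_indicator)
    finally show "ennreal (\<rho> s) * ennreal (min 1 (c * \<bar>s\<bar> * indicator K x)) \<le> ennreal (?C * indicator K x) * (ennreal (l s * min 1 (1 / s)) * indicator {0<..} s)" .
  qed
  also have "\<dots> = (\<integral>\<^sup>+x. ennreal ?C * (\<integral>\<^sup>+s. ennreal (l s * min 1 (1 / s)) * indicator {0<..} s \<partial>lborel) * indicator K x \<partial>dx)"
    by (intro nn_integral_cong, subst nn_integral_cmult) (auto split: split_indicator)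
  also have "\<dots> = ennreal ?C * (\<integral>\<^sup>+s. ennreal (l s * min 1 (1 / s)) * indicator {0<..} s \<partial>lborel) * emeasure dx K"
    by (rule nn_integral_cmult_indicator) (simp add: sets_dx)
  also have "\<dots> < \<infinity>"
    using l_int radon_compact_finite[OF dx_radon K] by (simp add: ennreal_mult_less_top)
  finally show ?thesis .
qed

lemma sigma_finite_N: "sigma_finite_measure N"
  unfolding N_def by (subst dxl.sigma_finite_iff_density_finite) auto

lemma N_nonzero: "emeasure N (space N) \<noteq> 0"
proof
  assume "emeasure N (space N) = 0"
  then have "(\<integral>\<^sup>+q. 1 \<partial>N) = 0" by simp
  then have "(\<integral>\<^sup>+x. \<integral>\<^sup>+s. ennreal (\<rho> s) \<partial>lborel \<partial>dx) = 0" by (subst (asm) nn_integral_N) auto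
  then have "(\<integral>\<^sup>+s. ennreal (\<rho> s) \<partial>lborel) = 0" using dx_nonzero by simp
  then have "AE s in lborel. ennreal (\<rho> s) = 0" by (subst (asm) nn_integral_0_iff_AE) auto
  then have "AE s in lborel. s \<notin> {0<..<1::real}"
  proof (rule eventually_mono)
    fix s assume "ennreal (\<rho> s) = 0"
    then show "s \<notin> {0<..<1}" using l_pos[of s] by (auto simp: \<rho>_def ennreal_eq_0_iff divide_le_0_iff)
  qed
  then have "emeasure lborel {0<..<1::real} = 0"
    by (subst (asm) AE_iff_null_sets[symmetric]) auto
  then show False by simp
qed

lemma ex_poisson: "\<exists>h. poisson_construction N h"
proof -
  interpret sigma_finite_measure N by (rule sigma_finite_N)
  show ?thesis
  proof (rule obtain_positive_integrable_function)
    fix f :: "'a \<times> real \<Rightarrow> real"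
    assume "f \<in> borel_measurable N" "\<And>x. f x > 0" "\<And>x. f x \<le> 1" "integrable N f"
    then have "poisson_construction N f" using N_nonzero by unfold_locales auto
    then show ?thesis by blast
  qed
qed

text \<open>Any admissible weight serves: it shapes the sample space, while the resulting law is
  fixed by its characteristic functional.\<close>

definition hN :: "'a \<times> real \<Rightarrow> real" where "hN = (SOME h. poisson_construction N h)"

sublocale P: poisson_construction N hN
  unfolding hN_def by (rule someI_ex[OF ex_poisson])

section \<open>The random measure carried by the Poisson points\<close>

definition Xi0 :: "(nat \<Rightarrow> nat) \<times> (nat \<times> nat \<Rightarrow> 'a \<times> real) \<Rightarrow> 'a measure" where
  "Xi0 \<omega> = distr (density (count_space (P.active \<omega>)) (\<lambda>i. ennreal (max 0 (snd (snd \<omega> i))))) borel (\<lambda>i. fst (snd \<omega> i))"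

definition locally_finite :: "(nat \<Rightarrow> nat) \<times> (nat \<times> nat \<Rightarrow> 'a \<times> real) \<Rightarrow> bool" where
  "locally_finite \<omega> \<longleftrightarrow> (\<forall>n::nat. (\<integral>\<^sup>+i. ennreal (max 0 (snd (snd \<omega> i)) * indicator (cball undefined (real n)) (fst (snd \<omega> i))) \<partial>count_space (P.active \<omega>)) < \<infinity>)"

text \<open>On the null event that some ball has infinite mass the measure is replaced by 0. The map
  then takes values in the Radon measures everywhere, as measurability into
  \<open>vague_space\<close> requires.\<close>

definition Xi :: "(nat \<Rightarrow> nat) \<times> (nat \<times> nat \<Rightarrow> 'a \<times> real) \<Rightarrow> 'a measure" where
  "Xi \<omega> = (if locally_finite \<omega> then Xi0 \<omega> else null_measure borel)"

lemma nn_integral_Xi0: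
  assumes [measurable]: "f \<in> borel_measurable borel"
  shows "(\<integral>\<^sup>+x. f x \<partial>Xi0 \<omega>) = (\<integral>\<^sup>+i. ennreal (max 0 (snd (snd \<omega> i))) * f (fst (snd \<omega> i)) \<partial>count_space (P.active \<omega>))"
  unfolding Xi0_def by (subst nn_integral_distr) (simp_all add: nn_integral_density)

lemma pairing_Xi0:
  assumes [measurable]: "\<phi> \<in> borel_measurable borel"
  shows "pairing \<phi> (Xi0 \<omega>) = (\<integral>i. max 0 (snd (snd \<omega> i)) * \<phi> (fst (snd \<omega> i)) \<partial>count_space (P.active \<omega>))"
  unfolding Xi0_def pairing_def by (subst integral_distr, simp, simp, subst integral_density) simp_all

lemma sets_Xi0: "sets (Xi0 \<omega>) = sets borel"
  by (simp add: Xi0_def)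

lemma Xi_radon: "Xi \<omega> \<in> radon_measures"
proof (cases "locally_finite \<omega>")
  case True
  have "emeasure (Xi0 \<omega>) K < \<infinity>" if K: "compact K" for K
  proof -
    have Km[measurable]: "K \<in> sets borel" using K by (rule borel_compact)
    obtain a r where ar: "\<forall>y\<in>K. dist a y \<le> r" using compact_imp_bounded[OF K] unfolding bounded_def by blast
    obtain n :: nat where n: "dist undefined a + r \<le> real n" using real_arch_simple by blast
    have sub: "K \<subseteq> cball undefined (real n)"
    proof
      fix y assume "y \<in> K"
      then have "dist a y \<le> r" using ar by blast
      then show "y \<in> cball undefined (real n)" using dist_triangle[of undefined y a] n by simp
    qed
    have "emeasure (Xi0 \<omega>) K \<le> emeasure (Xi0 \<omega>) (cball undefined (real n))"
      using sub by (intro emeasure_mono) (auto simp: sets_Xi0)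
    also have "\<dots> = (\<integral>\<^sup>+x. indicator (cball undefined (real n)) x \<partial>Xi0 \<omega>)"
      by (rule nn_integral_indicator[symmetric]) (simp add: sets_Xi0)
    also have "\<dots> = (\<integral>\<^sup>+i. ennreal (max 0 (snd (snd \<omega> i)) * indicator (cball undefined (real n)) (fst (snd \<omega> i))) \<partial>count_space (P.active \<omega>))"
      by (subst nn_integral_Xi0) (auto simp: ennreal_mult' ennreal_indicator intro!: nn_integral_cong)
    also have "\<dots> < \<infinity>" using True unfolding locally_finite_def by blast
    finally show ?thesis .
  qed
  then show ?thesis using True by (simp add: Xi_def radon_measures_def sets_Xi0)
qed (simp add: Xi_def radon_measures_def)

lemma locally_finite_meas [measurable]: "Measurable.pred P.\<Omega> locally_finite"
proof -
  have [measurable]: "(\<lambda>q::'a \<times> real. ennreal (max 0 (snd q) * indicator (cball undefined (real n)) (fst q))) \<in> borel_measurable N" for n :: nat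
    by measurable
  show ?thesis unfolding locally_finite_def by measurable
qed

lemma Xi_meas [measurable]: "Xi \<in> measurable P.\<Omega> vague_space"
proof (rule measurable_vague_spaceI)
  fix \<phi> :: "'a \<Rightarrow> real" assume "\<phi> \<in> Cc"
  note [measurable] = Cc_borel[OF this]
  have [measurable]: "(\<lambda>q::'a \<times> real. max 0 (snd q) * \<phi> (fst q)) \<in> borel_measurable N" by measurable
  have "pairing \<phi> (Xi \<omega>) = (if locally_finite \<omega> then (\<integral>i. max 0 (snd (snd \<omega> i)) * \<phi> (fst (snd \<omega> i)) \<partial>count_space (P.active \<omega>)) else 0)" for \<omega>
    by (simp add: Xi_def pairing_Xi0) (simp add: pairing_def)
  then show "(\<lambda>\<omega>. pairing \<phi> (Xi \<omega>)) \<in> borel_measurable P.\<Omega>"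
    by (simp only:) measurable
qed (rule Xi_radon)

text \<open>The marks over a ball, truncated at 1, are N-integrable by (a), so their untruncated sum
  is almost surely finite; there are countably many balls.\<close>

lemma AE_locally_finite: "AE \<omega> in P.\<Omega>. locally_finite \<omega>"
  unfolding locally_finite_def AE_all_countable
proof
  fix n :: nat
  let ?z = "\<lambda>q::'a \<times> real. max 0 (snd q) * indicator (cball undefined (real n)) (fst q)"
  have "(\<integral>\<^sup>+q. ennreal (min 1 (norm (?z q))) \<partial>N) \<le> (\<integral>\<^sup>+q. ennreal (min 1 (1 * \<bar>snd q\<bar> * indicator (cball undefined (real n)) (fst q))) \<partial>N)"
    by (intro nn_integral_mono ennreal_leI min.mono) (auto split: split_indicator)
  also have "\<dots> < \<infinity>" by (rule nn_integral_min_N) auto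
  finally have "AE \<omega> in P.\<Omega>. integrable (count_space (P.active \<omega>)) (\<lambda>i. ?z (snd \<omega> i))"
    by (intro P.AE_active_integrable) measurable
  then show "AE \<omega> in P.\<Omega>. (\<integral>\<^sup>+i. ennreal (?z (snd \<omega> i)) \<partial>count_space (P.active \<omega>)) < \<infinity>"
  proof (rule eventually_mono)
    fix \<omega> assume "integrable (count_space (P.active \<omega>)) (\<lambda>i. ?z (snd \<omega> i))"
    then have "(\<integral>\<^sup>+i. ennreal (norm (?z (snd \<omega> i))) \<partial>count_space (P.active \<omega>)) < \<infinity>"
      by (simp only: integrable_iff_bounded)
    also have "(\<integral>\<^sup>+i. ennreal (norm (?z (snd \<omega> i))) \<partial>count_space (P.active \<omega>)) = (\<integral>\<^sup>+i. ennreal (?z (snd \<omega> i)) \<partial>count_space (P.active \<omega>))"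
      by (intro nn_integral_cong arg_cong[where f = ennreal]) simp
    finally show "(\<integral>\<^sup>+i. ennreal (?z (snd \<omega> i)) \<partial>count_space (P.active \<omega>)) < \<infinity>" .
  qed
qed

lemma AE_marks_pos: "AE \<omega> in P.\<Omega>. \<forall>i\<in>P.active \<omega>. 0 < snd (snd \<omega> i)"
proof (rule P.AE_active)
  show "AE q in N. 0 < snd q"
    unfolding N_def by (subst AE_density) (auto simp: \<rho>_def)
qed

text \<open>The fibre over a point is N-null because dx has no atoms. The mark integral over the
  fibre may be infinite; the product with 0 is still 0 in \<open>ennreal\<close>.\<close>

lemma AE_points_inj: "AE \<omega> in P.\<Omega>. inj (\<lambda>i. fst (snd \<omega> i))"
proof (rule P.AE_points_distinct)
  have [measurable]: "(\<lambda>q. (fst (fst q), fst (snd q))) \<in> measurable (N \<Otimes>\<^sub>M N) (borel \<Otimes>\<^sub>M (borel :: 'a measure))"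
    by measurable
  have "{q \<in> space (N \<Otimes>\<^sub>M N). fst (fst q) \<noteq> fst (snd q)} = space (N \<Otimes>\<^sub>M N) - (\<lambda>q. (fst (fst q), fst (snd q))) -` {p :: 'a \<times> 'a. fst p = snd p} \<inter> space (N \<Otimes>\<^sub>M N)"
    by auto
  also have "\<dots> \<in> sets (N \<Otimes>\<^sub>M N)" by measurable
  finally show "{q \<in> space (N \<Otimes>\<^sub>M N). fst (fst q) \<noteq> fst (snd q)} \<in> sets (N \<Otimes>\<^sub>M N)" .
  fix q0 :: "'a \<times> real"
  have [measurable]: "{fst q0} \<in> sets borel" by simp
  have "(\<integral>\<^sup>+q. indicator {fst q0} (fst q) \<partial>N) = (\<integral>\<^sup>+x. \<integral>\<^sup>+s. ennreal (\<rho> s) * indicator {fst q0} x \<partial>lborel \<partial>dx)"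
    by (subst nn_integral_N) auto
  also have "\<dots> = (\<integral>\<^sup>+x. (\<integral>\<^sup>+s. ennreal (\<rho> s) \<partial>lborel) * indicator {fst q0} x \<partial>dx)"
    by (intro nn_integral_cong nn_integral_multc) auto
  also have "\<dots> = 0" by (subst nn_integral_cmult_indicator) (auto simp: sets_dx dx_nonatomic)
  finally have "AE q in N. indicator {fst q0} (fst q) = (0::ennreal)" by (subst (asm) nn_integral_0_iff_AE) auto
  then show "AE q in N. fst q0 \<noteq> fst q" by (rule eventually_mono) (auto simp: indicator_def)
qed

end

section \<open>Tilting the law by a sum over atoms\<close>

text \<open>Transfers integrability from exp L - 1 to the truncation of |L|. The factor 2 is for
  negative t = -u, where 1 - exp t is at least u/(1+u), which is at least half of min 1 u.\<close>

lemma min_abs_le_exp_minus_1: "min 1 \<bar>t\<bar> \<le> 2 * \<bar>exp t - 1\<bar>" for t :: real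
proof (cases "0 \<le> t")
  case True
  then have "t \<le> exp t - 1" using exp_ge_add_one_self[of t] by linarith
  then show ?thesis using True by (simp add: min_def)
next
  case False
  define u where "u = - t"
  have u: "0 < u" using False by (simp add: u_def)
  have "1 + u \<le> exp u" by (rule exp_ge_add_one_self)
  then have "exp t \<le> 1 / (1 + u)" using u by (simp add: u_def exp_minus field_simps)
  moreover have "min 1 u \<le> 2 * (1 - 1 / (1 + u))" using u by (simp add: min_def field_simps mult_left_le)
  ultimately have "min 1 u \<le> 2 * (1 - exp t)" by (meson diff_left_mono mult_left_mono order_trans zero_le_numeral)
  moreover have "exp t < 1" using False by simp
  ultimately show ?thesis using u by (simp add: u_def)
qed

lemma norm_cis_minus_1_le: "norm (cis t - 1) \<le> 2 * min 1 \<bar>t\<bar>"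
proof -
  have "norm (cis t - 1) \<le> \<bar>t\<bar>" using iexp_approx1[of t 0] by (simp add: cis_conv_exp)
  moreover have "norm (cis t - 1) \<le> 2" using norm_triangle_ineq4[of "cis t" 1] by simp
  ultimately show ?thesis unfolding min_def by (auto intro: order_trans)
qed

text \<open>The sum of L(x, s_x) over the atoms, as positive part minus negative part. Each part is
  an \<open>atom_sum\<close>, so the expression is measurable on all of M(X); an infinite part is
  sent to 0 by \<open>enn2real\<close>, which matters only where the series does not converge
  absolutely.\<close>

definition log_tilt :: "('a \<times> real \<Rightarrow> real) \<Rightarrow> 'a measure \<Rightarrow> real" where
  "log_tilt L \<eta> = enn2real (atom_sum (\<lambda>q. ennreal (L q)) \<eta>) - enn2real (atom_sum (\<lambda>q. ennreal (- L q)) \<eta>)"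

lemma log_tilt_measurable [measurable]:
  fixes L :: "'a::heine_borel \<times> real \<Rightarrow> real"
  assumes [measurable]: "L \<in> borel_measurable (borel \<Otimes>\<^sub>M borel)"
  shows "log_tilt L \<in> borel_measurable vague_space"
  unfolding log_tilt_def[abs_def] by measurable

lemma log_tilt_zero: "log_tilt (\<lambda>_. 0) \<eta> = 0"
  by (simp add: log_tilt_def atom_sum_def)

context levy_setup
begin

definition law :: "'a measure measure" where
  "law = distr P.\<Omega> vague_space Xi"

lemma sets_law [simp, measurable_cong]: "sets law = sets vague_space"
  by (simp add: law_def)

lemma space_law [simp]: "space law = radon_measures"
  by (simp add: law_def space_vague)

lemma prob_law: "prob_space law"
  unfolding law_def by (rule prob_space.prob_space_distr[OF P.prob_\<Omega> Xi_meas])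

lemma AE_good: "AE \<omega> in P.\<Omega>. locally_finite \<omega> \<and> (\<forall>i\<in>P.active \<omega>. 0 < snd (snd \<omega> i)) \<and> inj (\<lambda>i. fst (snd \<omega> i))"
  using AE_locally_finite AE_marks_pos AE_points_inj by eventually_elim auto

lemma pairing_Xi:
  assumes good: "locally_finite \<omega>" "\<forall>i\<in>P.active \<omega>. 0 < snd (snd \<omega> i)"
    and [measurable]: "\<phi> \<in> borel_measurable borel"
  shows "pairing \<phi> (Xi \<omega>) = (\<integral>i. snd (snd \<omega> i) * \<phi> (fst (snd \<omega> i)) \<partial>count_space (P.active \<omega>))"
  using good by (auto simp: Xi_def pairing_Xi0 intro!: Bochner_Integration.integral_cong)

text \<open>Since the locations are distinct, only the index i contributes to the mass of its
  location.\<close>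

lemma emeasure_Xi_point:
  assumes good: "locally_finite \<omega>" "\<forall>i\<in>P.active \<omega>. 0 < snd (snd \<omega> i)" "inj (\<lambda>i. fst (snd \<omega> i))"
    and i: "i \<in> P.active \<omega>"
  shows "emeasure (Xi \<omega>) {fst (snd \<omega> i)} = ennreal (snd (snd \<omega> i))"
proof -
  have "emeasure (Xi \<omega>) {fst (snd \<omega> i)} = (\<integral>\<^sup>+x. indicator {fst (snd \<omega> i)} x \<partial>Xi0 \<omega>)"
    using good by (subst nn_integral_indicator) (auto simp: sets_Xi0 Xi_def)
  also have "\<dots> = (\<integral>\<^sup>+j. ennreal (max 0 (snd (snd \<omega> j))) * indicator {fst (snd \<omega> i)} (fst (snd \<omega> j)) \<partial>count_space (P.active \<omega>))"
    by (rule nn_integral_Xi0) simp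
  also have "\<dots> = (\<integral>\<^sup>+j. ennreal (snd (snd \<omega> i)) * indicator {i} j \<partial>count_space (P.active \<omega>))"
    using good i by (intro nn_integral_cong) (auto split: split_indicator dest: injD)
  also have "\<dots> = ennreal (snd (snd \<omega> i)) * emeasure (count_space (P.active \<omega>)) {i}"
    using i by (intro nn_integral_cmult_indicator) auto
  also have "\<dots> = ennreal (snd (snd \<omega> i))" using i by (simp add: emeasure_count_space_finite)
  finally show ?thesis .
qed

text \<open>The bridge from sums over the Poisson points to functionals of the random measure alone:
  the mark of a point can be read off as the mass of its location.\<close>

lemma atom_sum_Xi:
  assumes good: "locally_finite \<omega>" "\<forall>i\<in>P.active \<omega>. 0 < snd (snd \<omega> i)" "inj (\<lambda>i. fst (snd \<omega> i))"
    and [measurable]: "f \<in> borel_measurable (borel \<Otimes>\<^sub>M borel)"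
  shows "atom_sum f (Xi \<omega>) = (\<integral>\<^sup>+i. f (snd \<omega> i) \<partial>count_space (P.active \<omega>))"
proof -
  note [measurable] = point_mass_measurable2[OF Xi_radon[of \<omega>]]
  have [measurable]: "atom_mass (Xi \<omega>) \<in> borel_measurable borel" unfolding atom_mass_def[abs_def] by measurable
  have "atom_sum f (Xi \<omega>) = (\<integral>\<^sup>+x. f (x, atom_mass (Xi \<omega>) x) / emeasure (Xi \<omega>) {x} \<partial>Xi0 \<omega>)"
    unfolding atom_sum_def using good(1) by (simp add: Xi_def)
  also have "\<dots> = (\<integral>\<^sup>+i. ennreal (max 0 (snd (snd \<omega> i))) * (f (fst (snd \<omega> i), atom_mass (Xi \<omega>) (fst (snd \<omega> i))) / emeasure (Xi \<omega>) {fst (snd \<omega> i)}) \<partial>count_space (P.active \<omega>))"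
    by (rule nn_integral_Xi0) measurable
  also have "\<dots> = (\<integral>\<^sup>+i. f (snd \<omega> i) \<partial>count_space (P.active \<omega>))"
  proof (rule nn_integral_cong)
    fix i assume "i \<in> space (count_space (P.active \<omega>))"
    then have i: "i \<in> P.active \<omega>" by simp
    then have s: "0 < snd (snd \<omega> i)" using good by blast
    have e: "emeasure (Xi \<omega>) {fst (snd \<omega> i)} = ennreal (snd (snd \<omega> i))" by (rule emeasure_Xi_point[OF good i])
    then have mm: "atom_mass (Xi \<omega>) (fst (snd \<omega> i)) = snd (snd \<omega> i)" using s by (simp add: atom_mass_def)
    have "ennreal (snd (snd \<omega> i)) * (f (snd \<omega> i) / ennreal (snd (snd \<omega> i))) = f (snd \<omega> i) * ennreal (snd (snd \<omega> i)) / ennreal (snd (snd \<omega> i))"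
      by (simp only: ennreal_times_divide mult.commute)
    also have "\<dots> = f (snd \<omega> i)" using s by (intro ennreal_mult_divide_eq) auto
    finally show "ennreal (max 0 (snd (snd \<omega> i))) * (f (fst (snd \<omega> i), atom_mass (Xi \<omega>) (fst (snd \<omega> i))) / emeasure (Xi \<omega>) {fst (snd \<omega> i)}) = f (snd \<omega> i)"
      unfolding e mm prod.collapse using s by (simp only: max_absorb2[OF less_imp_le[OF s]])
  qed
  finally show ?thesis .
qed

lemma log_tilt_Xi:
  fixes L :: "'a \<times> real \<Rightarrow> real"
  assumes good: "locally_finite \<omega>" "\<forall>i\<in>P.active \<omega>. 0 < snd (snd \<omega> i)" "inj (\<lambda>i. fst (snd \<omega> i))"
    and [measurable]: "L \<in> borel_measurable (borel \<Otimes>\<^sub>M borel)"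
    and int: "integrable (count_space (P.active \<omega>)) (\<lambda>i. L (snd \<omega> i))"
  shows "log_tilt L (Xi \<omega>) = (\<integral>i. L (snd \<omega> i) \<partial>count_space (P.active \<omega>))"
  unfolding log_tilt_def real_lebesgue_integral_def[OF int]
  by (subst (1 2) atom_sum_Xi[OF good]) simp_all

lemma integrable_min_Cc:
  assumes \<phi>: "\<phi> \<in> Cc"
  shows "integrable N (\<lambda>q. min 1 \<bar>snd q * \<phi> (fst q)\<bar>)"
proof (rule integrableI_bounded)
  note [measurable] = Cc_borel[OF \<phi>]
  show "(\<lambda>q. min 1 \<bar>snd q * \<phi> (fst q)\<bar>) \<in> borel_measurable N" by measurable
  obtain K M where K: "compact K" and "0 \<le> M" and M: "\<forall>x. \<bar>\<phi> x\<bar> \<le> M * indicator K x"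
    by (rule Cc_bounded[OF \<phi>])
  have "(\<integral>\<^sup>+q. ennreal (norm (min 1 \<bar>snd q * \<phi> (fst q)\<bar>)) \<partial>N) \<le> (\<integral>\<^sup>+q. ennreal (min 1 (M * \<bar>snd q\<bar> * indicator K (fst q))) \<partial>N)"
  proof (intro nn_integral_mono ennreal_leI)
    fix q :: "'a \<times> real"
    have "\<bar>snd q\<bar> * \<bar>\<phi> (fst q)\<bar> \<le> \<bar>snd q\<bar> * (M * indicator K (fst q))" using M by (intro mult_left_mono) auto
    then show "norm (min 1 \<bar>snd q * \<phi> (fst q)\<bar>) \<le> min 1 (M * \<bar>snd q\<bar> * indicator K (fst q))"
      by (simp add: abs_mult mult_ac min_def)
  qed
  also have "\<dots> < \<infinity>" by (rule nn_integral_min_N[OF K \<open>0 \<le> M\<close>])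
  finally show "(\<integral>\<^sup>+q. ennreal (norm (min 1 \<bar>snd q * \<phi> (fst q)\<bar>)) \<partial>N) < \<infinity>" .
qed

lemma integrable_cis_minus_1:
  assumes \<phi>: "\<phi> \<in> Cc"
  shows "integrable N (\<lambda>q. cis (snd q * \<phi> (fst q)) - 1)"
proof (rule Bochner_Integration.integrable_bound)
  note [measurable] = Cc_borel[OF \<phi>]
  show "integrable N (\<lambda>q. 2 * min 1 \<bar>snd q * \<phi> (fst q)\<bar>)" by (intro integrable_mult_right integrable_min_Cc[OF \<phi>])
  show "(\<lambda>q. cis (snd q * \<phi> (fst q)) - 1) \<in> borel_measurable N" by measurable
  show "AE q in N. norm (cis (snd q * \<phi> (fst q)) - 1) \<le> norm (2 * min 1 \<bar>snd q * \<phi> (fst q)\<bar>)"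
  proof (rule AE_I2)
    fix q :: "'a \<times> real"
    show "norm (cis (snd q * \<phi> (fst q)) - 1) \<le> norm (2 * min 1 \<bar>snd q * \<phi> (fst q)\<bar>)"
      using norm_cis_minus_1_le[of "snd q * \<phi> (fst q)"] by simp
  qed
qed

lemma AE_log_tilt_integrable:
  fixes L :: "'a \<times> real \<Rightarrow> real"
  assumes Lm: "L \<in> borel_measurable (borel \<Otimes>\<^sub>M borel)"
    and eL: "integrable N (\<lambda>q. exp (L q) - 1)"
  shows "AE \<omega> in P.\<Omega>. integrable (count_space (P.active \<omega>)) (\<lambda>i. L (snd \<omega> i))"
proof (rule P.AE_active_integrable)
  show "L \<in> borel_measurable N" using Lm by (simp only: measurable_cong_sets[OF sets_N refl])
  have "(\<integral>\<^sup>+q. ennreal (min 1 (norm (L q))) \<partial>N) \<le> (\<integral>\<^sup>+q. 2 * ennreal (norm (exp (L q) - 1)) \<partial>N)"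
  proof (rule nn_integral_mono)
    fix q :: "'a \<times> real"
    have "ennreal (min 1 (norm (L q))) \<le> ennreal (2 * norm (exp (L q) - 1))"
      using min_abs_le_exp_minus_1[of "L q"] by (intro ennreal_leI) simp
    then show "ennreal (min 1 (norm (L q))) \<le> 2 * ennreal (norm (exp (L q) - 1))" by (simp add: ennreal_mult')
  qed
  also have "\<dots> = 2 * (\<integral>\<^sup>+q. ennreal (norm (exp (L q) - 1)) \<partial>N)"
    by (intro nn_integral_cmult measurable_compose[OF borel_measurable_integrable[OF eL], of "\<lambda>x. ennreal (norm x)"]) simp
  also have "\<dots> < \<infinity>" using eL by (simp add: integrable_iff_bounded ennreal_mult_less_top)
  finally show "(\<integral>\<^sup>+q. ennreal (min 1 (norm (L q))) \<partial>N) < \<infinity>" .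
qed

text \<open>The exponential formula for z = L + i s \<phi>, carried over to the law of
  \<open>Xi\<close>. The case L = 0 gives the characteristic functional, the case \<phi> = 0 the
  normalisation of the tilt.\<close>

theorem tilted_characteristic_functional:
  fixes L :: "'a \<times> real \<Rightarrow> real"
  assumes Lm: "L \<in> borel_measurable (borel \<Otimes>\<^sub>M borel)"
    and eL: "integrable N (\<lambda>q. exp (L q) - 1)" and \<phi>: "\<phi> \<in> Cc"
  shows "integrable law (\<lambda>\<eta>. exp (log_tilt L \<eta>) *\<^sub>R cis (pairing \<phi> \<eta>))"
    and "(\<integral>\<eta>. exp (log_tilt L \<eta>) *\<^sub>R cis (pairing \<phi> \<eta>) \<partial>law) = exp (\<integral>q. exp (L q) *\<^sub>R cis (snd q * \<phi> (fst q)) - 1 \<partial>N)"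
    and "integrable N (\<lambda>q. exp (L q) *\<^sub>R cis (snd q * \<phi> (fst q)) - 1)"
proof -
  note [measurable] = Cc_borel[OF \<phi>] Lm pairing_measurable[OF \<phi>]
  define z where "z q = complex_of_real (L q) + \<i> * of_real (snd q * \<phi> (fst q))" for q
  have LmN[measurable]: "L \<in> borel_measurable N" using Lm by (simp only: measurable_cong_sets[OF sets_N refl])
  have zm: "z \<in> borel_measurable N" unfolding z_def by measurable
  have ez: "exp (z q) = exp (L q) *\<^sub>R cis (snd q * \<phi> (fst q))" for q
    by (simp add: z_def exp_add exp_of_real cis_conv_exp scaleR_conv_of_real)
  have m1: "integrable N (\<lambda>q. 2 * \<bar>exp (L q) - 1\<bar> + min 1 \<bar>snd q * \<phi> (fst q)\<bar>)"
    using eL by (intro Bochner_Integration.integrable_add integrable_min_Cc[OF \<phi>] integrable_mult_right) auto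
  have zfin: "(\<integral>\<^sup>+q. ennreal (min 1 (norm (z q))) \<partial>N) < \<infinity>"
  proof -
    have "(\<integral>\<^sup>+q. ennreal (min 1 (norm (z q))) \<partial>N) \<le> (\<integral>\<^sup>+q. ennreal (norm (2 * \<bar>exp (L q) - 1\<bar> + min 1 \<bar>snd q * \<phi> (fst q)\<bar>)) \<partial>N)"
    proof (intro nn_integral_mono ennreal_leI)
      fix q :: "'a \<times> real"
      have "norm (z q) \<le> \<bar>L q\<bar> + \<bar>snd q * \<phi> (fst q)\<bar>"
        unfolding z_def by (rule order_trans[OF norm_triangle_ineq]) (simp add: norm_mult)
      then have "min 1 (norm (z q)) \<le> min 1 \<bar>L q\<bar> + min 1 \<bar>snd q * \<phi> (fst q)\<bar>" by (auto simp: min_def)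
      also have "\<dots> \<le> norm (2 * \<bar>exp (L q) - 1\<bar> + min 1 \<bar>snd q * \<phi> (fst q)\<bar>)"
        using min_abs_le_exp_minus_1[of "L q"] by simp
      finally show "min 1 (norm (z q)) \<le> norm (2 * \<bar>exp (L q) - 1\<bar> + min 1 \<bar>snd q * \<phi> (fst q)\<bar>)" .
    qed
    also have "\<dots> < \<infinity>" using m1 unfolding integrable_iff_bounded by blast
    finally show ?thesis .
  qed
  have wint: "integrable N (\<lambda>q. exp (z q) - 1)"
  proof -
    \<comment> \<open>Splits exp z - 1 into (exp L - 1) cis(s \<phi>) and cis(s \<phi>) - 1,
      integrable by \<open>eL\<close> and by (a).\<close>
    have "integrable N (\<lambda>q. (exp (L q) - 1) *\<^sub>R cis (snd q * \<phi> (fst q)))"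
      by (rule Bochner_Integration.integrable_bound[OF eL]) (auto intro!: AE_I2)
    from Bochner_Integration.integrable_add[OF this integrable_cis_minus_1[OF \<phi>]]
    show ?thesis by (simp add: ez algebra_simps)
  qed
  then show "integrable N (\<lambda>q. exp (L q) *\<^sub>R cis (snd q * \<phi> (fst q)) - 1)" by (simp add: ez)
  \<comment> \<open>Both exponents converge absolutely almost surely, so the sum of z separates into
    the tilt and the pairing.\<close>
  have ae: "AE \<omega> in P.\<Omega>. exp (log_tilt L (Xi \<omega>)) *\<^sub>R cis (pairing \<phi> (Xi \<omega>)) = exp (\<integral>i. z (snd \<omega> i) \<partial>count_space (P.active \<omega>))"
    using AE_good P.AE_active_integrable[OF zm zfin] AE_log_tilt_integrable[OF Lm eL]
  proof eventually_elim
    case (elim \<omega>)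
    then have g: "locally_finite \<omega>" "\<forall>i\<in>P.active \<omega>. 0 < snd (snd \<omega> i)" "inj (\<lambda>i. fst (snd \<omega> i))" by blast+
    have i2: "integrable (count_space (P.active \<omega>)) (\<lambda>i. snd (snd \<omega> i) * \<phi> (fst (snd \<omega> i)))"
      using integrable_Im[OF elim(2)] by (simp add: z_def)
    have "(\<integral>i. z (snd \<omega> i) \<partial>count_space (P.active \<omega>))
      = (\<integral>i. complex_of_real (L (snd \<omega> i)) \<partial>count_space (P.active \<omega>)) + \<i> * (\<integral>i. complex_of_real (snd (snd \<omega> i) * \<phi> (fst (snd \<omega> i))) \<partial>count_space (P.active \<omega>))"
      unfolding z_def using elim(3) i2
      by (subst Bochner_Integration.integral_add) (auto intro!: integrable_of_real integrable_mult_right simp del: of_real_mult)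
    also have "\<dots> = complex_of_real (log_tilt L (Xi \<omega>)) + \<i> * complex_of_real (pairing \<phi> (Xi \<omega>))"
      unfolding log_tilt_Xi[OF g Lm elim(3)] pairing_Xi[OF g(1,2) Cc_borel[OF \<phi>]] by (simp only: integral_complex_of_real)
    finally show ?case by (simp add: exp_add exp_of_real cis_conv_exp scaleR_conv_of_real)
  qed
  have fm: "(\<lambda>\<eta>. exp (log_tilt L \<eta>) *\<^sub>R cis (pairing \<phi> \<eta>)) \<in> borel_measurable vague_space"
    using log_tilt_measurable[OF Lm] by measurable
  have fm': "(\<lambda>\<omega>. exp (log_tilt L (Xi \<omega>)) *\<^sub>R cis (pairing \<phi> (Xi \<omega>))) \<in> borel_measurable P.\<Omega>"
    by (rule measurable_compose[OF Xi_meas fm])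
  have em: "(\<lambda>\<omega>. exp (\<integral>i. z (snd \<omega> i) \<partial>count_space (P.active \<omega>))) \<in> borel_measurable P.\<Omega>"
    using P.active_integral_meas[OF zm] by measurable
  show "integrable law (\<lambda>\<eta>. exp (log_tilt L \<eta>) *\<^sub>R cis (pairing \<phi> \<eta>))"
    unfolding law_def integrable_distr_eq[OF Xi_meas fm] integrable_cong_AE[OF fm' em ae]
    by (rule P.exponential_formula(1)[OF zm zfin wint])
  show "(\<integral>\<eta>. exp (log_tilt L \<eta>) *\<^sub>R cis (pairing \<phi> \<eta>) \<partial>law) = exp (\<integral>q. exp (L q) *\<^sub>R cis (snd q * \<phi> (fst q)) - 1 \<partial>N)"
    unfolding law_def integral_distr[OF Xi_meas fm] integral_cong_AE[OF fm' em ae]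
      P.exponential_formula(2)[OF zm zfin wint] ez ..
qed

lemma characteristic_functional:
  assumes \<phi>: "\<phi> \<in> Cc"
  shows "(\<integral>\<eta>. cis (pairing \<phi> \<eta>) \<partial>law) = exp (\<integral>q. cis (snd q * \<phi> (fst q)) - 1 \<partial>N)"
  using tilted_characteristic_functional(2)[of "\<lambda>_. 0", OF _ _ \<phi>] by (simp add: log_tilt_zero)

text \<open>Identifies the abstract law with the constructed one, so that everything proved about
  the Poisson representation applies to it.\<close>

lemma levy_law_eq_law: "levy_law dx (levy_intensity l) = law"
proof (rule levy_law_eqI)
  show "is_levy_law dx (levy_intensity l) law"
    unfolding is_levy_law_def
  proof (intro conjI ballI)
    fix \<phi> :: "'a \<Rightarrow> real" assume \<phi>: "\<phi> \<in> Cc"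
    show "(\<integral>\<eta>. cis (pairing \<phi> \<eta>) \<partial>law) = exp (\<integral>x. (\<integral>s. (cis (s * \<phi> x) - 1) \<partial>levy_intensity l) \<partial>dx)"
      unfolding characteristic_functional[OF \<phi>] integral_N[OF integrable_cis_minus_1[OF \<phi>]]
      by (subst integral_levy_intensity) simp_all
  qed (auto intro: prob_law)
qed

lemma AE_law_atom_sum_finite:
  fixes L :: "'a \<times> real \<Rightarrow> real"
  assumes Lm: "L \<in> borel_measurable (borel \<Otimes>\<^sub>M borel)"
    and eL: "integrable N (\<lambda>q. exp (L q) - 1)"
  shows "AE \<eta> in law. atom_sum (\<lambda>q. ennreal \<bar>L q\<bar>) \<eta> < \<infinity>"
proof -
  note [measurable] = Lm
  have fm: "(\<lambda>q. ennreal \<bar>L q\<bar>) \<in> borel_measurable (borel \<Otimes>\<^sub>M borel)" by measurable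
  have "AE \<omega> in P.\<Omega>. atom_sum (\<lambda>q. ennreal \<bar>L q\<bar>) (Xi \<omega>) < \<infinity>"
    using AE_good AE_log_tilt_integrable[OF Lm eL]
  proof eventually_elim
    case (elim \<omega>)
    then have g: "locally_finite \<omega>" "\<forall>i\<in>P.active \<omega>. 0 < snd (snd \<omega> i)" "inj (\<lambda>i. fst (snd \<omega> i))" by blast+
    show ?case unfolding atom_sum_Xi[OF g fm] using elim(2) by (simp add: integrable_iff_bounded)
  qed
  moreover have "{\<eta> \<in> space vague_space. atom_sum (\<lambda>q. ennreal \<bar>L q\<bar>) \<eta> < \<infinity>} \<in> sets vague_space"
    using atom_sum_measurable[OF fm] by measurable
  ultimately show ?thesis unfolding law_def by (subst AE_distr_iff[OF Xi_meas])
qed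

end

subsection \<open>Quasi-invariance under multiplication\<close>

locale levy_multiplier = levy_setup dx l for dx :: "'a::heine_borel measure" and l +
  fixes \<theta> :: "'a \<Rightarrow> real"
  assumes l_osc: "\<forall>n::nat. n \<ge> 1 \<longrightarrow> (\<exists>\<epsilon>>0. \<exists>C::real. \<forall>r\<in>{1 / real n .. real n}.
              (\<integral>\<^sup>+s\<in>{0<..<\<epsilon>}. ennreal (\<bar>l (r * s) - l s\<bar> / s) \<partial>lborel) \<le> ennreal C)"
    and \<theta>: "\<theta> \<in> C0pos"
begin

lemma \<theta>_meas [measurable]: "\<theta> \<in> borel_measurable borel"
  by (rule C0pos_borel[OF \<theta>])

lemma \<theta>_pos: "0 < \<theta> x"
  using \<theta> by (simp add: C0pos_def)

section \<open>Integrability of the change of intensity\<close>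

lemma tail_finite:
  assumes \<delta>: "0 < \<delta>"
  shows "(\<integral>\<^sup>+s. ennreal (l s / s) * indicator {\<delta>..} s \<partial>lborel) < \<infinity>"
proof -
  let ?C = "max 1 (1 / \<delta>)"
  have "(\<integral>\<^sup>+s. ennreal (l s / s) * indicator {\<delta>..} s \<partial>lborel) \<le> (\<integral>\<^sup>+s. ennreal ?C * (ennreal (l s * min 1 (1 / s)) * indicator {0<..} s) \<partial>lborel)"
  proof (rule nn_integral_mono)
    fix s
    show "ennreal (l s / s) * indicator {\<delta>..} s \<le> ennreal ?C * (ennreal (l s * min 1 (1 / s)) * indicator {0<..} s)"
    proof (cases "\<delta> \<le> s")
      case True
      then have s: "0 < s" using \<delta> by simp
      have "1 / s \<le> ?C * min 1 (1 / s)"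
      proof (cases "s \<le> 1")
        case True
        have "1 / s \<le> 1 / \<delta>" using \<open>\<delta> \<le> s\<close> \<delta> s by (simp add: frac_le)
        then show ?thesis using True s by (simp add: min_def)
      next
        case False
        then have "1 / s < 1" by simp
        then have "min 1 (1 / s) = 1 / s" by simp
        moreover have "1 * (1 / s) \<le> ?C * (1 / s)" using s by (intro mult_right_mono) auto
        ultimately show ?thesis by simp
      qed
      then have "l s * (1 / s) \<le> l s * (?C * min 1 (1 / s))" using l_pos[OF s] by (intro mult_left_mono) auto
      then have "ennreal (l s / s) \<le> ennreal (?C * (l s * min 1 (1 / s)))" by (intro ennreal_leI) (simp add: mult_ac)
      also have "\<dots> = ennreal ?C * ennreal (l s * min 1 (1 / s))" by (rule ennreal_mult') simp
      finally show ?thesis using s True by simp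
    qed simp
  qed
  also have "\<dots> = ennreal ?C * (\<integral>\<^sup>+s. ennreal (l s * min 1 (1 / s)) * indicator {0<..} s \<partial>lborel)"
    by (rule nn_integral_cmult) measurable
  also have "\<dots> < \<infinity>" using l_int by (simp add: ennreal_mult_less_top)
  finally show ?thesis .
qed

text \<open>The measure ds/s is invariant under scaling, so the substitution only moves the
  cut-off.\<close>

lemma scaled_tail:
  "(\<integral>\<^sup>+s. ennreal (l (s / \<theta> x) / s) * indicator {\<epsilon>..} s \<partial>lborel) = (\<integral>\<^sup>+s. ennreal (l s / s) * indicator {\<epsilon> / \<theta> x..} s \<partial>lborel)"
proof -
  have "(\<integral>\<^sup>+s. ennreal (l (s / \<theta> x) / s) * indicator {\<epsilon>..} s \<partial>lborel)
    = ennreal \<bar>\<theta> x\<bar> * (\<integral>\<^sup>+s. ennreal (l ((0 + \<theta> x * s) / \<theta> x) / (0 + \<theta> x * s)) * indicator {\<epsilon>..} (0 + \<theta> x * s) \<partial>lborel)"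
    using \<theta>_pos[of x] by (intro nn_integral_real_affine) auto
  also have "\<dots> = (\<integral>\<^sup>+s. ennreal \<bar>\<theta> x\<bar> * (ennreal (l ((0 + \<theta> x * s) / \<theta> x) / (0 + \<theta> x * s)) * indicator {\<epsilon>..} (0 + \<theta> x * s)) \<partial>lborel)"
    by (rule nn_integral_cmult[symmetric]) measurable
  also have "\<dots> = (\<integral>\<^sup>+s. ennreal (l s / s) * indicator {\<epsilon> / \<theta> x..} s \<partial>lborel)"
  proof (rule nn_integral_cong)
    fix s
    have "ennreal \<bar>\<theta> x\<bar> * ennreal (l ((0 + \<theta> x * s) / \<theta> x) / (0 + \<theta> x * s)) = ennreal (\<theta> x * (l s / (\<theta> x * s)))"
      using \<theta>_pos[of x] by (subst ennreal_mult'[symmetric]) auto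
    also have "\<theta> x * (l s / (\<theta> x * s)) = l s / s" using \<theta>_pos[of x] by simp
    finally have "ennreal \<bar>\<theta> x\<bar> * ennreal (l ((0 + \<theta> x * s) / \<theta> x) / (0 + \<theta> x * s)) = ennreal (l s / s)" .
    moreover have "indicator {\<epsilon>..} (0 + \<theta> x * s) = (indicator {\<epsilon> / \<theta> x..} s :: ennreal)"
      using \<theta>_pos[of x] by (auto simp: indicator_def field_simps)
    ultimately show "ennreal \<bar>\<theta> x\<bar> * (ennreal (l ((0 + \<theta> x * s) / \<theta> x) / (0 + \<theta> x * s)) * indicator {\<epsilon>..} (0 + \<theta> x * s)) = ennreal (l s / s) * indicator {\<epsilon> / \<theta> x..} s"
      by (simp only: mult.assoc[symmetric])
  qed
  finally show ?thesis .
qed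

text \<open>Below \<epsilon> the difference is controlled by (c), above \<epsilon> each of its two
  terms is integrable separately, and outside K it is 0 because \<theta> = 1. The inner bound is
  uniform in x, so the finite mass of K finishes the estimate.\<close>

lemma rate_difference_finite:
  "(\<integral>\<^sup>+x. \<integral>\<^sup>+s. ennreal (\<bar>l s - l (s / \<theta> x)\<bar> / s) * indicator {0<..} s \<partial>lborel \<partial>dx) < \<infinity>"
proof -
  obtain K n where K: "compact K" and n: "n \<ge> 1" and out: "\<forall>x. x \<notin> K \<longrightarrow> \<theta> x = 1" and bd: "\<forall>x. \<theta> x \<in> {1 / real n .. real n}"
    by (rule C0pos_bounds[OF \<theta>])
  have Km[measurable]: "K \<in> sets borel" using K by (rule borel_compact)
  obtain \<epsilon> C where \<epsilon>: "0 < \<epsilon>" and C: "\<forall>r\<in>{1 / real n .. real n}. (\<integral>\<^sup>+s\<in>{0<..<\<epsilon>}. ennreal (\<bar>l (r * s) - l s\<bar> / s) \<partial>lborel) \<le> ennreal C"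
    using l_osc n by blast
  \<comment> \<open>A cut-off below both \<epsilon> and every \<epsilon>/\<theta>(x), so that a
    single tail T bounds the plain and the scaled term for all x.\<close>
  define \<delta> where "\<delta> = \<epsilon> / real n"
  have \<delta>: "0 < \<delta>" using \<epsilon> n by (simp add: \<delta>_def)
  define T where "T = (\<integral>\<^sup>+s. ennreal (l s / s) * indicator {\<delta>..} s \<partial>lborel)"
  have T: "T < \<infinity>" unfolding T_def by (rule tail_finite[OF \<delta>])
  have inner: "(\<integral>\<^sup>+s. ennreal (\<bar>l s - l (s / \<theta> x)\<bar> / s) * indicator {0<..} s \<partial>lborel) \<le> (ennreal C + (T + T)) * indicator K x" for x
  proof (cases "x \<in> K")
    case False
    then show ?thesis using out by simp
  next
    case True
    \<comment> \<open>The term l(s/\<theta>(x)) is l(r s) with r = 1/\<theta>(x); the range [1/n, n]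
      is stable under inversion.\<close>
    have r: "1 / \<theta> x \<in> {1 / real n .. real n}"
      using bd[rule_format, of x] \<theta>_pos[of x] n by (auto simp: field_simps)
    have d1: "\<delta> \<le> \<epsilon>" using \<epsilon> n by (simp add: \<delta>_def divide_le_eq mult_left_le)
    have d2: "\<delta> \<le> \<epsilon> / \<theta> x" unfolding \<delta>_def using bd[rule_format, of x] \<theta>_pos[of x] \<epsilon> n by (intro divide_left_mono) auto
    have "(\<integral>\<^sup>+s. ennreal (\<bar>l s - l (s / \<theta> x)\<bar> / s) * indicator {0<..} s \<partial>lborel)
      \<le> (\<integral>\<^sup>+s. ennreal (\<bar>l (1 / \<theta> x * s) - l s\<bar> / s) * indicator {0<..<\<epsilon>} s
           + (ennreal (l s / s) * indicator {\<epsilon>..} s + ennreal (l (s / \<theta> x) / s) * indicator {\<epsilon>..} s) \<partial>lborel)"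
    proof (rule nn_integral_mono)
      fix s
      show "ennreal (\<bar>l s - l (s / \<theta> x)\<bar> / s) * indicator {0<..} s
        \<le> ennreal (\<bar>l (1 / \<theta> x * s) - l s\<bar> / s) * indicator {0<..<\<epsilon>} s
           + (ennreal (l s / s) * indicator {\<epsilon>..} s + ennreal (l (s / \<theta> x) / s) * indicator {\<epsilon>..} s)"
      proof (cases "0 < s \<and> \<epsilon> \<le> s")
        case True
        then have s: "0 < s" by simp
        have l1: "0 < l s" "0 < l (s / \<theta> x)" using l_pos s \<theta>_pos[of x] by auto
        have "\<bar>l s - l (s / \<theta> x)\<bar> / s \<le> (l s + l (s / \<theta> x)) / s" using l1 s by (intro divide_right_mono) auto
        then have "ennreal (\<bar>l s - l (s / \<theta> x)\<bar> / s) \<le> ennreal (l s / s + l (s / \<theta> x) / s)" by (intro ennreal_leI) (simp add: add_divide_distrib)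
        also have "\<dots> = ennreal (l s / s) + ennreal (l (s / \<theta> x) / s)" using l1 s by (intro ennreal_plus) auto
        finally show ?thesis using True by simp
      next
        case False
        then show ?thesis using \<epsilon> by (auto simp: abs_minus_commute split: split_indicator)
      qed
    qed
    also have "\<dots> = (\<integral>\<^sup>+s. ennreal (\<bar>l (1 / \<theta> x * s) - l s\<bar> / s) * indicator {0<..<\<epsilon>} s \<partial>lborel)
       + ((\<integral>\<^sup>+s. ennreal (l s / s) * indicator {\<epsilon>..} s \<partial>lborel) + (\<integral>\<^sup>+s. ennreal (l (s / \<theta> x) / s) * indicator {\<epsilon>..} s \<partial>lborel))"
      by (subst nn_integral_add, measurable, subst nn_integral_add) measurable
    also have "\<dots> \<le> ennreal C + (T + T)"
    proof (intro add_mono)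
      show "(\<integral>\<^sup>+s. ennreal (\<bar>l (1 / \<theta> x * s) - l s\<bar> / s) * indicator {0<..<\<epsilon>} s \<partial>lborel) \<le> ennreal C"
        using C r by blast
      show "(\<integral>\<^sup>+s. ennreal (l s / s) * indicator {\<epsilon>..} s \<partial>lborel) \<le> T"
        unfolding T_def using d1 by (intro nn_integral_mono mult_left_mono) (auto split: split_indicator)
      show "(\<integral>\<^sup>+s. ennreal (l (s / \<theta> x) / s) * indicator {\<epsilon>..} s \<partial>lborel) \<le> T"
        unfolding scaled_tail T_def using d2 by (intro nn_integral_mono mult_left_mono) (auto split: split_indicator)
    qed
    finally show ?thesis using True by simp
  qed
  have "(\<integral>\<^sup>+x. \<integral>\<^sup>+s. ennreal (\<bar>l s - l (s / \<theta> x)\<bar> / s) * indicator {0<..} s \<partial>lborel \<partial>dx) \<le> (\<integral>\<^sup>+x. (ennreal C + (T + T)) * indicator K x \<partial>dx)"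
    by (intro nn_integral_mono inner)
  also have "\<dots> = (ennreal C + (T + T)) * emeasure dx K" by (rule nn_integral_cmult_indicator) (simp add: sets_dx)
  also have "\<dots> < \<infinity>" using T radon_compact_finite[OF dx_radon K] by (simp add: ennreal_mult_less_top)
  finally show ?thesis .
qed

text \<open>exp L is the density, relative to N, of the image of N under (x,s) to (x, \<theta>(x)
  s): that image has mark density l(s/\<theta>(x))/s.\<close>

definition L :: "'a \<times> real \<Rightarrow> real" where
  "L q = (if 0 < snd q then ln (l (snd q / \<theta> (fst q)) / l (snd q)) else 0)"

lemma L_meas [measurable]: "L \<in> borel_measurable (borel \<Otimes>\<^sub>M borel)"
  unfolding L_def by measurable

lemma exp_L: "0 < s \<Longrightarrow> exp (L (x, s)) = l (s / \<theta> x) / l s"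
  using l_pos[of s] l_pos[of "s / \<theta> x"] \<theta>_pos[of x] by (simp add: L_def)

lemma \<rho>_exp_L: "\<rho> s * (1 - exp (L (x, s))) = indicator {0<..} s * ((l s - l (s / \<theta> x)) / s)"
  using l_pos[of s] by (cases "0 < s") (auto simp: \<rho>_def exp_L field_simps)

lemma integrable_exp_L: "integrable N (\<lambda>q. exp (L q) - 1)"
proof (rule integrableI_bounded)
  show "(\<lambda>q. exp (L q) - 1) \<in> borel_measurable N" by measurable
  have "(\<integral>\<^sup>+q. ennreal (norm (exp (L q) - 1)) \<partial>N) = (\<integral>\<^sup>+x. \<integral>\<^sup>+s. ennreal (\<rho> s) * ennreal (norm (exp (L (x, s)) - 1)) \<partial>lborel \<partial>dx)"
    by (rule nn_integral_N) measurable
  also have "\<dots> = (\<integral>\<^sup>+x. \<integral>\<^sup>+s. ennreal (\<bar>l s - l (s / \<theta> x)\<bar> / s) * indicator {0<..} s \<partial>lborel \<partial>dx)"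
  proof (intro nn_integral_cong)
    fix x s
    have "ennreal (\<rho> s) * ennreal (norm (exp (L (x, s)) - 1)) = ennreal \<bar>\<rho> s * (1 - exp (L (x, s)))\<bar>"
      using \<rho>_nonneg[of s] by (simp add: ennreal_mult' abs_mult abs_minus_commute)
    also have "\<dots> = ennreal (\<bar>l s - l (s / \<theta> x)\<bar> / s) * indicator {0<..} s"
      unfolding \<rho>_exp_L by (auto split: split_indicator)
    finally show "ennreal (\<rho> s) * ennreal (norm (exp (L (x, s)) - 1)) = ennreal (\<bar>l s - l (s / \<theta> x)\<bar> / s) * indicator {0<..} s" .
  qed
  also have "\<dots> < \<infinity>" by (rule rate_difference_finite)
  finally show "(\<integral>\<^sup>+q. ennreal (norm (exp (L q) - 1)) \<partial>N) < \<infinity>" .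
qed

text \<open>By the exponential formula the tilt exp(\<open>log_tilt L\<close>) has mean exp(-c), so
  c is the normalising constant.\<close>

definition c :: real where "c = (\<integral>q. 1 - exp (L q) \<partial>N)"

lemma integrable_one_minus_exp_L: "integrable N (\<lambda>q. 1 - exp (L q))"
  using integrable_exp_L[THEN Bochner_Integration.integrable_minus] by simp

lemma c_eq: "c = (\<integral>x. (\<integral>s. (l s - l (s / \<theta> x)) / s \<partial>restrict_space lborel {0<..}) \<partial>dx)"
proof -
  \<comment> \<open>\<open>integral_N\<close> is stated for complex integrands, hence the passage
    through \<open>complex_of_real\<close>.\<close>
  have "complex_of_real c = (\<integral>q. complex_of_real (1 - exp (L q)) \<partial>N)"
    unfolding c_def by (rule integral_complex_of_real[symmetric])
  also have "\<dots> = (\<integral>x. \<integral>s. \<rho> s *\<^sub>R complex_of_real (1 - exp (L (x, s))) \<partial>lborel \<partial>dx)"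
    by (rule integral_N) (intro integrable_of_real integrable_one_minus_exp_L)
  also have "\<dots> = (\<integral>x. \<integral>s. complex_of_real (indicator {0<..} s * ((l s - l (s / \<theta> x)) / s)) \<partial>lborel \<partial>dx)"
    by (simp only: scaleR_conv_of_real of_real_mult[symmetric] \<rho>_exp_L)
  also have "\<dots> = complex_of_real (\<integral>x. \<integral>s. indicator {0<..} s * ((l s - l (s / \<theta> x)) / s) \<partial>lborel \<partial>dx)"
    by (simp only: integral_complex_of_real)
  also have "(\<lambda>x. \<integral>s. indicator {0<..} s * ((l s - l (s / \<theta> x)) / s) \<partial>lborel) = (\<lambda>x. \<integral>s. (l s - l (s / \<theta> x)) / s \<partial>restrict_space lborel {0<..})"
    by (subst integral_restrict_space) simp_all
  finally show ?thesis by (simp only: of_real_eq_iff)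
qed

text \<open>The integrand carries exp L (cis - 1) rather than exp L cis - 1, because only the former
  is transported exactly by the substitution; the latter differs by the integrable exp L - 1,
  treated separately through c.\<close>

lemma integral_exp_L_cis:
  assumes \<phi>: "\<phi> \<in> Cc"
  shows "(\<integral>q. exp (L q) *\<^sub>R (cis (snd q * \<phi> (fst q)) - 1) \<partial>N) = (\<integral>q. cis (snd q * (\<theta> (fst q) * \<phi> (fst q))) - 1 \<partial>N)"
    and "integrable N (\<lambda>q. exp (L q) *\<^sub>R (cis (snd q * \<phi> (fst q)) - 1))"
proof -
  have "integrable N (\<lambda>q. (exp (L q) *\<^sub>R cis (snd q * \<phi> (fst q)) - 1) - complex_of_real (exp (L q) - 1))"
    by (intro Bochner_Integration.integrable_diff tilted_characteristic_functional(3) L_meas integrable_exp_L \<phi> integrable_of_real)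
  then show i1: "integrable N (\<lambda>q. exp (L q) *\<^sub>R (cis (snd q * \<phi> (fst q)) - 1))"
    by (simp add: algebra_simps scaleR_conv_of_real)
  have i2: "integrable N (\<lambda>q. cis (snd q * (\<theta> (fst q) * \<phi> (fst q))) - 1)"
    by (rule integrable_cis_minus_1[OF Cc_mult_C0pos[OF \<phi> \<theta>]])
  show "(\<integral>q. exp (L q) *\<^sub>R (cis (snd q * \<phi> (fst q)) - 1) \<partial>N) = (\<integral>q. cis (snd q * (\<theta> (fst q) * \<phi> (fst q))) - 1 \<partial>N)"
    unfolding integral_N[OF i1] integral_N[OF i2]
  proof (rule Bochner_Integration.integral_cong[OF refl])
    fix x
    let ?f = "\<lambda>s. \<rho> s *\<^sub>R exp (L (x, s)) *\<^sub>R (cis (s * \<phi> x) - 1)"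
    have "(\<integral>s. ?f s \<partial>lborel) = \<bar>\<theta> x\<bar> *\<^sub>R (\<integral>s. ?f (0 + \<theta> x * s) \<partial>lborel)"
      using \<theta>_pos[of x] by (intro lborel_integral_real_affine) simp
    also have "\<dots> = (\<integral>s. \<bar>\<theta> x\<bar> *\<^sub>R ?f (0 + \<theta> x * s) \<partial>lborel)" by (rule integral_scaleR_right[symmetric])
    also have "\<dots> = (\<integral>s. \<rho> s *\<^sub>R (cis (s * (\<theta> x * \<phi> x)) - 1) \<partial>lborel)"
    proof (rule Bochner_Integration.integral_cong[OF refl])
      fix s
      \<comment> \<open>The Jacobian \<theta>(x) cancels the scaling of the factor 1/s, and exp L
        replaces l(\<theta>(x) s) by l(s).\<close>
      have "\<bar>\<theta> x\<bar> * (\<rho> (\<theta> x * s) * exp (L (x, \<theta> x * s))) = \<rho> s"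
      proof (cases "0 < s")
        case True
        then have p: "0 < \<theta> x * s" using \<theta>_pos[of x] by simp
        then show ?thesis using True \<theta>_pos[of x] l_pos[OF p] by (simp add: \<rho>_def exp_L)
      next
        case False
        then show ?thesis using \<theta>_pos[of x] by (simp add: \<rho>_def zero_less_mult_iff)
      qed
      moreover have "cis (\<theta> x * s * \<phi> x) = cis (s * (\<theta> x * \<phi> x))" by (simp add: mult_ac)
      ultimately show "\<bar>\<theta> x\<bar> *\<^sub>R ?f (0 + \<theta> x * s) = \<rho> s *\<^sub>R (cis (s * (\<theta> x * \<phi> x)) - 1)"
        by (simp only: scaleR_scaleR add_0)
    qed
    finally show "(\<integral>s. \<rho> s *\<^sub>R exp (L (x, s)) *\<^sub>R (cis (snd (x, s) * \<phi> (fst (x, s))) - 1) \<partial>lborel)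
        = (\<integral>s. \<rho> s *\<^sub>R (cis (snd (x, s) * (\<theta> (fst (x, s)) * \<phi> (fst (x, s)))) - 1) \<partial>lborel)"
      by simp
  qed
qed

section \<open>The density of the image law and equivalence\<close>

definition dens :: "'a measure \<Rightarrow> real" where
  "dens \<eta> = exp (log_tilt L \<eta> + c)"

lemma dens_meas [measurable]: "dens \<in> borel_measurable vague_space"
  unfolding dens_def[abs_def] by measurable

theorem theta_action_law: "distr law vague_space (theta_action \<theta>) = density law (\<lambda>\<eta>. ennreal (dens \<eta>))"
proof (rule vague_measure_eqI)
  have tm: "theta_action \<theta> \<in> measurable law vague_space"
    using theta_action_measurable[OF \<theta>] by (simp only: measurable_cong_sets[OF sets_law refl])
  have dm: "dens \<in> borel_measurable law" using dens_meas by (simp only: measurable_cong_sets[OF sets_law refl])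
  have zero: "(\<lambda>_. 0) \<in> Cc" by (auto simp: Cc_def)
  have di: "integrable law dens"
  proof -
    have "integrable law (\<lambda>\<eta>. complex_of_real (exp (log_tilt L \<eta>)))"
      using tilted_characteristic_functional(1)[OF L_meas integrable_exp_L zero] by (simp add: pairing_def scaleR_conv_of_real)
    from integrable_Re[OF this] have "integrable law (\<lambda>\<eta>. exp (log_tilt L \<eta>))" by simp
    then show ?thesis by (simp add: dens_def[abs_def] exp_add)
  qed
  show "finite_measure (distr law vague_space (theta_action \<theta>))"
    using prob_space.prob_space_distr[OF prob_law tm] by (rule prob_space.finite_measure)
  show "finite_measure (density law (\<lambda>\<eta>. ennreal (dens \<eta>)))"
  proof (rule finite_measureI)
    have "emeasure (density law (\<lambda>\<eta>. ennreal (dens \<eta>))) (space law) = (\<integral>\<^sup>+\<eta>. ennreal (dens \<eta>) \<partial>law)"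
      using dm sets.top[of law] by (subst emeasure_density) (auto intro!: nn_integral_cong simp del: space_law split: split_indicator)
    also have "\<dots> = ennreal (\<integral>\<eta>. dens \<eta> \<partial>law)"
      by (intro nn_integral_eq_integral di) (simp add: dens_def)
    finally show "emeasure (density law (\<lambda>\<eta>. ennreal (dens \<eta>))) (space (density law (\<lambda>\<eta>. ennreal (dens \<eta>)))) \<noteq> \<infinity>"
      by simp
  qed
  fix \<phi> :: "'a \<Rightarrow> real" assume \<phi>: "\<phi> \<in> Cc"
  note [measurable] = pairing_measurable[OF \<phi>]
  have "(\<integral>\<eta>. cis (pairing \<phi> \<eta>) \<partial>distr law vague_space (theta_action \<theta>)) = (\<integral>\<eta>. cis (pairing \<phi> (theta_action \<theta> \<eta>)) \<partial>law)"
    by (rule integral_distr[OF tm]) measurable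
  also have "\<dots> = (\<integral>\<eta>. cis (pairing (\<lambda>x. \<theta> x * \<phi> x) \<eta>) \<partial>law)"
    by (intro Bochner_Integration.integral_cong) (auto simp: pairing_theta_action[OF \<theta> _ \<phi>])
  also have "\<dots> = exp (\<integral>q. cis (snd q * (\<theta> (fst q) * \<phi> (fst q))) - 1 \<partial>N)"
    by (rule characteristic_functional[OF Cc_mult_C0pos[OF \<phi> \<theta>]])
  also have "\<dots> = exp (\<integral>q. exp (L q) *\<^sub>R (cis (snd q * \<phi> (fst q)) - 1) \<partial>N)"
    by (simp only: integral_exp_L_cis(1)[OF \<phi>])
  \<comment> \<open>Adding and subtracting 1 separates the exponent of the tilted functional from
    the constant c; both pieces are N-integrable.\<close>
  also have "(\<integral>q. exp (L q) *\<^sub>R (cis (snd q * \<phi> (fst q)) - 1) \<partial>N)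
      = (\<integral>q. (exp (L q) *\<^sub>R cis (snd q * \<phi> (fst q)) - 1) + complex_of_real (1 - exp (L q)) \<partial>N)"
    by (intro Bochner_Integration.integral_cong) (auto simp: algebra_simps scaleR_conv_of_real)
  also have "\<dots> = (\<integral>q. exp (L q) *\<^sub>R cis (snd q * \<phi> (fst q)) - 1 \<partial>N) + complex_of_real c"
    unfolding c_def integral_complex_of_real[symmetric]
    by (intro Bochner_Integration.integral_add tilted_characteristic_functional(3) L_meas integrable_exp_L \<phi> integrable_of_real integrable_one_minus_exp_L)
  also have "exp \<dots> = exp c *\<^sub>R (\<integral>\<eta>. exp (log_tilt L \<eta>) *\<^sub>R cis (pairing \<phi> \<eta>) \<partial>law)"
    unfolding tilted_characteristic_functional(2)[OF L_meas integrable_exp_L \<phi>]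
    by (simp add: exp_add exp_of_real scaleR_conv_of_real)
  also have "\<dots> = (\<integral>\<eta>. dens \<eta> *\<^sub>R cis (pairing \<phi> \<eta>) \<partial>law)"
    unfolding integral_scaleR_right[symmetric] by (simp add: dens_def exp_add mult.commute)
  also have "\<dots> = (\<integral>\<eta>. cis (pairing \<phi> \<eta>) \<partial>density law (\<lambda>\<eta>. ennreal (dens \<eta>)))"
    by (rule integral_density[symmetric]) (auto simp: dens_def[symmetric] dm, simp add: dens_def)
  finally show "(\<integral>\<eta>. cis (pairing \<phi> \<eta>) \<partial>distr law vague_space (theta_action \<theta>)) = (\<integral>\<eta>. cis (pairing \<phi> \<eta>) \<partial>density law (\<lambda>\<eta>. ennreal (dens \<eta>)))" .
qed simp_all

text \<open>The density is an exponential, hence strictly positive everywhere, so null sets agree in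
  both directions.\<close>

lemma equivalent_measures:
  shows "absolutely_continuous law (distr law vague_space (theta_action \<theta>))"
    and "absolutely_continuous (distr law vague_space (theta_action \<theta>)) law"
proof -
  have [measurable]: "dens \<in> borel_measurable law" using dens_meas by (simp only: measurable_cong_sets[OF sets_law refl])
  show "absolutely_continuous law (distr law vague_space (theta_action \<theta>))"
    unfolding theta_action_law by (rule absolutely_continuousI_density) measurable
  show "absolutely_continuous (distr law vague_space (theta_action \<theta>)) law"
    unfolding theta_action_law absolutely_continuous_def
  proof
    fix A assume "A \<in> null_sets (density law (\<lambda>\<eta>. ennreal (dens \<eta>)))"
    moreover have "(\<lambda>\<eta>. ennreal (dens \<eta>)) \<in> borel_measurable law" by measurable
    ultimately have A: "A \<in> sets law" and "AE \<eta> in law. \<eta> \<in> A \<longrightarrow> ennreal (dens \<eta>) = 0"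
      using null_sets_density_iff by blast+
    from this(2) have "AE \<eta> in law. \<eta> \<notin> A"
    proof (rule eventually_mono)
      fix \<eta> assume *: "\<eta> \<in> A \<longrightarrow> ennreal (dens \<eta>) = 0"
      have "0 < dens \<eta>" by (simp add: dens_def)
      then show "\<eta> \<notin> A" using * by (auto simp: ennreal_eq_0_iff)
    qed
    then show "A \<in> null_sets law" using AE_iff_null_sets[OF A] by blast
  qed
qed

lemma log_tilt_discrete_radon:
  assumes \<eta>: "\<eta> \<in> discrete_radon" and fin: "atom_sum (\<lambda>q. ennreal \<bar>L q\<bar>) \<eta> < \<infinity>"
  shows "integrable (count_space (atoms \<eta>)) (\<lambda>x. L (x, atom_mass \<eta> x))"
    and "log_tilt L \<eta> = (\<integral>x. L (x, atom_mass \<eta> x) \<partial>count_space (atoms \<eta>))"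
proof -
  have "(\<integral>\<^sup>+x. ennreal \<bar>L (x, atom_mass \<eta> x)\<bar> \<partial>count_space (atoms \<eta>)) < \<infinity>"
    using fin by (subst (asm) atom_sum_discrete_radon[OF \<eta>]) simp_all
  then show i: "integrable (count_space (atoms \<eta>)) (\<lambda>x. L (x, atom_mass \<eta> x))"
    by (intro integrableI_bounded) simp_all
  show "log_tilt L \<eta> = (\<integral>x. L (x, atom_mass \<eta> x) \<partial>count_space (atoms \<eta>))"
    unfolding log_tilt_def real_lebesgue_integral_def[OF i]
    by (subst (1 2) atom_sum_discrete_radon[OF \<eta>]) simp_all
qed

lemma integrable_rate_difference:
  "integrable (dx \<Otimes>\<^sub>M restrict_space lborel {0<..}) (\<lambda>(x, s). (l s - l (s / \<theta> x)) / s)"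
proof (rule integrableI_bounded)
  let ?R = "restrict_space lborel {0<..} :: real measure"
  interpret R: sigma_finite_measure ?R by (rule sigma_finite_measure_restrict_space[OF sigma_finite_lborel]) simp
  have id: "(\<lambda>q. (fst q, snd q)) \<in> measurable (dx \<Otimes>\<^sub>M ?R) (borel \<Otimes>\<^sub>M borel)"
  proof (rule measurable_Pair)
    show "fst \<in> measurable (dx \<Otimes>\<^sub>M ?R) borel" by measurable
    have "(\<lambda>s. s) \<in> measurable ?R borel" by (rule measurable_restrict_space1) simp
    then show "snd \<in> measurable (dx \<Otimes>\<^sub>M ?R) borel" by (rule measurable_compose[OF measurable_snd])
  qed
  have "(\<lambda>q. (l (snd q) - l (snd q / \<theta> (fst q))) / snd q) \<in> borel_measurable (borel \<Otimes>\<^sub>M borel)" by measurable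
  from measurable_compose[OF id this]
  show m: "(\<lambda>(x, s). (l s - l (s / \<theta> x)) / s) \<in> borel_measurable (dx \<Otimes>\<^sub>M ?R)" by (simp add: split_beta')
  have "(\<integral>\<^sup>+q. ennreal (norm (case q of (x, s) \<Rightarrow> (l s - l (s / \<theta> x)) / s)) \<partial>(dx \<Otimes>\<^sub>M ?R))
     = (\<integral>\<^sup>+x. \<integral>\<^sup>+s. ennreal (norm ((l s - l (s / \<theta> x)) / s)) \<partial>?R \<partial>dx)"
    using m by (subst R.nn_integral_fst[symmetric]) simp_all
  also have "\<dots> = (\<integral>\<^sup>+x. \<integral>\<^sup>+s. ennreal (\<bar>l s - l (s / \<theta> x)\<bar> / s) * indicator {0<..} s \<partial>lborel \<partial>dx)"
    by (intro nn_integral_cong, subst nn_integral_restrict_space) (auto intro!: nn_integral_cong split: split_indicator)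
  also have "\<dots> < \<infinity>" by (rule rate_difference_finite)
  finally show "(\<integral>\<^sup>+q. ennreal (norm (case q of (x, s) \<Rightarrow> (l s - l (s / \<theta> x)) / s)) \<partial>(dx \<Otimes>\<^sub>M ?R)) < \<infinity>" .
qed

text \<open>Almost everywhere uniqueness identifies the derivative with \<open>dens\<close>. On a
  discrete measure with absolutely convergent series, \<open>log_tilt L\<close> is an integral over
  the counting measure of the atoms, which is then translated into an unordered infinite
  sum.\<close>

lemma RN_deriv_law:
  "AE \<eta> in law. \<eta> \<in> discrete_radon \<longrightarrow>
     Infinite_Sum.abs_summable_on (\<lambda>x. ln (l (atom_mass \<eta> x / \<theta> x) / l (atom_mass \<eta> x))) (atoms \<eta>) \<and>
     RN_deriv law (distr law vague_space (theta_action \<theta>)) \<eta> = ennreal (exp (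
        (\<Sum>\<^sub>\<infinity>x\<in>atoms \<eta>. ln (l (atom_mass \<eta> x / \<theta> x) / l (atom_mass \<eta> x))) +
        (\<integral>x. (\<integral>s. (l s - l (s / \<theta> x)) / s \<partial>restrict_space lborel {0<..}) \<partial>dx)))"
proof -
  interpret law: prob_space law by (rule prob_law)
  have dm: "(\<lambda>\<eta>. ennreal (dens \<eta>)) \<in> borel_measurable law"
    using dens_meas by (simp only: measurable_cong_sets[OF sets_law refl] measurable_compose[OF _ measurable_ennreal])
  have "AE \<eta> in law. ennreal (dens \<eta>) = RN_deriv law (distr law vague_space (theta_action \<theta>)) \<eta>"
    by (rule law.RN_deriv_unique[OF dm theta_action_law[symmetric]])
  with AE_law_atom_sum_finite[OF L_meas integrable_exp_L] show ?thesis
  proof eventually_elim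
    case (elim \<eta>)
    show ?case
    proof (rule impI)
      assume \<eta>: "\<eta> \<in> discrete_radon"
      let ?f = "\<lambda>x. ln (l (atom_mass \<eta> x / \<theta> x) / l (atom_mass \<eta> x))"
      have eq: "L (x, atom_mass \<eta> x) = ?f x" if "x \<in> atoms \<eta>" for x
        using atom_mass_pos[OF discrete_radonD[OF \<eta>] that] by (simp add: L_def)
      have i: "integrable (count_space (atoms \<eta>)) ?f"
        using log_tilt_discrete_radon(1)[OF \<eta> elim(1)] by (rule Bochner_Integration.integrable_cong[OF refl, THEN iffD1, rotated]) (simp add: eq)
      then have a: "Infinite_Set_Sum.abs_summable_on ?f (atoms \<eta>)" by (simp only: Infinite_Set_Sum.abs_summable_on_def)
      have "log_tilt L \<eta> = (\<integral>x. ?f x \<partial>count_space (atoms \<eta>))"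
        unfolding log_tilt_discrete_radon(2)[OF \<eta> elim(1)] by (rule Bochner_Integration.integral_cong) (simp_all add: eq)
      also have "\<dots> = infsetsum ?f (atoms \<eta>)" by (simp only: infsetsum_def)
      also have "\<dots> = (\<Sum>\<^sub>\<infinity>x\<in>atoms \<eta>. ?f x)" by (rule infsetsum_infsum[OF a])
      finally have lt: "log_tilt L \<eta> = (\<Sum>\<^sub>\<infinity>x\<in>atoms \<eta>. ?f x)" .
      show "Infinite_Sum.abs_summable_on ?f (atoms \<eta>) \<and>
         RN_deriv law (distr law vague_space (theta_action \<theta>)) \<eta> = ennreal (exp ((\<Sum>\<^sub>\<infinity>x\<in>atoms \<eta>. ?f x) +
           (\<integral>x. (\<integral>s. (l s - l (s / \<theta> x)) / s \<partial>restrict_space lborel {0<..}) \<partial>dx)))"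
      proof
        show "Infinite_Sum.abs_summable_on ?f (atoms \<eta>)" using a by (simp only: abs_summable_equivalent)
        show "RN_deriv law (distr law vague_space (theta_action \<theta>)) \<eta> = ennreal (exp ((\<Sum>\<^sub>\<infinity>x\<in>atoms \<eta>. ?f x) +
           (\<integral>x. (\<integral>s. (l s - l (s / \<theta> x)) / s \<partial>restrict_space lborel {0<..}) \<partial>dx)))"
          unfolding elim(2)[symmetric] dens_def lt c_eq ..
      qed
    qed
  qed
qed

end

theorem mainTheorem1:
  fixes dx :: "'a::heine_borel measure" and l :: "real \<Rightarrow> real" and \<theta> :: "'a \<Rightarrow> real"
  assumes X_conn: "connected (UNIV :: 'a set)"
    and X_noncompact: "\<not> compact (UNIV :: 'a set)"
    and dx_radon: "dx \<in> radon_measures"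
    and dx_nonatomic: "\<forall>x. emeasure dx {x} = 0"
    and dx_support: "\<forall>U. open U \<and> U \<noteq> {} \<longrightarrow> emeasure dx U > 0"
    and l_meas: "l \<in> borel_measurable (restrict_space lborel {0<..})"
    and a: "set_integrable lborel {0<..} (\<lambda>s. l s * min 1 (1 / s))"
    and b: "\<forall>s>0. l s > 0"
    and c: "\<forall>n::nat. n \<ge> 1 \<longrightarrow> (\<exists>\<epsilon>>0. \<exists>C::real. \<forall>r\<in>{1 / real n .. real n}.
              (\<integral>\<^sup>+s\<in>{0<..<\<epsilon>}. ennreal (\<bar>l (r * s) - l s\<bar> / s) \<partial>lborel) \<le> ennreal C)"
    and theta: "\<theta> \<in> C0pos"
  shows "(\<forall>\<eta>\<in>discrete_radon. theta_action \<theta> \<eta> \<in> discrete_radon) \<and>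
    (let \<mu> = levy_law dx (levy_intensity l);
         \<mu>\<theta> = distr \<mu> vague_space (theta_action \<theta>)
     in absolutely_continuous \<mu> \<mu>\<theta> \<and> absolutely_continuous \<mu>\<theta> \<mu> \<and>
        integrable (dx \<Otimes>\<^sub>M restrict_space lborel {0<..})
          (\<lambda>(x, s). (l s - l (s / \<theta> x)) / s) \<and>
        (AE \<eta> in \<mu>. \<eta> \<in> discrete_radon \<longrightarrow>
           Infinite_Sum.abs_summable_on
             (\<lambda>x. ln (l (atom_mass \<eta> x / \<theta> x) / l (atom_mass \<eta> x))) (atoms \<eta>) \<and>
           RN_deriv \<mu> \<mu>\<theta> \<eta> = ennreal (exp (
              (\<Sum>\<^sub>\<infinity>x\<in>atoms \<eta>. ln (l (atom_mass \<eta> x / \<theta> x) / l (atom_mass \<eta> x))) +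
              (\<integral>x. (\<integral>s. (l s - l (s / \<theta> x)) / s \<partial>restrict_space lborel {0<..}) \<partial>dx)))))"
proof -
  \<comment> \<open>Measurability of l is known only on the open half-line, while the locale asks
    for it on the whole line. Every expression evaluates l at positive arguments, where l and l'
    agree, so the conclusions transfer back.\<close>
  define l' where "l' s = (if 0 < s then l s else 0)" for s
  let ?R = "restrict_space lborel {0<..} :: real measure"
  have l': "l' s = l s" if "0 < s" for s using that by (simp add: l'_def)
  have \<theta>_pos: "0 < \<theta> x" for x using theta by (simp add: C0pos_def)
  interpret levy_multiplier dx l' \<theta>
  proof
    show "dx \<in> radon_measures" by fact
    show "emeasure dx {x} = 0" for x using dx_nonatomic by blast
    have "emeasure dx UNIV > 0" using dx_support by blast
    then show "emeasure dx UNIV \<noteq> 0" by simp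
    have "(\<lambda>s. indicator {0<..} s *\<^sub>R l s) \<in> borel_measurable lborel"
      using l_meas by (subst (asm) borel_measurable_restrict_space_iff) simp_all
    moreover have "(\<lambda>s. indicator {0<..} s *\<^sub>R l s) = l'" by (auto simp: l'_def)
    ultimately show "l' \<in> borel_measurable borel" by simp
    show "0 < l' s" if "0 < s" for s using b that by (simp add: l')
    have "(\<integral>\<^sup>+s. ennreal (l' s * min 1 (1 / s)) * indicator {0<..} s \<partial>lborel)
        = (\<integral>\<^sup>+s. ennreal (norm (indicator {0<..} s *\<^sub>R (l s * min 1 (1 / s)))) \<partial>lborel)"
    proof (rule nn_integral_cong)
      fix s :: real
      have "0 < l s" if "0 < s" using b that by blast
      then show "ennreal (l' s * min 1 (1 / s)) * indicator {0<..} s = ennreal (norm (indicator {0<..} s *\<^sub>R (l s * min 1 (1 / s))))"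
        by (cases "0 < s") (simp_all add: l' abs_mult)
    qed
    also have "\<dots> < \<infinity>" using a unfolding set_integrable_def integrable_iff_bounded by blast
    finally show "(\<integral>\<^sup>+s. ennreal (l' s * min 1 (1 / s)) * indicator {0<..} s \<partial>lborel) < \<infinity>" .
    show "\<forall>n::nat. n \<ge> 1 \<longrightarrow> (\<exists>\<epsilon>>0. \<exists>C::real. \<forall>r\<in>{1 / real n .. real n}.
              (\<integral>\<^sup>+s\<in>{0<..<\<epsilon>}. ennreal (\<bar>l' (r * s) - l' s\<bar> / s) \<partial>lborel) \<le> ennreal C)"
    proof (intro allI impI)
      fix n :: nat assume n: "n \<ge> 1"
      obtain \<epsilon> C where \<epsilon>: "0 < \<epsilon>" and C: "\<forall>r\<in>{1 / real n .. real n}. (\<integral>\<^sup>+s\<in>{0<..<\<epsilon>}. ennreal (\<bar>l (r * s) - l s\<bar> / s) \<partial>lborel) \<le> ennreal C"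
        using c n by blast
      have "(\<integral>\<^sup>+s\<in>{0<..<\<epsilon>}. ennreal (\<bar>l' (r * s) - l' s\<bar> / s) \<partial>lborel) = (\<integral>\<^sup>+s\<in>{0<..<\<epsilon>}. ennreal (\<bar>l (r * s) - l s\<bar> / s) \<partial>lborel)"
        if "r \<in> {1 / real n .. real n}" for r
      proof (rule nn_integral_cong)
        fix s
        have "0 < 1 / real n" using n by simp
        then have r: "0 < r" using that unfolding atLeastAtMost_iff by linarith
        show "ennreal (\<bar>l' (r * s) - l' s\<bar> / s) * indicator {0<..<\<epsilon>} s = ennreal (\<bar>l (r * s) - l s\<bar> / s) * indicator {0<..<\<epsilon>} s"
          using r by (cases "0 < s") (simp_all add: l')
      qed
      then show "\<exists>\<epsilon>>0. \<exists>C::real. \<forall>r\<in>{1 / real n .. real n}. (\<integral>\<^sup>+s\<in>{0<..<\<epsilon>}. ennreal (\<bar>l' (r * s) - l' s\<bar> / s) \<partial>lborel) \<le> ennreal C"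
        using \<epsilon> C by (intro exI[of _ \<epsilon>] conjI exI[of _ C]) simp_all
    qed
    show "\<theta> \<in> C0pos" by fact
  qed
  have diff_eq: "(l s - l (s / \<theta> x)) / s = (l' s - l' (s / \<theta> x)) / s" if "0 < s" for s x
    using that \<theta>_pos[of x] by (simp add: l')
  have "levy_intensity l = levy_intensity l'"
  proof -
    have lm: "(\<lambda>s. ennreal (l s / s)) \<in> borel_measurable ?R"
    proof -
      have "(\<lambda>s. s) \<in> borel_measurable ?R" by (rule measurable_restrict_space1) simp
      from measurable_compose[OF borel_measurable_divide[OF assms(6) this] measurable_ennreal] show ?thesis .
    qed
    have "(\<lambda>s. ennreal (l' s / s)) \<in> borel_measurable ?R" by (rule measurable_restrict_space1) measurable
    moreover have "AE s in ?R. ennreal (l s / s) = ennreal (l' s / s)"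
      by (intro AE_I2) (simp add: space_restrict_space l')
    ultimately show ?thesis unfolding levy_intensity_def by (intro density_cong lm)
  qed
  then have law: "levy_law dx (levy_intensity l) = law" by (simp add: levy_law_eq_law)
  have iterated: "(\<integral>x. (\<integral>s. (l s - l (s / \<theta> x)) / s \<partial>?R) \<partial>dx) = (\<integral>x. (\<integral>s. (l' s - l' (s / \<theta> x)) / s \<partial>?R) \<partial>dx)"
    by (intro Bochner_Integration.integral_cong refl) (simp add: space_restrict_space diff_eq)
  have int: "integrable (dx \<Otimes>\<^sub>M ?R) (\<lambda>(x, s). (l s - l (s / \<theta> x)) / s)"
    using integrable_rate_difference
    by (rule Bochner_Integration.integrable_cong[OF refl, THEN iffD1, rotated])
      (auto simp: space_pair_measure space_restrict_space diff_eq)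
  have ae: "AE \<eta> in law. \<eta> \<in> discrete_radon \<longrightarrow>
       Infinite_Sum.abs_summable_on (\<lambda>x. ln (l (atom_mass \<eta> x / \<theta> x) / l (atom_mass \<eta> x))) (atoms \<eta>) \<and>
       RN_deriv law (distr law vague_space (theta_action \<theta>)) \<eta> = ennreal (exp (
          (\<Sum>\<^sub>\<infinity>x\<in>atoms \<eta>. ln (l (atom_mass \<eta> x / \<theta> x) / l (atom_mass \<eta> x))) +
          (\<integral>x. (\<integral>s. (l s - l (s / \<theta> x)) / s \<partial>?R) \<partial>dx)))"
    using RN_deriv_law
  proof eventually_elim
    case (elim \<eta>)
    show ?case
    proof
      assume \<eta>: "\<eta> \<in> discrete_radon"
      let ?f = "\<lambda>l x. ln (l (atom_mass \<eta> x / \<theta> x) / l (atom_mass \<eta> x))"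
      \<comment> \<open>Atoms have positive mass and \<theta> is positive, so both arguments of l
        are positive.\<close>
      have f: "?f l x = ?f l' x" if "x \<in> atoms \<eta>" for x
        using atom_mass_pos[OF discrete_radonD[OF \<eta>] that] \<theta>_pos[of x] by (simp add: l')
      have "Infinite_Sum.abs_summable_on (?f l) (atoms \<eta>) \<longleftrightarrow> Infinite_Sum.abs_summable_on (?f l') (atoms \<eta>)"
        by (rule summable_on_cong) (simp only: f)
      moreover have "(\<Sum>\<^sub>\<infinity>x\<in>atoms \<eta>. ?f l x) = (\<Sum>\<^sub>\<infinity>x\<in>atoms \<eta>. ?f l' x)"
        by (rule infsum_cong) (simp only: f)
      ultimately show "Infinite_Sum.abs_summable_on (?f l) (atoms \<eta>) \<and>
         RN_deriv law (distr law vague_space (theta_action \<theta>)) \<eta> = ennreal (exp ((\<Sum>\<^sub>\<infinity>x\<in>atoms \<eta>. ?f l x) +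
           (\<integral>x. (\<integral>s. (l s - l (s / \<theta> x)) / s \<partial>?R) \<partial>dx)))"
        using elim \<eta> unfolding iterated by simp
    qed
  qed
  show ?thesis
    unfolding Let_def law
    using theta_action_discrete_radon[OF theta] equivalent_measures int ae by blast
qed

end
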